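(* Let $p$ be a prime, let $G$ be a finite $p$-soluble group with $p$ dividing $|G|$, and let $P$ be a Sylow $p$-subgroup of $G$. Let $N$ be a normal subgroup of $G$ such that $G/N$ is $p$-supersoluble. Then $G$ is $p$-supersoluble if and only if there is some fixed set $\mathcal{M}_d(P)=\{P_1,\dots,P_d\}$ of $d$ maximal subgroups of $P$ with $\bigcap_{i=1}^d P_i=\Phi(P)$ (where $p^d=|P/\Phi(P)|$) such that $P_i\cap N$ satisfies the $\Pi$-property in $G$ for every $i=1,\dots,d$.
   Context: All groups are finite. A group is $p$-soluble if each of its chief factors is either a $p$-group or a $p'$-group; it is $p$-supersoluble if each of its chief factors is either of order $p$ or a $p'$-group. For a finite $p$-group $P$, $\Phi(P)$ denotes its Frattini subgroup and $d$ is the smallest number of generators of $P$, i.e. $p^d=|P/\Phi(P)|$. The notation $\mathcal{M}_d(P)=\{P_1,\dots,P_d\}$ means a set of $d$ maximal subgroups of $P$ such that $\bigcap_{i=1}^d P_i=\Phi(P)$ (such a set is not unique in general). For a group $X$, $\pi(X)$ is the set of primes dividing $|X|$. For a set of primes $\pi$, an integer is a $\pi$-number if all its prime divisors belong to $\pi$. A subgroup $H$ of a group $G$ satisfies the $\Pi$-property in $G$ if for every chief factor $L/K$ of $G$, the index $|G/K : N_{G/K}(HK/K\cap L/K)|$ is a $\pi(HK/K\cap L/K)$-number. *)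

theory Defs
  imports "HOL-Algebra.Group_Action" "HOL-Computational_Algebra.Primes"
begin

definition chief_factor :: "('a, 'b) monoid_scheme \<Rightarrow> 'a set \<Rightarrow> 'a set \<Rightarrow> bool" where
  "chief_factor G L K \<longleftrightarrow> L \<lhd> G \<and> K \<lhd> G \<and> K \<subset> L \<and>
     (\<forall>M. M \<lhd> G \<longrightarrow> K \<subseteq> M \<longrightarrow> M \<subseteq> L \<longrightarrow> M = K \<or> M = L)"

text \<open>The predicates below are meant for finite groups.  For an infinite group the library's
  \<open>order\<close> is \<open>0\<close>, which satisfies none of the three conditions on chief factors
  used here.\<close>

definition p_group :: "nat \<Rightarrow> ('a, 'b) monoid_scheme \<Rightarrow> bool" where
  "p_group p X \<longleftrightarrow> (\<exists>n. order X = p ^ n)"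

definition p'_group :: "nat \<Rightarrow> ('a, 'b) monoid_scheme \<Rightarrow> bool" where
  "p'_group p X \<longleftrightarrow> \<not> p dvd order X"

definition p_soluble :: "nat \<Rightarrow> ('a, 'b) monoid_scheme \<Rightarrow> bool" where
  "p_soluble p G \<longleftrightarrow> (\<forall>L K. chief_factor G L K \<longrightarrow>
     p_group p (G\<lparr>carrier := L\<rparr> Mod K) \<or> p'_group p (G\<lparr>carrier := L\<rparr> Mod K))"

definition p_supersoluble :: "nat \<Rightarrow> ('a, 'b) monoid_scheme \<Rightarrow> bool" where
  "p_supersoluble p G \<longleftrightarrow> (\<forall>L K. chief_factor G L K \<longrightarrow>
     order (G\<lparr>carrier := L\<rparr> Mod K) = p \<or> p'_group p (G\<lparr>carrier := L\<rparr> Mod K))"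

definition sylow_subgroup :: "nat \<Rightarrow> 'a set \<Rightarrow> ('a, 'b) monoid_scheme \<Rightarrow> bool" where
  "sylow_subgroup p P G \<longleftrightarrow> subgroup P G \<and> card P = p ^ multiplicity p (order G)"

definition maximal_subgroup :: "'a set \<Rightarrow> ('a, 'b) monoid_scheme \<Rightarrow> bool" where
  "maximal_subgroup M G \<longleftrightarrow> subgroup M G \<and> M \<noteq> carrier G \<and>
     (\<forall>H. subgroup H G \<longrightarrow> M \<subseteq> H \<longrightarrow> H = M \<or> H = carrier G)"

text \<open>Intersecting with the carrier makes the Frattini subgroup of a group without maximal
  subgroups the whole group, and lets the empty family be admissible for the trivial group.\<close>

definition frattini :: "('a, 'b) monoid_scheme \<Rightarrow> 'a set" where
  "frattini G = carrier G \<inter> \<Inter>{M. maximal_subgroup M G}"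

definition maximal_family :: "('a, 'b) monoid_scheme \<Rightarrow> nat \<Rightarrow> 'a set set \<Rightarrow> bool" where
  "maximal_family P d \<M> \<longleftrightarrow> finite \<M> \<and> card \<M> = d \<and>
     (\<forall>M\<in>\<M>. maximal_subgroup M P) \<and> carrier P \<inter> \<Inter>\<M> = frattini P"

definition pi_number :: "nat set \<Rightarrow> nat \<Rightarrow> bool" where
  "pi_number \<pi> n \<longleftrightarrow> (\<forall>q. Factorial_Ring.prime q \<longrightarrow> q dvd n \<longrightarrow> q \<in> \<pi>)"

text \<open>In the following definition \<open>A\<close> is \<open>HK/K \<inter> L/K\<close>, as a set of cosets inside
  \<open>G Mod K\<close>; the number of cosets is the index of its normalizer in \<open>G Mod K\<close>.\<close>

definition Pi_property :: "'a set \<Rightarrow> ('a, 'b) monoid_scheme \<Rightarrow> bool" where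
  "Pi_property H G \<longleftrightarrow> (\<forall>L K. chief_factor G L K \<longrightarrow>
     (let A = carrier (G\<lparr>carrier := H <#>\<^bsub>G\<^esub> K\<rparr> Mod K) \<inter> carrier (G\<lparr>carrier := L\<rparr> Mod K)
      in pi_number {q. Factorial_Ring.prime q \<and> q dvd card A}
           (card (rcosets\<^bsub>G Mod K\<^esub> (normalizer (G Mod K) A)))))"

end

theory Submission
  imports Defs "HOL-Algebra.SndIsomorphismGrp" "HOL-Algebra.Sylow" "HOL-Number_Theory.Residue_Primitive_Roots"
begin

text \<open>
  If \<open>G\<close> is \<open>p\<close>-supersoluble, every \<open>p\<close>-subgroup meets every chief factor trivially or covers it, so any
  admissible family of maximal subgroups of \<open>P\<close> will do.

  For the converse, the \<open>\<Pi>\<close>-property makes \<open>(P\<^sub>i \<inter> L) K\<close> normal in \<open>G\<close> for every chief factor \<open>L / K\<close>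
  with \<open>L \<le> N\<close>, because \<open>P\<close> normalizes \<open>P\<^sub>i\<close>; so \<open>P\<^sub>i \<inter> L\<close> either covers \<open>L / K\<close> or is contained in
  \<open>K\<close>.  Let \<open>K \<le> N\<close> be a maximal normal subgroup of \<open>G\<close> with \<open>P \<inter> K \<le> \<Phi>(P)\<close>.  In \<open>G / K\<close> every minimal
  normal \<open>p\<close>-subgroup below \<open>N / K\<close> then has order \<open>p\<close> and avoids some maximal subgroup of the Sylow
  subgroup.  Averaging the projection onto it over the cosets of \<open>P\<close> gives a \<open>G\<close>-invariant complement
  in \<open>O\<^sub>p(N / K)\<close>, so \<open>O\<^sub>p(N / K)\<close> is a product of normal subgroups of order \<open>p\<close>, hence central in the
  Sylow subgroup.  As \<open>O\<^sub>p(N / K)\<close> contains its centralizer in \<open>N / K\<close>, it is a Sylow subgroup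
  of \<open>N / K\<close>, and \<open>G / K\<close> is \<open>p\<close>-supersoluble.

  The chief factors below \<open>K\<close> are treated from the top.  For such a \<open>p\<close>-chief factor \<open>R\<close> (modulo the lower
  term) let \<open>D\<close> be the centralizer of all chief factors of order \<open>p\<close> above \<open>R\<close>.  Then \<open>G / D\<close> is abelian
  of exponent dividing \<open>p - 1\<close> and \<open>D / R\<close> has a normal \<open>p\<close>-complement \<open>E / R\<close>.  If \<open>E\<close> did not centralize
  \<open>R\<close>, then \<open>R\<close> would be complemented in \<open>G\<close>, which \<open>R \<le> \<Phi>(P)\<close> excludes; so \<open>D\<close> centralizes \<open>R\<close> and \<open>G\<close> acts
  on \<open>R\<close> irreducibly by commuting maps of order dividing \<open>p - 1\<close>.  These have eigenvectors, so \<open>|R| = p\<close>.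
\<close>

subsection \<open>Subgroups, conjugation and chief factors\<close>

text \<open>The subgroup \<open>\<Phi>(P)\<close> need not be normal in \<open>G\<close> and so
  cannot be divided out; \<open>K\<close> takes its place. Its maximality is used twice: it excludes
  nontrivial normal p'-subgroups of \<open>G / K\<close> inside \<open>N / K\<close>, whose
  preimages would meet \<open>P\<close> in the same subgroup as \<open>K\<close>, and it provides
  for each minimal normal p-subgroup of \<open>G / K\<close> below \<open>N / K\<close> a member of
  the family that does not contain the Sylow part of its preimage. Below \<open>K\<close> the
  \<Pi>-property says nothing: every member of the family contains \<open>P \<inter> K\<close> and
  hence covers each p-chief factor there. All that remains is that \<open>P \<inter> K\<close>
  consists of nongenerators of \<open>P\<close>, and the argument becomes one of saturation, as for
  supersolubility of \<open>G\<close> modulo its Frattini subgroup. The three complements that occur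
  (of a central section, of a minimal normal subgroup, inside a normal p-subgroup) have one source:
  a product over coset representatives gives a crossed homomorphism into an abelian normal subgroup
  \<open>R\<close> that is a power map on \<open>R\<close> with exponent prime to
  \<open>|R|\<close>; its kernel is the complement.\<close>

definition (in group) conjugate :: "'a \<Rightarrow> 'a \<Rightarrow> 'a" where
  "conjugate g x = g \<otimes> x \<otimes> inv g"

locale finite_group = group +
  assumes finite_carrier: "finite (carrier G)"

context group
begin

lemma mult_inv_cancel [simp]:
  "x \<in> carrier G \<Longrightarrow> y \<in> carrier G \<Longrightarrow> x \<otimes> (inv x \<otimes> y) = y"
  "x \<in> carrier G \<Longrightarrow> y \<in> carrier G \<Longrightarrow> inv x \<otimes> (x \<otimes> y) = y"
  by (simp_all add: m_assoc[symmetric])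

lemma conjugate_closed [simp, intro]:
  "g \<in> carrier G \<Longrightarrow> x \<in> carrier G \<Longrightarrow> conjugate g x \<in> carrier G"
  by (simp add: conjugate_def)

lemma conjugate_mult:
  "g \<in> carrier G \<Longrightarrow> x \<in> carrier G \<Longrightarrow> y \<in> carrier G \<Longrightarrow>
    conjugate g (x \<otimes> y) = conjugate g x \<otimes> conjugate g y"
  by (simp add: conjugate_def m_assoc)

lemma conjugate_conjugate:
  "g \<in> carrier G \<Longrightarrow> h \<in> carrier G \<Longrightarrow> x \<in> carrier G \<Longrightarrow>
    conjugate g (conjugate h x) = conjugate (g \<otimes> h) x"
  by (simp add: conjugate_def m_assoc inv_mult_group)

lemma conjugate_one [simp]: "g \<in> carrier G \<Longrightarrow> conjugate g \<one> = \<one>"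
  by (simp add: conjugate_def)

lemma one_conjugate [simp]: "x \<in> carrier G \<Longrightarrow> conjugate \<one> x = x"
  by (simp add: conjugate_def)

lemma conjugate_inv:
  "g \<in> carrier G \<Longrightarrow> x \<in> carrier G \<Longrightarrow> conjugate g (inv x) = inv (conjugate g x)"
  by (simp add: conjugate_def inv_mult_group m_assoc)

lemma conjugate_inverse [simp]:
  "g \<in> carrier G \<Longrightarrow> x \<in> carrier G \<Longrightarrow> conjugate g (conjugate (inv g) x) = x"
  "g \<in> carrier G \<Longrightarrow> x \<in> carrier G \<Longrightarrow> conjugate (inv g) (conjugate g x) = x"
  by (simp_all add: conjugate_conjugate)

lemma conjugate_eq_iff:
  "g \<in> carrier G \<Longrightarrow> x \<in> carrier G \<Longrightarrow> y \<in> carrier G \<Longrightarrow>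
    conjugate g x = conjugate g y \<longleftrightarrow> x = y"
  by (metis conjugate_inverse(2))

lemma conjugate_pow:
  "g \<in> carrier G \<Longrightarrow> x \<in> carrier G \<Longrightarrow> conjugate g (x [^] (n::nat)) = conjugate g x [^] n"
  by (induction n) (simp_all add: conjugate_mult)

lemma conjugate_fixed_iff:
  "g \<in> carrier G \<Longrightarrow> x \<in> carrier G \<Longrightarrow> conjugate g x = x \<longleftrightarrow> g \<otimes> x = x \<otimes> g"
  unfolding conjugate_def by (metis inv_solve_right m_closed)

lemma conjugate_subgroup: "subgroup H G \<Longrightarrow> g \<in> H \<Longrightarrow> x \<in> H \<Longrightarrow> conjugate g x \<in> H"
  by (simp add: conjugate_def subgroup.m_closed subgroup.m_inv_closed)

lemma normal_iff_conjugate: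
  "H \<lhd> G \<longleftrightarrow> subgroup H G \<and> (\<forall>g\<in>carrier G. \<forall>x\<in>H. conjugate g x \<in> H)"
  by (simp add: normal_inv_iff conjugate_def)

lemma normal_subgroup: "H \<lhd> G \<Longrightarrow> subgroup H G"
  by (simp add: normal_imp_subgroup)

lemma normal_conjugate: "H \<lhd> G \<Longrightarrow> g \<in> carrier G \<Longrightarrow> x \<in> H \<Longrightarrow> conjugate g x \<in> H"
  by (simp add: normal_iff_conjugate)

lemma normal_carrier: "carrier G \<lhd> G"
  by (simp add: normal_iff_conjugate subgroup_self)

lemma mem_set_mult: "x \<in> H <#> K \<longleftrightarrow> (\<exists>h\<in>H. \<exists>k\<in>K. x = h \<otimes> k)"
  by (auto simp: set_mult_def)

lemma subgroup_set_mult: "subgroup H G \<Longrightarrow> K \<lhd> G \<Longrightarrow> subgroup (H <#> K) G"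
  by (metis commut_normal second_isomorphism_grp.intro second_isomorphism_grp_axioms.intro
      second_isomorphism_grp.normal_set_mult_subgroup)

lemma normal_set_mult: "H \<lhd> G \<Longrightarrow> K \<lhd> G \<Longrightarrow> H <#> K \<lhd> G"
  by (rule normal_subgroup_set_mult_closed)

lemma normal_Int: "H \<lhd> G \<Longrightarrow> K \<lhd> G \<Longrightarrow> H \<inter> K \<lhd> G"
  by (rule normal_subgroup_intersect)

lemma subgroup_Int: "subgroup H G \<Longrightarrow> subgroup K G \<Longrightarrow> subgroup (H \<inter> K) G"
  by (rule subgroups_Inter_pair)

lemma subset_set_mult_left: "H \<subseteq> carrier G \<Longrightarrow> subgroup K G \<Longrightarrow> H \<subseteq> H <#> K"
  unfolding mem_set_mult subset_iff by (metis r_one subgroup.one_closed)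

lemma subset_set_mult_right: "subgroup H G \<Longrightarrow> K \<subseteq> carrier G \<Longrightarrow> K \<subseteq> H <#> K"
  unfolding mem_set_mult subset_iff by (metis l_one subgroup.one_closed)

lemma set_mult_least: "subgroup L G \<Longrightarrow> H \<subseteq> L \<Longrightarrow> K \<subseteq> L \<Longrightarrow> H <#> K \<subseteq> L"
  by (force simp: mem_set_mult intro: subgroup.m_closed)

lemma dedekind_left:
  assumes "subgroup A G" "H \<subseteq> A" "K \<subseteq> carrier G"
  shows "(H <#> K) \<inter> A = H <#> (K \<inter> A)"
proof
  show "(H <#> K) \<inter> A \<subseteq> H <#> (K \<inter> A)"
  proof
    fix x assume "x \<in> (H <#> K) \<inter> A"
    then obtain h k where hk: "h \<in> H" "k \<in> K" "x = h \<otimes> k" "x \<in> A"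
      by (auto simp: mem_set_mult)
    have "k = inv h \<otimes> x"
      using hk assms by (metis inv_solve_left subgroup.mem_carrier subset_iff)
    then have "k \<in> A"
      using hk assms by (metis subgroup.m_closed subgroup.m_inv_closed subset_iff)
    then show "x \<in> H <#> (K \<inter> A)"
      using hk by (auto simp: mem_set_mult)
  qed
qed (use assms in \<open>force simp: mem_set_mult intro: subgroup.m_closed\<close>)

lemma dedekind_right:
  assumes "subgroup A G" "K \<subseteq> A" "H \<subseteq> carrier G"
  shows "(H <#> K) \<inter> A = (H \<inter> A) <#> K"
proof
  show "(H <#> K) \<inter> A \<subseteq> (H \<inter> A) <#> K"
  proof
    fix x assume "x \<in> (H <#> K) \<inter> A"
    then obtain h k where hk: "h \<in> H" "k \<in> K" "x = h \<otimes> k" "x \<in> A"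
      by (auto simp: mem_set_mult)
    have "h = x \<otimes> inv k"
      using hk assms by (metis inv_solve_right subgroup.mem_carrier subset_iff)
    then have "h \<in> A"
      using hk assms by (metis subgroup.m_closed subgroup.m_inv_closed subset_iff)
    then show "x \<in> (H \<inter> A) <#> K"
      using hk by (auto simp: mem_set_mult)
  qed
qed (use assms in \<open>force simp: mem_set_mult intro: subgroup.m_closed\<close>)

lemma powers_subset:
  assumes X: "subgroup X G" "x \<in> X"
  shows "range (\<lambda>k::nat. x [^] k) \<subseteq> X"
proof -
  have "x [^] k \<in> X" for k :: nat
    by (induction k) (use X in \<open>auto simp: subgroup.one_closed subgroup.m_closed\<close>)
  then show ?thesis by blast
qed

lemma card_rcosets_subgroup:
  assumes "subgroup K G" "subgroup L G" "K \<subseteq> L"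
  shows "card (rcosets\<^bsub>G\<lparr>carrier := L\<rparr>\<^esub> K) * card K = card L"
  using group.lagrange[OF subgroup_imp_group[OF assms(2)] subgroup_incl[OF assms(1,2,3)]]
  by (simp add: order_def)

lemma card_subgroup_dvd:
  assumes "subgroup K G" "subgroup L G" "K \<subseteq> L"
  shows "card K dvd card L"
  using card_rcosets_subgroup[OF assms] by (metis dvd_triv_right)

end

context finite_group
begin

lemma finite_subgroup: "subgroup H G \<Longrightarrow> finite H"
  using finite_carrier finite_subset subgroup.subset by metis

lemma card_subgroup_pos: "subgroup H G \<Longrightarrow> 0 < card H"
  using finite_carrier subgroup.finite_imp_card_positive by blast

lemma order_quotient:
  assumes "subgroup K G" "subgroup L G" "K \<subseteq> L"
  shows "order (G\<lparr>carrier := L\<rparr> Mod K) = card L div card K"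
  using card_rcosets_subgroup[OF assms] card_subgroup_pos[OF assms(1)]
  by (simp add: order_def FactGroup_def) (metis div_mult_self_is_m)

text \<open>With \<open>a\<close> a fixed H-part of \<open>x\<close>, the factorizations of
  \<open>x\<close> are \<open>(a z) (inv z inv a x)\<close> with \<open>z\<close> in
  \<open>H \<inter> K\<close>; this matches the pairs \<open>(x, z)\<close> with
  \<open>H \<times> K\<close>. Neither factor is assumed normal, so \<open>H <#> K\<close> is only a
  set.\<close>

lemma card_set_mult:
  assumes H: "subgroup H G" and K: "subgroup K G"
  shows "card (H <#> K) * card (H \<inter> K) = card H * card K"
proof -
  note Hc = subgroup.mem_carrier[OF H] and Kc = subgroup.mem_carrier[OF K]
  define a where "a x = (SOME h. h \<in> H \<and> inv h \<otimes> x \<in> K)" for x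
  have a: "a x \<in> H \<and> inv (a x) \<otimes> x \<in> K" if x: "x \<in> H <#> K" for x
  proof -
    obtain h k where "h \<in> H" "k \<in> K" "x = h \<otimes> k"
      using x by (auto simp: mem_set_mult)
    then have "h \<in> H \<and> inv h \<otimes> x \<in> K"
      using Hc Kc by (simp add: m_assoc[symmetric])
    then show ?thesis
      unfolding a_def by (rule someI)
  qed
  define f where "f = (\<lambda>(x, z). (a x \<otimes> z, inv z \<otimes> (inv (a x) \<otimes> x)))"
  have sub: "H <#> K \<subseteq> carrier G"
    using H K by (simp add: setmult_subset_G subgroup.subset)
  have "bij_betw f ((H <#> K) \<times> (H \<inter> K)) (H \<times> K)"
  proof (rule bij_betwI')
    fix u v assume "u \<in> (H <#> K) \<times> (H \<inter> K)" "v \<in> (H <#> K) \<times> (H \<inter> K)"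
    then obtain x z y w where uv: "u = (x, z)" "v = (y, w)" "x \<in> H <#> K" "y \<in> H <#> K"
      "z \<in> H \<inter> K" "w \<in> H \<inter> K" by (cases u; cases v) simp
    have prod: "a x \<otimes> z \<otimes> (inv z \<otimes> (inv (a x) \<otimes> x)) = x"
      if "x \<in> H <#> K" "z \<in> H \<inter> K" for x z
    proof -
      have "a x \<in> carrier G" "z \<in> carrier G" "x \<in> carrier G"
        using that a[of x] Hc sub by auto
      then show ?thesis
        by (simp add: m_assoc)
    qed
    show "f u = f v \<longleftrightarrow> u = v"
    proof
      assume eq: "f u = f v"
      then have "x = y"
        using prod[of x z] prod[of y w] uv by (simp add: f_def)
      moreover from eq this have "a x \<otimes> z = a x \<otimes> w"
        using uv by (simp add: f_def)
      then have "z = w"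
        using uv a[of x] Hc by simp
      ultimately show "u = v" using uv by simp
    qed simp
  next
    fix u assume "u \<in> (H <#> K) \<times> (H \<inter> K)"
    then show "f u \<in> H \<times> K"
      using a subgroup.m_closed[OF H] subgroup.m_closed[OF K] subgroup.m_inv_closed[OF K]
      by (auto simp: f_def)
  next
    fix v assume "v \<in> H \<times> K"
    then obtain h k where v: "v = (h, k)" "h \<in> H" "k \<in> K" by auto
    define x where "x = h \<otimes> k"
    have x: "x \<in> H <#> K"
      using v by (auto simp: mem_set_mult x_def)
    note ax = a[OF x]
    have c: "a x \<in> carrier G" "h \<in> carrier G" "k \<in> carrier G" "x \<in> carrier G"
      using ax v Hc Kc x sub by auto
    define z where "z = inv (a x) \<otimes> h"
    have z1: "z = (inv (a x) \<otimes> x) \<otimes> inv k"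
      using c by (simp add: z_def x_def m_assoc)
    have "z \<in> H"
      unfolding z_def using ax v H by (simp add: subgroup.m_closed subgroup.m_inv_closed)
    moreover have "z \<in> K"
      unfolding z1 using ax v K by (simp add: subgroup.m_closed subgroup.m_inv_closed)
    ultimately have z: "z \<in> H \<inter> K" by simp
    have "f (x, z) = v"
    proof -
      have "a x \<otimes> z = h"
        using c by (simp add: z_def)
      moreover have "inv z \<otimes> (inv (a x) \<otimes> x) = k"
      proof -
        have "inv (a x) \<otimes> x = z \<otimes> k"
          using c by (simp add: z_def x_def m_assoc)
        then show ?thesis
          using z c Hc by simp
      qed
      ultimately show ?thesis using v by (simp add: f_def)
    qed
    then show "\<exists>u\<in>(H <#> K) \<times> (H \<inter> K). v = f u"
      using x z by (intro bexI[of _ "(x, z)"]) auto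
  qed
  from bij_betw_same_card[OF this] show ?thesis
    by (simp add: card_cartesian_product)
qed

lemma ex_maximal_set:
  assumes "Q A" "\<And>X. Q X \<Longrightarrow> X \<subseteq> carrier G"
  shows "\<exists>M. Q M \<and> (\<forall>X. Q X \<longrightarrow> M \<subseteq> X \<longrightarrow> X = M)"
proof -
  have "finite (Collect Q)"
    by (rule finite_subset[of _ "Pow (carrier G)"]) (use assms(2) finite_carrier in auto)
  then show ?thesis
    using finite_has_maximal[of "Collect Q"] assms(1) by (metis empty_iff mem_Collect_eq)
qed

lemma ex_minimal_set:
  assumes "Q A" "\<And>X. Q X \<Longrightarrow> X \<subseteq> carrier G"
  shows "\<exists>M. Q M \<and> (\<forall>X. Q X \<longrightarrow> X \<subseteq> M \<longrightarrow> X = M)"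
proof -
  have "finite (Collect Q)"
    by (rule finite_subset[of _ "Pow (carrier G)"]) (use assms(2) finite_carrier in auto)
  then show ?thesis
    using finite_has_minimal[of "Collect Q"] assms(1) by (metis empty_iff mem_Collect_eq)
qed

lemma ex_chief_factor_above:
  assumes K: "K \<lhd> G" and L: "L \<lhd> G" "K \<subset> L"
  obtains X where "chief_factor G X K" "X \<subseteq> L"
proof -
  obtain X where X: "X \<lhd> G \<and> K \<subset> X \<and> X \<subseteq> L"
    "\<And>Y. Y \<lhd> G \<and> K \<subset> Y \<and> Y \<subseteq> L \<Longrightarrow> Y \<subseteq> X \<Longrightarrow> Y = X"
    using ex_minimal_set[of "\<lambda>X. X \<lhd> G \<and> K \<subset> X \<and> X \<subseteq> L" L]
      L subgroup.subset[OF normal_subgroup] by blast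
  have "M = K \<or> M = X" if "M \<lhd> G" "K \<subseteq> M" "M \<subseteq> X" for M
    using X(1) X(2)[of M] that by (cases "M = K") auto
  then have "chief_factor G X K"
    using X(1) K by (simp add: chief_factor_def)
  then show thesis using X(1) that by blast
qed

lemma ex_chief_factor_below:
  assumes K: "K \<lhd> G" "K \<subset> L" and L: "L \<lhd> G"
  obtains Y where "chief_factor G L Y" "K \<subseteq> Y"
proof -
  obtain Y where Y: "Y \<lhd> G \<and> K \<subseteq> Y \<and> Y \<subset> L"
    "\<And>X. X \<lhd> G \<and> K \<subseteq> X \<and> X \<subset> L \<Longrightarrow> Y \<subseteq> X \<Longrightarrow> X = Y"
    using ex_maximal_set[of "\<lambda>Y. Y \<lhd> G \<and> K \<subseteq> Y \<and> Y \<subset> L" K]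
      K subgroup.subset[OF normal_subgroup] by blast
  have "M = Y \<or> M = L" if "M \<lhd> G" "Y \<subseteq> M" "M \<subseteq> L" for M
    using Y(1) Y(2)[of M] that by (cases "M = L") auto
  then have "chief_factor G L Y"
    using Y(1) L by (simp add: chief_factor_def)
  then show thesis using Y(1) that by blast
qed

end

subsection \<open>Chief series and epimorphisms\<close>

text \<open>The condition ranges over all chief factors of \<open>G\<close> between the two terms,
  not over those of one series, and it speaks of indices instead of quotient groups. Sections can
  then be glued and moved to quotients of \<open>G\<close> by comparing cardinalities.\<close>

definition supersoluble_between :: "('a, 'b) monoid_scheme \<Rightarrow> nat \<Rightarrow> 'a set \<Rightarrow> 'a set \<Rightarrow> bool" where
  "supersoluble_between G p K L \<longleftrightarrow> (\<forall>X Y. chief_factor G X Y \<longrightarrow> K \<subseteq> Y \<longrightarrow> X \<subseteq> L \<longrightarrow>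
     card X div card Y = p \<or> \<not> p dvd card X div card Y)"

lemma chief_factorD:
  assumes "chief_factor G L K"
  shows "L \<lhd> G" "K \<lhd> G" "K \<subset> L" "\<And>M. M \<lhd> G \<Longrightarrow> K \<subseteq> M \<Longrightarrow> M \<subseteq> L \<Longrightarrow> M = K \<or> M = L"
  using assms by (auto simp: chief_factor_def)

lemma div_eq_div_cross:
  fixes a b c d :: nat
  assumes "a * d = c * b" "b dvd a" "d dvd c" "0 < b" "0 < d"
  shows "a div b = c div d"
proof -
  obtain k m where "a = b * k" "c = d * m"
    using assms(2,3) by (auto elim!: dvdE)
  then show ?thesis using assms by (simp add: mult.commute mult.left_commute)
qed

context finite_group
begin

lemma card_index_mult:
  assumes "subgroup K G" "subgroup L G" "K \<subseteq> L"
  shows "(card L div card K) * card K = card L"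
  using card_subgroup_dvd[OF assms] by simp

lemma index_mult:
  assumes "subgroup K G" "subgroup X G" "subgroup L G" "K \<subseteq> X" "X \<subseteq> L"
  shows "card L div card K = (card L div card X) * (card X div card K)"
proof -
  have "card L = (card L div card X) * ((card X div card K) * card K)"
    using card_index_mult assms by simp
  then show ?thesis
    using card_subgroup_pos[OF assms(1)] by (metis div_mult_self_is_m mult.assoc)
qed

text \<open>A chief factor \<open>X / Y\<close> may straddle \<open>L\<close>. Since
  \<open>(X \<inter> L) Y\<close> is \<open>Y\<close> or \<open>X\<close>, its order is that of
  \<open>X L / Y L\<close>, a chief factor above \<open>L\<close>, or that of
  \<open>(X \<inter> L) / (Y \<inter> L)\<close>, a chief factor below \<open>L\<close>. This does
  the work of the Jordan-Hoelder theorem.\<close>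

lemma supersoluble_between_trans:
  assumes K: "K \<lhd> G" and L: "L \<lhd> G" and M: "M \<lhd> G" and KL: "K \<subseteq> L" and LM: "L \<subseteq> M"
    and 1: "supersoluble_between G p K L" and 2: "supersoluble_between G p L M"
  shows "supersoluble_between G p K M"
  unfolding supersoluble_between_def
proof (intro allI impI)
  fix X Y assume cf: "chief_factor G X Y" and KY: "K \<subseteq> Y" and XM: "X \<subseteq> M"
  note XY = chief_factorD[OF cf]
  note sub = normal_subgroup[OF XY(1)] normal_subgroup[OF XY(2)] normal_subgroup[OF L]
  note subs = sub[THEN subgroup.subset]
  have XLn: "X \<inter> L \<lhd> G" and YLn: "Y \<inter> L \<lhd> G"
    using XY L normal_Int by blast+
  note pos = card_subgroup_pos[OF sub(1)] card_subgroup_pos[OF sub(2)] card_subgroup_pos[OF sub(3)]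
    card_subgroup_pos[OF normal_subgroup[OF XLn]] card_subgroup_pos[OF normal_subgroup[OF YLn]]
  note dvdXY = card_subgroup_dvd[OF sub(2) sub(1) psubset_imp_subset[OF XY(3)]]
  have "(X \<inter> L) <#> Y \<lhd> G" "Y \<subseteq> (X \<inter> L) <#> Y" "(X \<inter> L) <#> Y \<subseteq> X"
    using normal_set_mult[OF XLn XY(2)] subset_set_mult_right[OF normal_subgroup[OF XLn] subs(2)]
      set_mult_least[OF sub(1)] XY(3) by auto
  then consider "(X \<inter> L) <#> Y = Y" | "(X \<inter> L) <#> Y = X"
    using XY(4) by blast
  then show "card X div card Y = p \<or> \<not> p dvd card X div card Y"
  proof cases
    case 1
    have XL: "X \<inter> L \<subseteq> Y"
      using subset_set_mult_left[of "X \<inter> L" Y] subs sub(2) 1 by auto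
    then have int: "X \<inter> L = Y \<inter> L" using XY(3) by auto
    have "X <#> L \<lhd> G" "Y <#> L \<lhd> G"
      using XY L normal_set_mult by blast+
    note n = this and s = this[THEN normal_subgroup]
    have le: "Y <#> L \<subseteq> X <#> L"
      using XY(3) mono_set_mult by (metis order_refl psubset_imp_subset)
    have c: "card (X <#> L) * card (Y \<inter> L) = card X * card L"
      "card (Y <#> L) * card (Y \<inter> L) = card Y * card L"
      using card_set_mult sub int by metis+
    have eq: "card (X <#> L) * card Y = card X * card (Y <#> L)"
    proof -
      have "(card (X <#> L) * card Y) * card (Y \<inter> L) = (card X * card (Y <#> L)) * card (Y \<inter> L)"
        using c by (metis mult.assoc mult.commute)
      then show ?thesis using pos by simp
    qed
    have "card Y < card X"
      using psubset_card_mono[OF finite_subgroup[OF sub(1)] XY(3)] .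
    then have ne: "Y <#> L \<noteq> X <#> L"
      using eq card_subgroup_pos[OF s(1)] by (metis mult.commute mult_cancel1 not_gr_zero nat_neq_iff)
    have "chief_factor G (X <#> L) (Y <#> L)"
      unfolding chief_factor_def
    proof (intro conjI allI impI)
      fix B assume B: "B \<lhd> G" "Y <#> L \<subseteq> B" "B \<subseteq> X <#> L"
      have LB: "L \<subseteq> B" and YB: "Y \<subseteq> B"
        using B(2) subset_set_mult_right[OF sub(2) subs(3)] subset_set_mult_left[OF subs(2) sub(3)]
        by auto
      have "B = (X \<inter> B) <#> L"
        using dedekind_right[OF normal_subgroup[OF B(1)] LB subs(1)] B(3) by auto
      moreover have "X \<inter> B = Y \<or> X \<inter> B = X"
        using XY(4)[of "X \<inter> B"] normal_Int[OF XY(1) B(1)] YB XY(3) by auto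
      ultimately show "B = Y <#> L \<or> B = X <#> L" by auto
    qed (use n le ne in auto)
    moreover have "L \<subseteq> Y <#> L" "X <#> L \<subseteq> M"
      using subset_set_mult_right[OF sub(2) subs(3)] set_mult_least[OF normal_subgroup[OF M] XM LM]
      by auto
    ultimately have "card (X <#> L) div card (Y <#> L) = p \<or> \<not> p dvd card (X <#> L) div card (Y <#> L)"
      using 2 unfolding supersoluble_between_def by blast
    moreover have "card (X <#> L) div card (Y <#> L) = card X div card Y"
      using div_eq_div_cross[OF eq card_subgroup_dvd[OF s(2) s(1) le] dvdXY]
        card_subgroup_pos[OF s(2)] pos by simp
    ultimately show ?thesis by simp
  next
    case 2
    have c: "card X * card (Y \<inter> L) = card (X \<inter> L) * card Y"
    proof -
      have "(X \<inter> L) \<inter> Y = Y \<inter> L" using XY(3) by auto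
      then show ?thesis
        using card_set_mult[OF normal_subgroup[OF XLn] sub(2)] 2 by simp
    qed
    have "Y \<inter> L \<noteq> X \<inter> L"
    proof
      assume "Y \<inter> L = X \<inter> L"
      then have "card X = card Y" using c pos by simp
      then show False
        using psubset_card_mono[OF finite_subgroup[OF sub(1)] XY(3)] by simp
    qed
    have "chief_factor G (X \<inter> L) (Y \<inter> L)"
      unfolding chief_factor_def
    proof (intro conjI allI impI)
      fix B assume B: "B \<lhd> G" "Y \<inter> L \<subseteq> B" "B \<subseteq> X \<inter> L"
      note Bs = normal_subgroup[OF B(1)]
      have "B <#> Y \<lhd> G" "Y \<subseteq> B <#> Y" "B <#> Y \<subseteq> X"
        using normal_set_mult[OF B(1) XY(2)] subset_set_mult_right[OF Bs subs(2)]
          set_mult_least[OF sub(1)] B(3) XY(3) by auto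
      then consider "B <#> Y = Y" | "B <#> Y = X"
        using XY(4) by blast
      then show "B = Y \<inter> L \<or> B = X \<inter> L"
      proof cases
        case 1
        then have "B \<subseteq> Y"
          using subset_set_mult_left[OF subgroup.subset[OF Bs] sub(2)] by auto
        then show ?thesis using B by auto
      next
        case 2
        have "X \<inter> L = B <#> (Y \<inter> (X \<inter> L))"
          using dedekind_left[OF normal_subgroup[OF XLn] B(3) subs(2)] 2 by auto
        also have "\<dots> \<subseteq> B"
          using B(2) by (intro set_mult_least[OF Bs]) auto
        finally show ?thesis using B(3) by auto
      qed
    qed (use XLn YLn XY(3) \<open>Y \<inter> L \<noteq> X \<inter> L\<close> in auto)
    moreover have "K \<subseteq> Y \<inter> L" "X \<inter> L \<subseteq> L"
      using KY KL by auto
    ultimately have "card (X \<inter> L) div card (Y \<inter> L) = p \<or> \<not> p dvd card (X \<inter> L) div card (Y \<inter> L)"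
      using 1 unfolding supersoluble_between_def by blast
    moreover have "card X div card Y = card (X \<inter> L) div card (Y \<inter> L)"
      using div_eq_div_cross[OF c dvdXY card_subgroup_dvd[OF normal_subgroup[OF YLn] normal_subgroup[OF XLn]]]
        pos XY(3) by auto
    ultimately show ?thesis by simp
  qed
qed

lemma supersoluble_between_refl: "supersoluble_between G p K K"
  by (auto simp: supersoluble_between_def dest: chief_factorD)

lemma chief_factor_index_dvd:
  assumes K: "K \<lhd> G" and L: "L \<lhd> G" and cf: "chief_factor G X Y" and KY: "K \<subseteq> Y" and XL: "X \<subseteq> L"
  shows "card X div card Y dvd card L div card K"
proof -
  note XY = chief_factorD[OF cf]
  note s = normal_subgroup[OF K] normal_subgroup[OF L] normal_subgroup[OF XY(1)] normal_subgroup[OF XY(2)]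
  have "card L div card K = (card L div card X) * (card X div card K)"
    using index_mult[OF s(1,3,2)] KY XL XY(3) by simp
  also have "card X div card K = (card X div card Y) * (card Y div card K)"
    using index_mult[OF s(1,4,3)] KY XY(3) by simp
  finally show ?thesis by simp
qed

lemma supersoluble_between_p':
  assumes "K \<lhd> G" "L \<lhd> G" "\<not> p dvd card L div card K"
  shows "supersoluble_between G p K L"
  unfolding supersoluble_between_def using chief_factor_index_dvd[OF assms(1,2)] assms(3) dvd_trans by metis

lemma supersoluble_between_prime_index:
  assumes "prime p" "K \<lhd> G" "L \<lhd> G" "card L div card K = p"
  shows "supersoluble_between G p K L"
  unfolding supersoluble_between_def
proof (intro allI impI)
  fix X Y assume "chief_factor G X Y" "K \<subseteq> Y" "X \<subseteq> L"
  then have "card X div card Y dvd p"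
    using chief_factor_index_dvd[OF assms(2,3)] assms(4) by blast
  then show "card X div card Y = p \<or> \<not> p dvd card X div card Y"
    using assms(1) by (auto simp: prime_nat_iff)
qed

lemma p_supersoluble_iff:
  "p_supersoluble p G \<longleftrightarrow> supersoluble_between G p {\<one>} (carrier G)"
proof -
  have "order (G\<lparr>carrier := L\<rparr> Mod K) = card L div card K \<and> {\<one>} \<subseteq> K \<and> L \<subseteq> carrier G"
    if "chief_factor G L K" for L K
    using chief_factorD[OF that] order_quotient normal_subgroup subgroup.subset subgroup.one_closed
    by (metis empty_subsetI insert_subset psubset_imp_subset)
  then show ?thesis
    unfolding p_supersoluble_def supersoluble_between_def p'_group_def by metis
qed

lemma p_soluble_iff:
  assumes "p_soluble p G" "chief_factor G L K"
  shows "(\<exists>n. card L div card K = p ^ n) \<or> \<not> p dvd card L div card K"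
proof -
  have "order (G\<lparr>carrier := L\<rparr> Mod K) = card L div card K"
    using chief_factorD[OF assms(2)] order_quotient normal_subgroup psubset_imp_subset by metis
  then show ?thesis
    using assms unfolding p_soluble_def p'_group_def p_group_def by metis
qed

end

section \<open>Transfer of subgroups, orders and chief factors along epimorphisms\<close>

locale finite_epimorphism = group_hom G H h for G (structure) and H (structure) and h +
  assumes finite_dom: "finite (carrier G)" and surj: "h ` carrier G = carrier H"

sublocale finite_epimorphism \<subseteq> dom: finite_group G
  by unfold_locales (rule finite_dom)

sublocale finite_epimorphism \<subseteq> cod: finite_group H
  by unfold_locales (metis finite_dom surj finite_imageI)

context finite_epimorphism
begin

definition preimage :: "'c set \<Rightarrow> 'a set" where
  "preimage X = {x \<in> carrier G. h x \<in> X}"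

abbreviation Ker :: "'a set" where "Ker \<equiv> kernel G H h"

lemma hom_conjugate:
  "g \<in> carrier G \<Longrightarrow> x \<in> carrier G \<Longrightarrow> h (G.conjugate g x) = H.conjugate (h g) (h x)"
  by (simp add: G.conjugate_def H.conjugate_def)

lemma preimage_subgroup:
  assumes "subgroup X H" shows "subgroup (preimage X) G"
proof (rule G.subgroupI)
  show "preimage X \<noteq> {}"
    using subgroup.one_closed[OF assms] by (auto simp: preimage_def intro!: exI[of _ "\<one>"])
qed (use assms in \<open>auto simp: preimage_def subgroup.m_closed subgroup.m_inv_closed\<close>)

lemma preimage_normal: "X \<lhd> H \<Longrightarrow> preimage X \<lhd> G"
  unfolding G.normal_iff_conjugate H.normal_iff_conjugate
  using preimage_subgroup by (auto simp: preimage_def hom_conjugate)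

lemma image_subgroup: "subgroup L G \<Longrightarrow> subgroup (h ` L) H"
  by (rule subgroup_img_is_subgroup)

lemma image_normal:
  assumes "L \<lhd> G" shows "h ` L \<lhd> H"
proof -
  have "H.conjugate g y \<in> h ` L" if gy: "g \<in> carrier H" "y \<in> h ` L" for g y
  proof -
    obtain a x where "a \<in> carrier G" "g = h a" "x \<in> L" "y = h x"
      using gy surj by blast
    then show ?thesis
      using assms G.normal_conjugate hom_conjugate subgroup.mem_carrier[OF G.normal_subgroup]
      by (metis imageI)
  qed
  then show ?thesis
    unfolding H.normal_iff_conjugate using image_subgroup[OF G.normal_subgroup[OF assms]] by simp
qed

lemma image_preimage: "X \<subseteq> carrier H \<Longrightarrow> h ` preimage X = X"
  using surj by (auto simp: preimage_def)

lemma mem_image_iff: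
  assumes "subgroup L G" "Ker \<subseteq> L" "x \<in> carrier G"
  shows "h x \<in> h ` L \<longleftrightarrow> x \<in> L"
proof
  assume "h x \<in> h ` L"
  then obtain y where y: "y \<in> L" "h x = h y" by blast
  then have yc: "y \<in> carrier G" using assms subgroup.mem_carrier by metis
  have "h (inv y \<otimes> x) = \<one>\<^bsub>H\<^esub>"
    using y yc assms by simp
  then have "inv y \<otimes> x \<in> L"
    using yc assms by (auto simp: kernel_def)
  then have "y \<otimes> (inv y \<otimes> x) \<in> L"
    using y assms subgroup.m_closed by metis
  then show "x \<in> L" using yc assms by simp
qed simp

lemma preimage_image:
  assumes "subgroup L G" "Ker \<subseteq> L" shows "preimage (h ` L) = L"
  using mem_image_iff[OF assms] subgroup.mem_carrier[OF assms(1)] by (auto simp: preimage_def)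

lemma Ker_subset_preimage: "subgroup X H \<Longrightarrow> Ker \<subseteq> preimage X"
  by (auto simp: kernel_def preimage_def subgroup.one_closed)

lemma card_image:
  assumes L: "subgroup L G"
  shows "card L = card (h ` L) * card (L \<inter> Ker)"
proof -
  note Lc = subgroup.mem_carrier[OF L]
  have fib: "card {x \<in> L. h x = y} = card (L \<inter> Ker)" if y: "y \<in> h ` L" for y
  proof -
    obtain a where a: "a \<in> L" "y = h a" using y by blast
    have "bij_betw (\<lambda>z. a \<otimes> z) (L \<inter> Ker) {x \<in> L. h x = y}"
    proof (rule bij_betw_byWitness[where f' = "\<lambda>x. inv a \<otimes> x"])
      show "(\<lambda>z. a \<otimes> z) ` (L \<inter> Ker) \<subseteq> {x \<in> L. h x = y}"
        using a Lc L by (auto simp: kernel_def subgroup.m_closed)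
      show "(\<lambda>x. inv a \<otimes> x) ` {x \<in> L. h x = y} \<subseteq> L \<inter> Ker"
        using a Lc L by (auto simp: kernel_def subgroup.m_closed subgroup.m_inv_closed)
    qed (use a Lc in auto)
    then show ?thesis using bij_betw_same_card by fastforce
  qed
  have fin: "finite L" using dom.finite_subgroup[OF L] .
  have "card L = card (\<Union>y\<in>h ` L. {x \<in> L. h x = y})"
    by (rule arg_cong[where f = card]) auto
  also have "\<dots> = (\<Sum>y\<in>h ` L. card {x \<in> L. h x = y})"
    using fin by (intro card_UN_disjoint) auto
  also have "\<dots> = card (h ` L) * card (L \<inter> Ker)"
    using fib by simp
  finally show ?thesis .
qed

lemma card_image_Ker: "subgroup L G \<Longrightarrow> Ker \<subseteq> L \<Longrightarrow> card L = card (h ` L) * card Ker"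
  using card_image[of L] by (simp add: Int_absorb1)

lemma card_preimage: "subgroup X H \<Longrightarrow> card (preimage X) = card X * card Ker"
  using card_image_Ker[OF preimage_subgroup Ker_subset_preimage] image_preimage subgroup.subset
  by metis

lemma card_Ker_pos: "0 < card Ker"
  using dom.card_subgroup_pos[OF subgroup_kernel] .

lemma image_mono_iff:
  assumes "subgroup L G" "subgroup M G" "Ker \<subseteq> M"
  shows "h ` L \<subseteq> h ` M \<longleftrightarrow> L \<subseteq> M"
  using mem_image_iff[OF assms(2,3)] subgroup.mem_carrier[OF assms(1)]
  by (metis image_mono imageI subset_iff)

lemma chief_factor_preimage:
  assumes "chief_factor H X Y"
  shows "chief_factor G (preimage X) (preimage Y)"
proof -
  note XY = chief_factorD[OF assms]
  note s = H.normal_subgroup[OF XY(1)] H.normal_subgroup[OF XY(2)]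
  note im = image_preimage[OF subgroup.subset[OF s(1)]] image_preimage[OF subgroup.subset[OF s(2)]]
  show ?thesis
    unfolding chief_factor_def
  proof (intro conjI allI impI)
    show "preimage Y \<subset> preimage X"
    proof (rule psubsetI)
      show "preimage Y \<subseteq> preimage X" using XY(3) by (auto simp: preimage_def)
      show "preimage Y \<noteq> preimage X" using XY(3) im by auto
    qed
    fix M assume M: "M \<lhd> G" "preimage Y \<subseteq> M" "M \<subseteq> preimage X"
    have K: "Ker \<subseteq> M" using M(2) Ker_subset_preimage[OF s(2)] by auto
    have "h ` M \<lhd> H" "Y \<subseteq> h ` M" "h ` M \<subseteq> X"
      using M image_normal image_mono[OF M(2), of h] image_mono[OF M(3), of h] im by auto
    then have "h ` M = Y \<or> h ` M = X" using XY(4) by blast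
    then show "M = preimage Y \<or> M = preimage X"
      using preimage_image[OF G.normal_subgroup[OF M(1)] K] by auto
  qed (use XY preimage_normal in auto)
qed

lemma chief_factor_image:
  assumes "chief_factor G X Y" "Ker \<subseteq> Y"
  shows "chief_factor H (h ` X) (h ` Y)"
proof -
  note XY = chief_factorD[OF assms(1)]
  note s = G.normal_subgroup[OF XY(1)] G.normal_subgroup[OF XY(2)]
  have KX: "Ker \<subseteq> X" using XY assms by auto
  show ?thesis
    unfolding chief_factor_def
  proof (intro conjI allI impI)
    show "h ` Y \<subset> h ` X"
      using XY(3) image_mono_iff[OF s(1) s(2) assms(2)] by auto
    fix M assume M: "M \<lhd> H" "h ` Y \<subseteq> M" "M \<subseteq> h ` X"
    have "Y \<subseteq> preimage M"
      using M(2) subgroup.mem_carrier[OF s(2)] by (auto simp: preimage_def)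
    moreover have "preimage M \<subseteq> X"
      using M(3) mem_image_iff[OF s(1) KX] unfolding preimage_def by blast
    moreover note preimage_normal[OF M(1)]
    ultimately
    have "preimage M = Y \<or> preimage M = X" using XY(4) by blast
    then show "M = h ` Y \<or> M = h ` X"
      using image_preimage[OF subgroup.subset[OF H.normal_subgroup[OF M(1)]]] by auto
  qed (use XY image_normal in auto)
qed

lemma index_image:
  assumes "subgroup X G" "subgroup Y G" "Ker \<subseteq> Y" "Y \<subseteq> X"
  shows "card (h ` X) div card (h ` Y) = card X div card Y"
  using card_image_Ker[OF assms(1)] card_image_Ker[OF assms(2)] assms card_Ker_pos by auto

lemma image_Ker: "h ` Ker = {\<one>\<^bsub>H\<^esub>}"
  using subgroup.one_closed[OF subgroup_kernel] by (force simp: kernel_def)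

lemma supersoluble_between_image:
  assumes K: "subgroup K G" "Ker \<subseteq> K" and L: "subgroup L G" "Ker \<subseteq> L"
  shows "supersoluble_between H p (h ` K) (h ` L) \<longleftrightarrow> supersoluble_between G p K L"
proof
  assume A: "supersoluble_between H p (h ` K) (h ` L)"
  show "supersoluble_between G p K L"
    unfolding supersoluble_between_def
  proof (intro allI impI)
    fix X Y assume XY: "chief_factor G X Y" "K \<subseteq> Y" "X \<subseteq> L"
    have KY: "Ker \<subseteq> Y" using XY(2) K(2) by blast
    note c = chief_factor_image[OF XY(1) KY]
    have "h ` K \<subseteq> h ` Y" "h ` X \<subseteq> h ` L"
      using XY by auto
    then show "card X div card Y = p \<or> \<not> p dvd card X div card Y"
      using A c index_image[of X Y] chief_factorD[OF XY(1)] G.normal_subgroup KY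
      unfolding supersoluble_between_def by (metis psubset_imp_subset)
  qed
next
  assume A: "supersoluble_between G p K L"
  show "supersoluble_between H p (h ` K) (h ` L)"
    unfolding supersoluble_between_def
  proof (intro allI impI)
    fix X Y assume XY: "chief_factor H X Y" "h ` K \<subseteq> Y" "X \<subseteq> h ` L"
    note c = chief_factor_preimage[OF XY(1)]
    note s = H.normal_subgroup[OF chief_factorD(1)[OF XY(1)]] H.normal_subgroup[OF chief_factorD(2)[OF XY(1)]]
    have "preimage X \<subseteq> L"
      using XY(3) mem_image_iff[OF L] unfolding preimage_def by blast
    moreover have "K \<subseteq> preimage Y"
      using XY(2) subgroup.mem_carrier[OF K(1)] by (auto simp: preimage_def)
    ultimately
    have "card (preimage X) div card (preimage Y) = p \<or> \<not> p dvd card (preimage X) div card (preimage Y)"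
      using A c unfolding supersoluble_between_def by blast
    then show "card X div card Y = p \<or> \<not> p dvd card X div card Y"
      using card_preimage[OF s(1)] card_preimage[OF s(2)] card_Ker_pos by simp
  qed
qed

end

lemma (in finite_group) quotient_epimorphism:
  assumes "K \<lhd> G"
  shows "finite_epimorphism G (G Mod K) ((#>) K)" "kernel G (G Mod K) ((#>) K) = K"
proof -
  show "finite_epimorphism G (G Mod K) ((#>) K)"
    using normal.factorgroup_is_group[OF assms] normal.r_coset_hom_Mod[OF assms] finite_carrier
    by (simp add: finite_epimorphism_def finite_epimorphism_axioms_def group_hom_def
        group_hom_axioms_def carrier_FactGroup)
  show "kernel G (G Mod K) ((#>) K) = K"
    using coset_join1[of K] coset_join2[of _ K] normal_subgroup[OF assms] subgroup.subset
    by (force simp: kernel_def)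
qed

subsection \<open>Groups of prime power order\<close>

lemma prime_dvd_primepow_nat:
  fixes p n :: nat
  assumes "prime p" "n dvd p ^ k" "n \<noteq> 1"
  shows "p dvd n"
proof -
  obtain j where j: "n = p ^ j"
    using divides_primepow_nat[OF assms(1)] assms(2) by blast
  then have "j \<noteq> 0" using assms(3) by (cases j) auto
  then show ?thesis using j by simp
qed

lemma ex_other_element:
  assumes "x \<in> F" "p dvd card F" "prime (p::nat)"
  obtains z where "z \<in> F" "z \<noteq> x"
proof -
  have "F \<noteq> {x}" using assms(2,3) by auto
  then show thesis using assms(1) that by blast
qed

text \<open>The index form of being Sylow passes to images under epimorphisms by divisibility alone,
  where a multiplicity in the group order would have to be recomputed.\<close>

definition p_sylow :: "nat \<Rightarrow> 'a set \<Rightarrow> ('a, 'b) monoid_scheme \<Rightarrow> bool" where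
  "p_sylow p P G \<longleftrightarrow> subgroup P G \<and> (\<exists>k. card P = p ^ k) \<and> \<not> p dvd order G div card P"

context finite_group
begin

lemma subgroup_finite_group:
  assumes "subgroup H G"
  shows "finite_group (G\<lparr>carrier := H\<rparr>)"
  using subgroup_imp_group[OF assms] finite_subgroup[OF assms]
  by (simp add: finite_group_def finite_group_axioms_def)

text \<open>Orbit lengths divide \<open>p ^ k\<close>, and without fixed points none of them is 1,
  so \<open>p\<close> divides each.\<close>

lemma prime_dvd_card_no_fixed_points:
  assumes p: "prime p" and ord: "order G = p ^ k" and fin: "finite X"
    and closed: "\<And>g x. g \<in> carrier G \<Longrightarrow> x \<in> X \<Longrightarrow> act g x \<in> X"
    and one: "\<And>x. x \<in> X \<Longrightarrow> act \<one> x = x"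
    and mult: "\<And>g h x. g \<in> carrier G \<Longrightarrow> h \<in> carrier G \<Longrightarrow> x \<in> X \<Longrightarrow> act (g \<otimes> h) x = act g (act h x)"
    and nofix: "\<And>x. x \<in> X \<Longrightarrow> \<exists>g\<in>carrier G. act g x \<noteq> x"
  shows "p dvd card X"
proof -
  \<comment> \<open>The elements of \<open>BijGroup X\<close> are extensional functions, hence the
    restriction.\<close>
  let ?\<phi> = "\<lambda>g. restrict (act g) X"
  have act_inv: "act (inv g) (act g x) = x" "act g (act (inv g) x) = x"
    if "g \<in> carrier G" "x \<in> X" for g x
    using that mult[of "inv g" g x] mult[of g "inv g" x] one by auto
  have "?\<phi> g \<in> Bij X" if "g \<in> carrier G" for g
    unfolding Bij_def using that closed act_inv
    by (auto intro!: bij_betw_byWitness[where f' = "act (inv g)"])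
  moreover have "?\<phi> (g \<otimes> h) = compose X (?\<phi> g) (?\<phi> h)" if "g \<in> carrier G" "h \<in> carrier G" for g h
    using that closed mult by (auto simp: compose_def restrict_def)
  ultimately have "?\<phi> \<in> hom G (BijGroup X)"
    by (auto simp: hom_def BijGroup_def)
  then interpret A: group_action G X ?\<phi>
    by (simp add: group_action_def group_hom_def group_hom_axioms_def group_BijGroup)
  have orb: "p dvd card B" if "B \<in> orbits G X ?\<phi>" for B
  proof -
    obtain x where x: "x \<in> X" "B = orbit G ?\<phi> x"
      using \<open>B \<in> orbits G X ?\<phi>\<close> by (auto simp: orbits_def)
    have "card B dvd p ^ k"
      using A.orbit_stabilizer_theorem[OF x(1)] x(2) ord by (metis dvd_triv_left)
    moreover have "card B \<noteq> 1"
    proof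
      assume "card B = 1"
      then obtain b where b: "B = {b}" using card_1_singletonE by blast
      have "act g x \<in> B" if "g \<in> carrier G" for g
        using that x by (auto simp: orbit_def)
      then have "act g x = x" if "g \<in> carrier G" for g
        using that b one[OF x(1)] by (metis one_closed singletonD)
      then show False using nofix[OF x(1)] by auto
    qed
    ultimately show ?thesis using prime_dvd_primepow_nat[OF p] by blast
  qed
  have "card X = (\<Sum>B\<in>orbits G X ?\<phi>. card B)"
    using A.disjoint_sum[OF fin, of "\<lambda>_. 1::nat"] by simp
  then show ?thesis using orb by (simp add: dvd_sum)
qed

lemma prime_dvd_card_fixed_points:
  assumes p: "prime p" and ord: "order G = p ^ k" and fin: "finite X"
    and closed: "\<And>g x. g \<in> carrier G \<Longrightarrow> x \<in> X \<Longrightarrow> act g x \<in> X"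
    and one: "\<And>x. x \<in> X \<Longrightarrow> act \<one> x = x"
    and mult: "\<And>g h x. g \<in> carrier G \<Longrightarrow> h \<in> carrier G \<Longrightarrow> x \<in> X \<Longrightarrow> act (g \<otimes> h) x = act g (act h x)"
    and X: "p dvd card X"
  shows "p dvd card {x \<in> X. \<forall>g\<in>carrier G. act g x = x}"
proof -
  let ?F = "{x \<in> X. \<forall>g\<in>carrier G. act g x = x}"
  have 1: "p dvd card (X - ?F)"
  proof (rule prime_dvd_card_no_fixed_points[OF p ord])
    fix g x assume g: "g \<in> carrier G" and x: "x \<in> X - ?F"
    show "act g x \<in> X - ?F"
    proof
      show "act g x \<in> X" using g x closed by blast
      have undo: "act (inv g) (act g x) = x"
        using g x mult[of "inv g" g x] one by simp
      show "act g x \<notin> ?F"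
      proof
        assume f: "act g x \<in> ?F"
        then have "act (inv g) (act g x) = act g x" using g by simp
        then have "act g x = x" using undo by simp
        then show False using f x by simp
      qed
    qed
  qed (use fin one mult in auto)
  have sub: "?F \<subseteq> X" by auto
  have "card X = card (X - ?F) + card ?F"
    using card_mono[OF fin sub] card_Diff_subset[OF finite_subset[OF sub fin] sub] by simp
  then have "p dvd card (X - ?F) + card ?F" using X by simp
  then show ?thesis using dvd_add_right_iff[OF 1] by blast
qed

lemma p_subgroup_fixes_element:
  assumes p: "prime p" and P: "subgroup P G" "card P = p ^ k"
    and R: "subgroup R G" "card R = p ^ m" "R \<noteq> {\<one>}"
    and norm: "\<And>g x. g \<in> P \<Longrightarrow> x \<in> R \<Longrightarrow> conjugate g x \<in> R"
  obtains z where "z \<in> R" "z \<noteq> \<one>" "\<And>g. g \<in> P \<Longrightarrow> conjugate g z = z"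
proof -
  interpret P: finite_group "G\<lparr>carrier := P\<rparr>"
    by (rule subgroup_finite_group[OF P(1)])
  let ?F = "{x \<in> R. \<forall>g\<in>carrier (G\<lparr>carrier := P\<rparr>). conjugate g x = x}"
  have fin: "finite R" by (rule finite_subgroup[OF R(1)])
  have "card R \<noteq> 1"
    using R(3) subgroup.one_closed[OF R(1)] by (auto simp: card_1_singleton_iff)
  then have "p dvd card R"
    using prime_dvd_primepow_nat[OF p] R(2) by simp
  then have pF: "p dvd card ?F"
    using subgroup.mem_carrier[OF P(1)] subgroup.mem_carrier[OF R(1)] P norm fin
    by (intro P.prime_dvd_card_fixed_points[OF p, of k])
       (auto simp: order_def conjugate_conjugate)
  have "\<one> \<in> ?F"
    using subgroup.one_closed[OF R(1)] subgroup.mem_carrier[OF P(1)] by auto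
  then obtain z where "z \<in> ?F" "z \<noteq> \<one>"
    using pF p by (rule ex_other_element)
  then show thesis using that[of z] by simp
qed

lemma mem_normalizer:
  assumes "A \<subseteq> carrier G"
  shows "g \<in> normalizer G A \<longleftrightarrow> g \<in> carrier G \<and> conjugate g ` A = A"
proof -
  have "g <# A #> inv g = conjugate g ` A"
    by (auto simp: l_coset_def r_coset_def conjugate_def)
  then show ?thesis
    using assms by (simp add: normalizer_def stabilizer_def)
qed

lemma mem_normalizer_subgroup:
  assumes A: "subgroup A G" and g: "g \<in> carrier G" "\<And>x. x \<in> A \<Longrightarrow> conjugate g x \<in> A"
  shows "g \<in> normalizer G A"
proof -
  have "inj_on (conjugate g) A"
    using g(1) subgroup.mem_carrier[OF A] by (auto simp: inj_on_def conjugate_eq_iff)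
  then have "card (conjugate g ` A) = card A" by (rule card_image)
  moreover have "conjugate g ` A \<subseteq> A" using g(2) by auto
  ultimately have "conjugate g ` A = A"
    using finite_subgroup[OF A] by (metis card_subset_eq)
  then show ?thesis using mem_normalizer[OF subgroup.subset[OF A]] g(1) by simp
qed

text \<open>\<open>M\<close> acts on its right cosets, whose number is divisible by
  \<open>p\<close>, and fixes the coset \<open>M\<close>. A second fixed coset \<open>M x\<close>
  yields an element \<open>x\<close> outside \<open>M\<close> that normalizes \<open>M\<close>, so
  maximality makes \<open>M\<close> normal. A subgroup of order \<open>p\<close> of
  \<open>G / M\<close> then has all of \<open>G\<close> as preimage.\<close>

lemma p_group_maximal_subgroup:
  assumes p: "prime p" and ord: "order G = p ^ k" and M: "maximal_subgroup M G"
  shows "M \<lhd> G" "card M * p = order G"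
proof -
  have Ms: "subgroup M G" and Mne: "M \<noteq> carrier G"
    and max: "\<And>H. subgroup H G \<Longrightarrow> M \<subseteq> H \<Longrightarrow> H = M \<or> H = carrier G"
    using M by (auto simp: maximal_subgroup_def)
  note Mc = subgroup.mem_carrier[OF Ms] and Msub = subgroup.subset[OF Ms]
  interpret M: finite_group "G\<lparr>carrier := M\<rparr>"
    by (rule subgroup_finite_group[OF Ms])
  have "card (rcosets M) * card M = p ^ k"
    using lagrange[OF Ms] ord by simp
  moreover have "card (rcosets M) \<noteq> 1"
  proof
    assume "card (rcosets M) = 1"
    then have "card M = card (carrier G)"
      using lagrange[OF Ms] by (simp add: order_def)
    then show False using Mne Msub finite_carrier by (metis card_subset_eq)
  qed
  ultimately have pr: "p dvd card (rcosets M)"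
    using prime_dvd_primepow_nat[OF p] by (metis dvd_triv_left)
  obtain j where j: "card M = p ^ j"
    using divides_primepow_nat[OF p] \<open>card (rcosets M) * card M = p ^ k\<close> by (metis dvd_triv_right)
  \<comment> \<open>Inverses turn multiplication from the right into a left action.\<close>
  let ?F = "{c \<in> rcosets M. \<forall>m\<in>carrier (G\<lparr>carrier := M\<rparr>). c #> inv m = c}"
  have rc: "c \<subseteq> carrier G" if "c \<in> rcosets M" for c
    using that Msub by (auto simp: RCOSETS_def r_coset_def)
  have fr: "finite (rcosets M)"
    using finite_carrier rcosets_subset_PowG[OF Ms] finite_subset by blast
  have pF: "p dvd card ?F"
  proof (rule M.prime_dvd_card_fixed_points[OF p, of j])
    fix g c assume "g \<in> carrier (G\<lparr>carrier := M\<rparr>)" and c: "c \<in> rcosets M"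
    then have g: "g \<in> carrier G" using Mc by simp
    obtain x where "x \<in> carrier G" "c = M #> x" using c by (auto simp: RCOSETS_def)
    then have "c #> inv g = M #> (x \<otimes> inv g)"
      using g Msub coset_mult_assoc by simp
    then show "c #> inv g \<in> rcosets M"
      using g \<open>x \<in> carrier G\<close> Msub by (simp add: rcosetsI)
  next
    fix g h c assume "g \<in> carrier (G\<lparr>carrier := M\<rparr>)" "h \<in> carrier (G\<lparr>carrier := M\<rparr>)" "c \<in> rcosets M"
    then show "c #> inv (g \<otimes>\<^bsub>G\<lparr>carrier := M\<rparr>\<^esub> h) = c #> inv h #> inv g"
      using Mc rc by (simp add: inv_mult_group coset_mult_assoc)
  qed (use rc fr pr j in \<open>simp_all add: order_def\<close>)
  have "M \<in> ?F"
  proof -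
    have "M \<in> rcosets M"
      using rcosetsI[OF Msub one_closed] Msub by simp
    then show ?thesis
      using Ms by (simp add: coset_join2 subgroup.m_inv_closed Mc)
  qed
  then obtain C where C: "C \<in> ?F" "C \<noteq> M"
    using pF p by (rule ex_other_element)
  then obtain x where x: "x \<in> carrier G" "C = M #> x" by (auto simp: RCOSETS_def)
  have xM: "x \<notin> M" using C(2) x coset_join2[OF x(1) Ms] by auto
  have cx: "conjugate x m \<in> M" if m: "m \<in> M" for m
  proof -
    have "C #> inv (inv m) = C"
      using C(1) subgroup.m_inv_closed[OF Ms m] by auto
    then have "M #> (x \<otimes> m) = M #> x"
      using x m Mc Msub by (simp add: coset_mult_assoc)
    then have "x \<otimes> m \<in> M #> x"
      using rcos_self[OF _ Ms, of "x \<otimes> m"] x m Mc by simp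
    then obtain n where "n \<in> M" "x \<otimes> m = n \<otimes> x"
      by (auto simp: r_coset_def)
    then show ?thesis
      using x m Mc by (simp add: conjugate_def m_assoc)
  qed
  have "x \<in> normalizer G M" by (rule mem_normalizer_subgroup[OF Ms x(1) cx])
  moreover have "M \<subseteq> normalizer G M"
    using mem_normalizer_subgroup[OF Ms] Mc conjugate_subgroup[OF Ms] by blast
  ultimately have "normalizer G M = carrier G"
    using max[OF normalizer_imp_subgroup[OF Msub]] xM by blast
  then have "conjugate g m \<in> M" if "g \<in> carrier G" "m \<in> M" for g m
    using that mem_normalizer[OF Msub, of g] by blast
  then show norm: "M \<lhd> G" using Ms by (simp add: normal_iff_conjugate)
  interpret q: finite_epimorphism G "G Mod M" "(#>) M"
    by (rule quotient_epimorphism(1)[OF norm])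
  note ker = quotient_epimorphism(2)[OF norm]
  have oq: "order (G Mod M) = card (rcosets M)"
    by (simp add: order_def FactGroup_def)
  \<comment> \<open>With exponent 1 Sylow's existence theorem gives a subgroup of order exactly
    \<open>p\<close>.\<close>
  obtain n where n: "order (G Mod M) = p ^ 1 * n"
    using pr oq by (auto elim: dvdE)
  obtain B where B: "subgroup B (G Mod M)" "card B = p"
    using sylow_thm[OF p normal.factorgroup_is_group[OF norm] n q.cod.finite_carrier] by auto
  have cB: "card (q.preimage B) = p * card M"
    using q.card_preimage[OF B(1)] B(2) ker by simp
  moreover have "M \<subseteq> q.preimage B"
    using q.Ker_subset_preimage[OF B(1)] ker by simp
  moreover have "q.preimage B \<noteq> M"
    using cB p card_subgroup_pos[OF Ms] prime_gt_1_nat[OF p] by auto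
  ultimately have "q.preimage B = carrier G"
    using max[OF q.preimage_subgroup[OF B(1)]] by blast
  then show "card M * p = order G"
    using cB by (simp add: order_def mult.commute)
qed

lemma ex_maximal_subgroup:
  assumes "subgroup B G" "B \<noteq> carrier G"
  obtains M where "maximal_subgroup M G" "B \<subseteq> M"
proof -
  let ?Q = "\<lambda>X. subgroup X G \<and> B \<subseteq> X \<and> X \<noteq> carrier G"
  have Q0: "?Q B" using assms by simp
  have Q_carrier: "X \<subseteq> carrier G" if "?Q X" for X
    using that by (simp add: subgroup.subset)
  obtain M where M: "?Q M" "\<And>X. ?Q X \<Longrightarrow> M \<subseteq> X \<Longrightarrow> X = M"
    using ex_maximal_set[of ?Q, OF Q0 Q_carrier] by blast
  have "X = M \<or> X = carrier G" if "subgroup X G" "M \<subseteq> X" for X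
    using M(1) M(2)[of X] that by (cases "X = carrier G") auto
  then have "maximal_subgroup M G"
    using M(1) by (simp add: maximal_subgroup_def)
  moreover have "B \<subseteq> M" using M by simp
  ultimately show thesis by (rule that)
qed

lemma frattini_set_mult:
  assumes "subgroup B G" "carrier G \<subseteq> frattini G <#> B"
  shows "B = carrier G"
proof (rule ccontr)
  assume "B \<noteq> carrier G"
  then obtain M where M: "maximal_subgroup M G" "B \<subseteq> M"
    using ex_maximal_subgroup assms(1) by blast
  have "frattini G \<subseteq> M" using M(1) by (auto simp: frattini_def)
  then have "carrier G \<subseteq> M"
    using assms(2) set_mult_least[of M "frattini G" B] M by (auto simp: maximal_subgroup_def)
  then show False using M(1) subgroup.subset by (auto simp: maximal_subgroup_def)
qed

lemma subgroup_carrier_Inter: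
  assumes "\<And>M. M \<in> \<F> \<Longrightarrow> subgroup M G"
  shows "subgroup (carrier G \<inter> \<Inter>\<F>) G"
  using subgroups_Inter[of "insert (carrier G) \<F>"] assms subgroup_self by auto

lemma frattini_subgroup: "subgroup (frattini G) G"
  unfolding frattini_def by (rule subgroup_carrier_Inter) (simp add: maximal_subgroup_def)

text \<open>Among the families whose members lower the order of the intersection by the full power
  \<open>p ^ card \<F>\<close>, a maximal one has the Frattini subgroup as intersection: a maximal
  subgroup not containing the intersection would meet it in index \<open>p\<close> and could be
  added. Comparing orders gives \<open>card \<F> = d\<close>.\<close>

lemma ex_maximal_family:
  assumes p: "prime p" and ord: "order G = p ^ k"
    and d: "p ^ d = order (G Mod frattini G)"
  obtains \<F> where "maximal_family G d \<F>"
proof -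
  let ?S = "{\<F>. \<F> \<subseteq> {M. maximal_subgroup M G} \<and> card (carrier G \<inter> \<Inter>\<F>) * p ^ card \<F> = order G}"
  have maxs: "{M. maximal_subgroup M G} \<subseteq> Pow (carrier G)"
    using subgroup.subset by (auto simp: maximal_subgroup_def)
  have fin: "finite {M. maximal_subgroup M G}"
    using finite_subset[OF maxs] finite_carrier by simp
  have "?S \<subseteq> Pow {M. maximal_subgroup M G}" by blast
  then have "finite ?S" using fin finite_subset by (metis (no_types, lifting) finite_Pow_iff)
  moreover have "{} \<in> ?S" by (simp add: order_def)
  ultimately obtain \<F> where F: "\<F> \<in> ?S" "\<forall>X\<in>?S. \<F> \<subseteq> X \<longrightarrow> \<F> = X"
    using finite_has_maximal by (metis (no_types, lifting) empty_iff)
  let ?D = "carrier G \<inter> \<Inter>\<F>"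
  have Dsub: "subgroup ?D G"
    using F(1) by (intro subgroup_carrier_Inter) (auto simp: maximal_subgroup_def)
  have finF: "finite \<F>" using F(1) fin finite_subset by blast
  have "?D \<subseteq> M" if M: "maximal_subgroup M G" for M
  proof (rule ccontr)
    assume nle: "\<not> ?D \<subseteq> M"
    note mx = p_group_maximal_subgroup[OF p ord M]
    note Ms = normal_subgroup[OF mx(1)]
    have "subgroup (?D <#> M) G" "M \<subseteq> ?D <#> M" "?D \<subseteq> ?D <#> M"
      using subgroup_set_mult[OF Dsub mx(1)] subset_set_mult_right[OF Dsub subgroup.subset[OF Ms]]
        subset_set_mult_left[OF subgroup.subset[OF Dsub] Ms] by auto
    then have "?D <#> M = carrier G"
      using M nle unfolding maximal_subgroup_def by blast
    then have "(card M * p) * card (?D \<inter> M) = card ?D * card M"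
      using card_set_mult[OF Dsub Ms] mx(2) by (simp add: order_def)
    then have "card ?D = p * card (?D \<inter> M)"
      using card_subgroup_pos[OF Ms] by simp
    moreover have "M \<notin> \<F>" using nle by blast
    moreover have "carrier G \<inter> \<Inter>(insert M \<F>) = ?D \<inter> M" by blast
    ultimately have "insert M \<F> \<in> ?S"
      using F(1) finF M by (simp add: mult.commute mult.left_commute)
    then show False using F(2) \<open>M \<notin> \<F>\<close> by blast
  qed
  then have D: "?D = frattini G"
    using F(1) unfolding frattini_def by blast
  have "p ^ d * card ?D = p ^ card \<F> * card ?D"
    using lagrange[OF frattini_subgroup] d F(1) D by (simp add: order_def FactGroup_def mult.commute)
  then have "p ^ d = p ^ card \<F>"
    using card_subgroup_pos[OF Dsub] by simp
  then have "d = card \<F>"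
    using prime_gt_1_nat[OF p] by (simp add: power_inject_exp)
  then have "maximal_family G d \<F>"
    unfolding maximal_family_def using F(1) finF D by blast
  then show thesis by (rule that)
qed

section \<open>Sylow subgroups and normal sections\<close>

lemma p_sylowD:
  assumes "p_sylow p P G"
  shows "subgroup P G" "\<not> p dvd order G div card P" "\<exists>k. card P = p ^ k"
  using assms by (auto simp: p_sylow_def)

lemma sylow_subgroup_p_sylow:
  assumes "prime p" "sylow_subgroup p P G"
  shows "p_sylow p P G"
proof -
  have "order G \<noteq> 0"
    using finite_carrier order_gt_0_iff_finite by simp
  then have "\<not> p dvd order G div p ^ multiplicity p (order G)"
    using multiplicity_decompose[of "order G" p] prime_gt_1_nat[OF assms(1)] by auto
  then show ?thesis using assms by (auto simp: p_sylow_def sylow_subgroup_def)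
qed

lemma p_sylow_index_normal:
  assumes P: "p_sylow p P G" and N: "N \<lhd> G"
  shows "\<not> p dvd card N div card (P \<inter> N)"
proof
  assume "p dvd card N div card (P \<inter> N)"
  note P = p_sylowD[OF P] and N' = normal_subgroup[OF N]
  have PN: "subgroup (P <#> N) G" "P \<subseteq> P <#> N"
    using subgroup_set_mult[OF P(1) N] subset_set_mult_left[OF subgroup.subset[OF P(1)] N'] by auto
  have I: "subgroup (P \<inter> N) G" using subgroup_Int P(1) N' by blast
  have "card N div card (P \<inter> N) = card (P <#> N) div card P"
    using card_set_mult[OF P(1) N'] card_subgroup_pos[OF I] card_subgroup_pos[OF P(1)]
      card_subgroup_dvd[OF I N'] card_subgroup_dvd[OF P(1) PN(1,2)]
    by (intro div_eq_div_cross) (auto simp: mult.commute)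
  moreover have "order G div card P = (order G div card (P <#> N)) * (card (P <#> N) div card P)"
    using index_mult[OF P(1) PN(1) subgroup_self PN(2) subgroup.subset[OF PN(1)]] by (simp add: order_def)
  ultimately show False
    using P(2) \<open>p dvd card N div card (P \<inter> N)\<close> by simp
qed

lemma card_subgroup_p_power:
  assumes "prime p" "subgroup P G" "card P = p ^ k" "subgroup B G" "B \<subseteq> P"
  shows "\<exists>j. card B = p ^ j"
  using divides_primepow_nat[OF assms(1)] card_subgroup_dvd[OF assms(4,2,5)] assms(3) by auto

text \<open>The index of \<open>(P \<inter> L) K\<close> in \<open>L\<close> divides both
  \<open>|L : K|\<close>, a power of \<open>p\<close>, and \<open>|L : P \<inter> L|\<close>, which
  is prime to \<open>p\<close>.\<close>

lemma p_sylow_covers: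
  assumes p: "prime p" and P: "p_sylow p P G" and KL: "K \<lhd> G" "L \<lhd> G" "K \<subseteq> L"
    and ix: "card L div card K = p ^ n"
  shows "(P \<inter> L) <#> K = L"
proof -
  note s = normal_subgroup[OF KL(1)] normal_subgroup[OF KL(2)]
  have I: "subgroup (P \<inter> L) G" using subgroup_Int p_sylowD(1)[OF P] s by blast
  let ?B = "(P \<inter> L) <#> K"
  have B: "subgroup ?B G" "P \<inter> L \<subseteq> ?B" "K \<subseteq> ?B" "?B \<subseteq> L"
    using subgroup_set_mult[OF I KL(1)] subset_set_mult_left[OF subgroup.subset[OF I] s(1)]
      subset_set_mult_right[OF I subgroup.subset[OF s(1)]] set_mult_least[OF s(2)] KL(3) by auto
  have "card L div card K = card L div card ?B * (card ?B div card K)"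
    "card L div card (P \<inter> L) = card L div card ?B * (card ?B div card (P \<inter> L))"
    by (rule index_mult[OF s(1) B(1) s(2) B(3,4)], rule index_mult[OF I B(1) s(2) B(2,4)])
  then have "card L div card ?B dvd p ^ n" "\<not> p dvd card L div card ?B"
    using ix p_sylow_index_normal[OF P KL(2)] by (metis dvd_triv_left, metis dvd_mult2)
  then have "card L div card ?B = 1"
    using prime_dvd_primepow_nat[OF p] by blast
  then have "card L = card ?B"
    using card_index_mult[OF B(1) s(2) B(4)] by simp
  then show ?thesis
    using B(4) finite_subgroup[OF s(2)] by (metis card_subset_eq)
qed

lemma p_sylow_contains:
  assumes "prime p" "p_sylow p P G" "R \<lhd> G" "card R = p ^ n"
  shows "R \<subseteq> P"
proof -
  have "(P \<inter> R) <#> {\<one>} = R"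
    using p_sylow_covers[OF assms(1,2) one_is_normal assms(3), of n] assms(4)
      subgroup.one_closed[OF normal_subgroup[OF assms(3)]] by simp
  moreover have "(P \<inter> R) <#> {\<one>} \<subseteq> P"
    using subgroup.one_closed[OF p_sylowD(1)[OF assms(2)]]
    by (intro set_mult_least[OF p_sylowD(1)[OF assms(2)]]) auto
  ultimately show ?thesis by simp
qed

text \<open>\<open>|P \<inter> L : P \<inter> K|\<close> is the index of \<open>K\<close> in
  \<open>(P \<inter> L) K\<close>; it is a power of \<open>p\<close> that divides
  \<open>|L : K|\<close>.\<close>

lemma p_sylow_Int_eq:
  assumes p: "prime p" and P: "p_sylow p P G" and KL: "K \<lhd> G" "L \<lhd> G" "K \<subseteq> L"
    and ix: "\<not> p dvd card L div card K"
  shows "P \<inter> L = P \<inter> K"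
proof -
  note s = normal_subgroup[OF KL(1)] normal_subgroup[OF KL(2)]
  have I: "subgroup (P \<inter> L) G" "subgroup (P \<inter> K) G"
    using subgroup_Int p_sylowD(1)[OF P] s by blast+
  have IK: "(P \<inter> L) \<inter> K = P \<inter> K" using KL(3) by auto
  let ?B = "(P \<inter> L) <#> K"
  have B: "subgroup ?B G" "K \<subseteq> ?B" "?B \<subseteq> L"
    using subgroup_set_mult[OF I(1) KL(1)]
      subset_set_mult_right[OF I(1) subgroup.subset[OF s(1)]] set_mult_least[OF s(2)] KL(3) by auto
  have le: "P \<inter> K \<subseteq> P \<inter> L" using KL(3) by auto
  have "card (P \<inter> L) div card (P \<inter> K) = card ?B div card K"
    using card_set_mult[OF I(1) s(1)] IK card_subgroup_pos[OF I(2)] card_subgroup_pos[OF s(1)]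
      card_subgroup_dvd[OF I(2,1) le] card_subgroup_dvd[OF s(1) B(1,2)]
    by (intro div_eq_div_cross) (auto simp: mult.commute)
  moreover have "card L div card K = card L div card ?B * (card ?B div card K)"
    by (rule index_mult[OF s(1) B(1) s(2) B(2,3)])
  ultimately have nd: "\<not> p dvd card (P \<inter> L) div card (P \<inter> K)"
    using ix by (metis dvd_mult)
  obtain k where "card P = p ^ k" using p_sylowD(3)[OF P] by blast
  then obtain j where "card (P \<inter> L) = p ^ j"
    using card_subgroup_p_power[OF p p_sylowD(1)[OF P] _ I(1)] by auto
  then have "card (P \<inter> L) div card (P \<inter> K) dvd p ^ j"
    using card_index_mult[OF I(2,1) le] by (metis dvd_triv_left)
  then have "card (P \<inter> L) div card (P \<inter> K) = 1"
    using nd prime_dvd_primepow_nat[OF p] by blast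
  then have "card (P \<inter> L) = card (P \<inter> K)"
    using card_index_mult[OF I(2,1) le] by simp
  then show ?thesis
    using le finite_subgroup[OF I(1)] by (metis card_subset_eq)
qed

end

lemma (in finite_epimorphism) p_sylow_image:
  assumes p: "prime p" and P: "p_sylow p P G"
  shows "p_sylow p (h ` P) H"
proof -
  note Ps = dom.p_sylowD[OF P]
  obtain k where k: "card P = p ^ k" using Ps(3) by blast
  have I: "subgroup (P \<inter> Ker) G" using G.subgroup_Int[OF Ps(1) subgroup_kernel] .
  note s = image_subgroup[OF Ps(1)]
  have cP: "card P = card (h ` P) * card (P \<inter> Ker)"
    by (rule card_image[OF Ps(1)])
  have cG: "order G = order H * card Ker"
    using card_image_Ker[OF G.subgroup_self subgroup.subset[OF subgroup_kernel]] surj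
    by (simp add: order_def)
  have "order H = (order H div card (h ` P)) * card (h ` P)"
    using dom.card_index_mult cod.card_index_mult[OF s H.subgroup_self subgroup.subset[OF s]]
    by (simp add: order_def)
  moreover have "card Ker = (card Ker div card (P \<inter> Ker)) * card (P \<inter> Ker)"
    using dom.card_index_mult[OF I subgroup_kernel] by simp
  ultimately have "order G = ((order H div card (h ` P)) * (card Ker div card (P \<inter> Ker))) * card P"
    using cG cP by (metis mult.assoc mult.commute)
  then have "order G div card P = (order H div card (h ` P)) * (card Ker div card (P \<inter> Ker))"
    using dom.card_subgroup_pos[OF Ps(1)] by (metis div_mult_self_is_m)
  then have "\<not> p dvd order H div card (h ` P)"
    using Ps(2) by auto
  moreover have "\<exists>j. card (h ` P) = p ^ j"
    using divides_primepow_nat[OF p] cP k by (metis dvd_triv_left)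
  ultimately show ?thesis using s by (simp add: p_sylow_def)
qed

subsection \<open>Averaging over cosets\<close>

lemma (in comm_monoid) finprod_swap:
  assumes "finite A" "finite B" "\<And>a b. a \<in> A \<Longrightarrow> b \<in> B \<Longrightarrow> f a b \<in> carrier G"
  shows "finprod G (\<lambda>a. finprod G (f a) B) A = finprod G (\<lambda>b. finprod G (\<lambda>a. f a b) A) B"
  using assms(1,3)
proof (induction A rule: finite_induct)
  case (insert a A)
  have "finprod G (\<lambda>a. finprod G (f a) B) (insert a A) =
      finprod G (f a) B \<otimes> finprod G (\<lambda>a. finprod G (f a) B) A"
    using insert by (intro finprod_insert) (auto intro!: finprod_closed)
  also have "\<dots> = finprod G (f a) B \<otimes> finprod G (\<lambda>b. finprod G (\<lambda>a. f a b) A) B"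
    using insert by simp
  also have "\<dots> = finprod G (\<lambda>b. f a b \<otimes> finprod G (\<lambda>a. f a b) A) B"
    using insert by (intro finprod_multf[symmetric]) (auto intro!: finprod_closed)
  also have "\<dots> = finprod G (\<lambda>b. finprod G (\<lambda>a. f a b) (insert a A)) B"
    using insert
    by (intro finprod_cong' refl finprod_insert[symmetric])
       (auto intro!: finprod_closed m_closed)
  finally show ?case .
qed simp

lemma (in comm_monoid) finprod_pow_sum:
  assumes "x \<in> carrier G" "finite A"
  shows "finprod G (\<lambda>a. x [^] (e a :: nat)) A = x [^] (\<Sum>a\<in>A. e a)"
  using assms(2)
proof (induction A rule: finite_induct)
  case (insert a A)
  then show ?case
    using assms(1) by (subst finprod_insert) (auto simp: nat_pow_mult)
qed simp

lemma (in comm_monoid) finprod_pow: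
  assumes "f \<in> A \<rightarrow> carrier G"
  shows "finprod G f A [^] (n::nat) = finprod G (\<lambda>a. f a [^] n) A"
  using assms
proof (induction A rule: infinite_finite_induct)
  case (insert a A)
  then have "finprod G f (insert a A) [^] n = (f a \<otimes> finprod G f A) [^] n"
    by (subst finprod_insert) auto
  also have "\<dots> = f a [^] n \<otimes> finprod G f A [^] n"
    using insert by (intro nat_pow_distrib) auto
  also have "\<dots> = finprod G (\<lambda>a. f a [^] n) (insert a A)"
    using insert by (subst finprod_insert) auto
  finally show ?case .
qed auto

lemma finprod_hom:
  assumes A: "comm_monoid A" and B: "comm_monoid B" and h: "h \<in> hom A B" "h \<one>\<^bsub>A\<^esub> = \<one>\<^bsub>B\<^esub>"
    and f: "f \<in> X \<rightarrow> carrier A"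
  shows "h (finprod A f X) = finprod B (\<lambda>x. h (f x)) X"
proof -
  interpret A: comm_monoid A by (rule A)
  interpret B: comm_monoid B by (rule B)
  show ?thesis
    using f
  proof (induction X rule: infinite_finite_induct)
    case (insert a X)
    have "h (finprod A f (insert a X)) = h (f a) \<otimes>\<^bsub>B\<^esub> h (finprod A f X)"
      using insert h by (subst A.finprod_insert) (auto simp: hom_def)
    also have "\<dots> = finprod B (\<lambda>x. h (f x)) (insert a X)"
      using insert h by (subst B.finprod_insert) (auto simp: hom_def)
    finally show ?case .
  qed (use h in auto)
qed

context group
begin

lemma pow_cong:
  assumes "x \<in> carrier G" "x [^] (n::nat) = \<one>" "[a = b] (mod n)"
  shows "x [^] a = x [^] b"
proof -
  have "x [^] c = x [^] (c mod n)" for c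
  proof -
    have "x [^] c = x [^] (n * (c div n) + c mod n)" by simp
    also have "\<dots> = (x [^] n) [^] (c div n) \<otimes> x [^] (c mod n)"
      using assms(1) by (simp only: nat_pow_mult[symmetric] nat_pow_pow)
    finally show ?thesis using assms(1,2) by simp
  qed
  then show ?thesis using assms(3) by (metis cong_def)
qed

lemma comm_subgroup:
  assumes "subgroup R G" "\<And>x y. x \<in> R \<Longrightarrow> y \<in> R \<Longrightarrow> x \<otimes> y = y \<otimes> x"
  shows "comm_group (G\<lparr>carrier := R\<rparr>)"
  using assms subgroup_imp_group[OF assms(1)] group.group_comm_groupI[of "G\<lparr>carrier := R\<rparr>"] by simp

lemma r_coset_eq_iff:
  assumes "subgroup R G" "x \<in> carrier G" "y \<in> carrier G"
  shows "R #> x = R #> y \<longleftrightarrow> x \<otimes> inv y \<in> R"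
proof
  assume "R #> x = R #> y"
  then have "x \<in> R #> y" using rcos_self[OF assms(2,1)] by simp
  then obtain r where r: "r \<in> R" "x = r \<otimes> y" by (auto simp: r_coset_def)
  then have "x \<otimes> inv y = r"
    using assms subgroup.mem_carrier[OF assms(1)] by (simp add: m_assoc)
  then show "x \<otimes> inv y \<in> R" using r by simp
next
  assume r: "x \<otimes> inv y \<in> R"
  have "x \<in> R #> y"
    unfolding r_coset_def using r assms by (auto simp: m_assoc intro!: bexI[of _ "x \<otimes> inv y"])
  then show "R #> x = R #> y"
    using repr_independence[OF _ assms(3,1)] by simp
qed

lemma conjugate_prod:
  assumes R: "R \<lhd> G" and comm: "comm_group (G\<lparr>carrier := R\<rparr>)" and g: "g \<in> carrier G"
    and f: "f \<in> C \<rightarrow> R"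
  shows "conjugate g (finprod (G\<lparr>carrier := R\<rparr>) f C) =
    finprod (G\<lparr>carrier := R\<rparr>) (\<lambda>c. conjugate g (f c)) C"
proof -
  note Rc = subgroup.mem_carrier[OF normal_subgroup[OF R]]
  have cm: "comm_monoid (G\<lparr>carrier := R\<rparr>)" using comm by (simp add: comm_group_def)
  show ?thesis
    using f Rc g normal_conjugate[OF R g]
    by (intro finprod_hom[OF cm cm]) (auto simp: hom_def conjugate_mult)
qed

text \<open>Multiplying a cocycle identity over all cosets removes the permutation
  \<open>\<sigma>\<close> by reindexing. What depends on a choice of representatives coset by coset
  thereby becomes a crossed homomorphism.\<close>

lemma cocycle_prod:
  assumes R: "R \<lhd> G" and comm: "comm_group (G\<lparr>carrier := R\<rparr>)" and g: "g \<in> carrier G"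
    and a: "a \<in> C \<rightarrow> R" and b: "b \<in> C \<rightarrow> R" and \<sigma>: "bij_betw \<sigma> C C"
    and f: "\<And>c. c \<in> C \<Longrightarrow> f c = conjugate g (a c) \<otimes> b (\<sigma> c)"
  shows "finprod (G\<lparr>carrier := R\<rparr>) f C =
    conjugate g (finprod (G\<lparr>carrier := R\<rparr>) a C) \<otimes> finprod (G\<lparr>carrier := R\<rparr>) b C"
proof -
  let ?R = "G\<lparr>carrier := R\<rparr>"
  interpret R: comm_group ?R by (rule comm)
  note conj = normal_conjugate[OF R g]
  have \<sigma>C: "\<sigma> ` C = C" "inj_on \<sigma> C" using \<sigma> by (auto simp: bij_betw_def)
  have bs: "(\<lambda>c. b (\<sigma> c)) \<in> C \<rightarrow> R" using b \<sigma>C by auto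
  have "finprod ?R f C =
      finprod ?R (\<lambda>c. conjugate g (a c) \<otimes>\<^bsub>?R\<^esub> b (\<sigma> c)) C"
    using f a bs conj R.m_closed by (intro R.finprod_cong') (auto simp: Pi_def)
  also have "\<dots> = finprod ?R (\<lambda>c. conjugate g (a c)) C \<otimes>\<^bsub>?R\<^esub>
      finprod ?R (\<lambda>c. b (\<sigma> c)) C"
    using a bs conj by (intro R.finprod_multf) (auto simp: Pi_def)
  also have "finprod ?R (\<lambda>c. b (\<sigma> c)) C = finprod ?R b C"
    using R.finprod_reindex[of b \<sigma> C] b \<sigma>C by simp
  finally show ?thesis
    using conjugate_prod[OF R comm g a] by simp
qed

end

context finite_group
begin

lemma pow_card_subgroup:
  assumes "subgroup H G" "x \<in> H"
  shows "x [^] card H = \<one>"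
proof -
  interpret H: finite_group "G\<lparr>carrier := H\<rparr>"
    by (rule subgroup_finite_group[OF assms(1)])
  show ?thesis
    using H.pow_order_eq_1[of x] assms nat_pow_consistent[of x "card H" H] by (simp add: order_def)
qed

lemma coprime_root:
  assumes "subgroup H G" "coprime n (card H)"
  obtains m :: nat where "\<And>x. x \<in> H \<Longrightarrow> (x [^] n) [^] m = x"
proof -
  obtain m where m: "[n * m = Suc 0] (mod card H)"
    using cong_solve_coprime_nat[OF assms(2)] by blast
  have "(x [^] n) [^] m = x" if x: "x \<in> H" for x
  proof -
    have xc: "x \<in> carrier G" using x subgroup.mem_carrier[OF assms(1)] by blast
    show ?thesis
      using pow_cong[OF xc pow_card_subgroup[OF assms(1) x] m] xc by (simp add: nat_pow_pow)
  qed
  then show thesis by (rule that)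
qed

text \<open>On \<open>R\<close> the map is raising to the power \<open>n\<close>, which is injective
  as \<open>n\<close> is prime to \<open>|R|\<close>, so the kernel meets \<open>R\<close>
  trivially. It is also surjective there, so every \<open>x\<close> can be corrected by an
  \<open>n\<close>-th root of \<open>f x\<close> to land in the kernel. All complements below are
  obtained in this way.\<close>

lemma crossed_hom_kernel:
  assumes R: "subgroup R G" and S: "subgroup S G" and RS: "R \<subseteq> S"
    and comm: "\<And>x y. x \<in> R \<Longrightarrow> y \<in> R \<Longrightarrow> x \<otimes> y = y \<otimes> x"
    and fR: "\<And>x. x \<in> S \<Longrightarrow> f x \<in> R"
    and f_mult: "\<And>x y. x \<in> S \<Longrightarrow> y \<in> S \<Longrightarrow> f (x \<otimes> y) = conjugate x (f y) \<otimes> f x"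
    and f_pow: "\<And>z. z \<in> R \<Longrightarrow> f z = z [^] (n::nat)" and cop: "coprime n (card R)"
  shows "subgroup {x \<in> S. f x = \<one>} G" (is "subgroup ?Q G") "R \<inter> {x \<in> S. f x = \<one>} = {\<one>}"
    "R <#> {x \<in> S. f x = \<one>} = S"
proof -
  note Rc = subgroup.mem_carrier[OF R] and Sc = subgroup.mem_carrier[OF S]
  obtain m :: nat where root: "\<And>x. x \<in> R \<Longrightarrow> (x [^] n) [^] m = x"
    using coprime_root[OF R cop] by blast
  have f1: "f \<one> = \<one>" using f_pow[OF subgroup.one_closed[OF R]] by simp
  show Q: "subgroup ?Q G"
  proof (rule subgroupI)
    show "?Q \<subseteq> carrier G" using Sc by auto
    show "?Q \<noteq> {}" using f1 subgroup.one_closed[OF S] by auto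
    fix a assume a: "a \<in> ?Q"
    then have ia: "inv a \<in> S" using subgroup.m_inv_closed[OF S] by blast
    have "f (inv a \<otimes> a) = conjugate (inv a) (f a) \<otimes> f (inv a)" using ia a by (intro f_mult) auto
    then show "inv a \<in> ?Q" using a ia f1 Sc Rc[OF fR[OF ia]] by simp
    fix b assume "b \<in> ?Q"
    then show "a \<otimes> b \<in> ?Q" using a Sc f_mult subgroup.m_closed[OF S] by simp
  qed
  have "z = \<one>" if "z \<in> R" "f z = \<one>" for z
    using root[OF that(1)] unfolding f_pow[OF that(1), symmetric] that(2) by simp
  then show "R \<inter> ?Q = {\<one>}"
    using subgroup.one_closed[OF R] subgroup.one_closed[OF Q] by blast
  show "R <#> ?Q = S"
  proof
    show "R <#> ?Q \<subseteq> S" using RS by (intro set_mult_least[OF S]) auto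
    show "S \<subseteq> R <#> ?Q"
    proof
      fix x assume x: "x \<in> S"
      note fx = fR[OF x]
      \<comment> \<open>The \<open>n\<close>-th root of \<open>f x\<close> in \<open>R\<close>. As
        \<open>R\<close> is abelian, \<open>inv z\<close> acts trivially on \<open>f x\<close>, and
        \<open>f (inv z)\<close> is the inverse of \<open>f x\<close>.\<close>
      define z where "z = f x [^] m"
      have zR: "z \<in> R" unfolding z_def using powers_subset[OF R fx] by blast
      have zn: "z [^] n = f x"
        using root[OF fx] Rc[OF fx] by (simp add: z_def nat_pow_pow mult.commute)
      have iz: "inv z \<in> R" "inv z \<in> S" using subgroup.m_inv_closed[OF R zR] RS by auto
      have "conjugate (inv z) (f x) = f x"
        using comm[OF iz(1) fx] Rc fx iz by (simp add: conjugate_fixed_iff)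
      then have "f (inv z \<otimes> x) = f x \<otimes> f (inv z)"
        using f_mult[OF iz(2) x] by simp
      also have "\<dots> = \<one>"
        using f_pow[OF iz(1)] zn[symmetric] Rc[OF zR] by (simp add: nat_pow_inv)
      finally have "inv z \<otimes> x \<in> ?Q"
        using iz(2) x subgroup.m_closed[OF S] by blast
      moreover have "x = z \<otimes> (inv z \<otimes> x)" using Sc[OF x] Rc[OF zR] by simp
      ultimately show "x \<in> R <#> ?Q" using zR mem_set_mult by blast
    qed
  qed
qed

end

section \<open>Representatives of a normal section and their cocycles\<close>

locale coset_section = finite_group +
  fixes R E
  assumes R: "R \<lhd> G" and E: "E \<lhd> G" and R_sub: "R \<subseteq> E"
begin

definition C where "C = (\<lambda>x. R #> x) ` E"

definition t where "t c = (SOME x. x \<in> E \<and> c = R #> x)"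

lemma t: "c \<in> C \<Longrightarrow> t c \<in> E \<and> R #> t c = c"
proof -
  assume "c \<in> C"
  then have "\<exists>x. x \<in> E \<and> c = R #> x" by (auto simp: C_def)
  then have "t c \<in> E \<and> c = R #> t c" unfolding t_def by (rule someI_ex)
  then show ?thesis by simp
qed

lemmas R_carrier = subgroup.mem_carrier[OF normal_subgroup[OF R]]
  and E_carrier = subgroup.mem_carrier[OF normal_subgroup[OF E]]

lemma t_carrier [simp]: "c \<in> C \<Longrightarrow> t c \<in> carrier G"
  using t E_carrier by blast

lemma coset_eq: "x \<in> E \<Longrightarrow> y \<in> E \<Longrightarrow> R #> x = R #> y \<longleftrightarrow> x \<otimes> inv y \<in> R"
  using r_coset_eq_iff[OF normal_subgroup[OF R]] E_carrier by simp

lemma coset_in_C [simp]: "x \<in> E \<Longrightarrow> R #> x \<in> C"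
  by (simp add: C_def)

lemma card_C: "card C = card E div card R"
proof -
  have "C = rcosets\<^bsub>G\<lparr>carrier := E\<rparr>\<^esub> R"
    by (auto simp: C_def RCOSETS_def r_coset_def)
  then show ?thesis
    using card_rcosets_subgroup[OF normal_subgroup[OF R] normal_subgroup[OF E] R_sub]
      card_subgroup_pos[OF normal_subgroup[OF R]] by (metis div_mult_self_is_m)
qed

text \<open>Conjugation by elements of \<open>G\<close> and left multiplication by elements of
  \<open>E\<close> both respect congruence modulo \<open>R\<close>; this common notion lets both
  permute the cosets through \<open>induced\<close>.\<close>

definition coset_map :: "('a \<Rightarrow> 'a) \<Rightarrow> bool" where
  "coset_map f \<longleftrightarrow> f \<in> E \<rightarrow> E \<and> (\<forall>x\<in>E. \<forall>y\<in>E. x \<otimes> inv y \<in> R \<longrightarrow> f x \<otimes> inv (f y) \<in> R)"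

definition induced where "induced f c = R #> f (t c)"

lemma induced_coset:
  assumes "coset_map f" "x \<in> E"
  shows "induced f (R #> x) = R #> f x"
proof -
  have "t (R #> x) \<in> E" "R #> t (R #> x) = R #> x"
    using t[of "R #> x"] assms(2) by auto
  then show ?thesis
    using assms coset_eq unfolding induced_def coset_map_def by (auto simp: Pi_iff)
qed

lemma bij_betw_induced:
  assumes "coset_map f" "coset_map f'" "\<And>x. x \<in> E \<Longrightarrow> f' (f x) = x" "\<And>x. x \<in> E \<Longrightarrow> f (f' x) = x"
  shows "bij_betw (induced f) C C"
proof (rule bij_betw_byWitness[where f' = "induced f'"])
  have f: "f x \<in> E" "f' x \<in> E" if "x \<in> E" for x
    using assms(1,2) that by (auto simp: coset_map_def)
  show "\<forall>c\<in>C. induced f' (induced f c) = c" "\<forall>c\<in>C. induced f (induced f' c) = c"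
    "induced f ` C \<subseteq> C" "induced f' ` C \<subseteq> C"
    using assms f by (auto simp: C_def induced_coset)
qed

lemma coset_map_conjugate:
  assumes "g \<in> carrier G" shows "coset_map (conjugate g)"
  unfolding coset_map_def
  using assms normal_conjugate[OF E] normal_conjugate[OF R assms] E_carrier
  by (auto simp: conjugate_inv[symmetric] conjugate_mult[symmetric])

lemma coset_map_mult:
  assumes e: "e \<in> E" shows "coset_map (\<lambda>x. e \<otimes> x)"
  unfolding coset_map_def
proof (intro conjI ballI impI)
  show "(\<lambda>x. e \<otimes> x) \<in> E \<rightarrow> E"
    using e subgroup.m_closed[OF normal_subgroup[OF E]] by auto
  fix x y assume xy: "x \<in> E" "y \<in> E" "x \<otimes> inv y \<in> R"
  have "e \<otimes> x \<otimes> inv (e \<otimes> y) = conjugate e (x \<otimes> inv y)"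
    using e xy E_carrier by (simp add: conjugate_def inv_mult_group m_assoc)
  then show "e \<otimes> x \<otimes> inv (e \<otimes> y) \<in> R"
    using normal_conjugate[OF R] e xy E_carrier by simp
qed

lemma bij_betw_conjugate: "g \<in> carrier G \<Longrightarrow> bij_betw (induced (conjugate g)) C C"
  using E_carrier by (intro bij_betw_induced[of _ "conjugate (inv g)"] coset_map_conjugate) auto

lemma bij_betw_mult: "e \<in> E \<Longrightarrow> bij_betw (induced (\<lambda>x. e \<otimes> x)) C C"
  using E_carrier subgroup.m_inv_closed[OF normal_subgroup[OF E]]
  by (intro bij_betw_induced[of _ "\<lambda>x. inv e \<otimes> x"] coset_map_mult) auto

lemma coset_map_mem: "coset_map f \<Longrightarrow> x \<in> E \<Longrightarrow> f x \<in> E"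
  by (auto simp: coset_map_def)

lemma induced_C: "coset_map f \<Longrightarrow> c \<in> C \<Longrightarrow> induced f c \<in> C"
  using t by (simp add: induced_def coset_map_mem)

lemma induced_comp:
  assumes "coset_map f" "coset_map f'" "c \<in> C"
  shows "induced f (induced f' c) = R #> f (f' (t c))"
  using assms t induced_coset[OF assms(1), of "f' (t c)"]
  by (simp add: induced_def[of f'] coset_map_mem)

text \<open>The image of a representative and the representative of the image lie in the same coset.
  Their quotient is the cocycle behind the two complements that follow.\<close>

lemma defect_in_R:
  assumes "coset_map f" "c \<in> C"
  shows "f (t c) \<otimes> inv (t (induced f c)) \<in> R"
  using assms t[OF assms(2)] t[OF induced_C[OF assms]] coset_eq[of "f (t c)" "t (induced f c)"]
  by (simp add: induced_def coset_map_mem)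

end

context finite_group
begin

text \<open>The product \<open>\<phi>\<close> is the transfer of \<open>E\<close> into the central
  subgroup \<open>Z\<close>. It is the power map with exponent \<open>n = |E : Z|\<close> on
  \<open>Z\<close>, so its kernel \<open>Q\<close> complements \<open>Z\<close> in \<open>E\<close>
  and has order \<open>n\<close>.\<close>

lemma central_complement:
  assumes Z: "Z \<lhd> G" and E: "E \<lhd> G" and ZE: "Z \<subseteq> E"
    and central: "\<And>z e. z \<in> Z \<Longrightarrow> e \<in> E \<Longrightarrow> z \<otimes> e = e \<otimes> z"
    and cop: "coprime (card Z) (card E div card Z)"
  obtains Q where "Q \<lhd> G" "Q \<subseteq> E" "card Q = card E div card Z"
proof -
  interpret coset_section G Z E
    by (intro coset_section.intro coset_section_axioms.intro Z E ZE finite_group_axioms)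
  note Zs = normal_subgroup[OF Z] and Es = normal_subgroup[OF E]
  define n where "n = card E div card Z"
  have cm: "comm_group (G\<lparr>carrier := Z\<rparr>)"
    using central ZE by (intro comm_subgroup[OF Zs]) auto
  interpret Z: comm_group "G\<lparr>carrier := Z\<rparr>" by (rule cm)
  define act where "act a = induced (\<lambda>x. a \<otimes> x)" for a
  define \<tau> where "\<tau> a c = a \<otimes> t c \<otimes> inv (t (act a c))" for a c
  define \<phi> where "\<phi> a = finprod (G\<lparr>carrier := Z\<rparr>) (\<tau> a) C" for a
  have \<tau>: "\<tau> a \<in> C \<rightarrow> Z" if "a \<in> E" for a
    using defect_in_R[OF coset_map_mult[OF that]] by (auto simp: \<tau>_def act_def)
  have \<phi>Z: "\<phi> a \<in> Z" if "a \<in> E" for a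
    using Z.finprod_closed[of "\<tau> a" C] \<tau>[OF that] by (simp add: \<phi>_def)
  have \<phi>_mult: "\<phi> (a \<otimes> b) = conjugate a (\<phi> b) \<otimes> \<phi> a" if a: "a \<in> E" and b: "b \<in> E" for a b
  proof -
    have ac: "a \<in> carrier G" "b \<in> carrier G" using a b E_carrier by auto
    have "\<tau> (a \<otimes> b) c = conjugate a (\<tau> b c) \<otimes> \<tau> a (act b c)" if c: "c \<in> C" for c
    proof -
      have "act a (act b c) = act (a \<otimes> b) c"
        unfolding act_def using induced_comp[OF coset_map_mult[OF a] coset_map_mult[OF b] c] ac c
        by (simp add: induced_def m_assoc)
      moreover have "act b c \<in> C" "act (a \<otimes> b) c \<in> C"
        using induced_C[OF coset_map_mult] c a b subgroup.m_closed[OF Es] by (auto simp: act_def)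
      ultimately show ?thesis
        using ac c by (simp add: \<tau>_def conjugate_def m_assoc)
    qed
    then show ?thesis
      unfolding \<phi>_def using bij_betw_mult[OF b] \<tau> a b
      by (intro cocycle_prod[OF Z cm ac(1), of _ _ _ "act b"]) (auto simp: act_def)
  qed
  have \<phi>_Z: "\<phi> z = z [^] n" if z: "z \<in> Z" for z
  proof -
    have "\<tau> z c = z" if c: "c \<in> C" for c
    proof -
      have "z \<otimes> t c \<otimes> inv (t c) \<in> Z" using z c R_carrier by (simp add: m_assoc)
      then have "Z #> (z \<otimes> t c) = Z #> t c"
        using coset_eq[of "z \<otimes> t c" "t c"] z ZE t[OF c] subgroup.m_closed[OF Es] by auto
      then have "act z c = c"
        using t[OF c] by (simp add: act_def induced_def)
      then show ?thesis using z c R_carrier by (simp add: \<tau>_def m_assoc)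
    qed
    then have "\<phi> z = finprod (G\<lparr>carrier := Z\<rparr>) (\<lambda>_. z) C"
      unfolding \<phi>_def using z by (intro Z.finprod_cong') auto
    also have "\<dots> = z [^] n"
      using Z.finprod_const[of z C] z card_C nat_pow_consistent[of z n Z, symmetric] by (simp add: n_def)
    finally show ?thesis .
  qed
  have copn: "coprime n (card Z)" using cop by (simp add: n_def coprime_commute)
  then obtain m :: nat where root: "\<And>x. x \<in> Z \<Longrightarrow> (x [^] n) [^] m = x"
    using coprime_root[OF Zs] by blast
  have triv: "z = \<one>" if "z \<in> Z" "z [^] n = \<one>" for z
    using root[OF that(1)] that(2) by simp
  define Q where "Q = {x \<in> E. \<phi> x = \<one>}"
  have "x \<otimes> y = y \<otimes> x" if "x \<in> Z" "y \<in> Z" for x y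
    using central that ZE by blast
  note ker = crossed_hom_kernel[OF Zs Es ZE this \<phi>Z \<phi>_mult \<phi>_Z copn, folded Q_def]
  note Qs = ker(1)
  have \<phi>1: "\<phi> \<one> = \<one>"
    using \<phi>_Z[OF subgroup.one_closed[OF Zs]] by simp
  have "card E = card Z * card Q"
    using card_set_mult[OF Zs Qs] ker(2,3) by simp
  then have cQ: "card Q = n"
    using card_subgroup_pos[OF Zs] by (simp add: n_def)
  have \<phi>_pow: "x [^] k \<in> E \<and> \<phi> (x [^] k) = \<phi> x [^] k" if x: "x \<in> E" for x and k :: nat
  proof (induction k)
    case 0 then show ?case using \<phi>1 subgroup.one_closed[OF Es] by simp
  next
    case (Suc k)
    moreover from this have "conjugate (x [^] k) (\<phi> x) = \<phi> x"
      using central[OF \<phi>Z[OF x], of "x [^] k"] R_carrier[OF \<phi>Z[OF x]] E_carrier by (simp add: conjugate_fixed_iff)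
    ultimately have "\<phi> (x [^] k \<otimes> x) = \<phi> x \<otimes> \<phi> x [^] k"
      using \<phi>_mult[OF _ x] by simp
    then show ?case
      using Suc x subgroup.m_closed[OF Es] R_carrier[OF \<phi>Z[OF x]] nat_pow_Suc2[of "\<phi> x" k] by simp
  qed
  \<comment> \<open>This description involves no representatives, so \<open>Q\<close> is invariant
    under all of \<open>G\<close> and not only under \<open>E\<close>.\<close>
  have Q_iff: "x \<in> Q \<longleftrightarrow> x [^] n = \<one>" if x: "x \<in> E" for x
  proof
    show "x [^] n = \<one>" if "x \<in> Q" using pow_card_subgroup[OF Qs that] cQ by simp
    assume "x [^] n = \<one>"
    then have "\<phi> x [^] n = \<one>" using \<phi>_pow[OF x, of n] \<phi>1 by simp
    then show "x \<in> Q" using triv[OF \<phi>Z[OF x]] x by (simp add: Q_def)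
  qed
  have "conjugate g x \<in> Q" if g: "g \<in> carrier G" and x: "x \<in> Q" for g x
  proof -
    have xE: "x \<in> E" using x by (simp add: Q_def)
    then show ?thesis
      using Q_iff[OF normal_conjugate[OF E g xE]] Q_iff[OF xE] x conjugate_pow[OF g E_carrier[OF xE]] g
      by (metis conjugate_one)
  qed
  then have "Q \<lhd> G" using Qs by (simp add: normal_iff_conjugate)
  then show thesis using that cQ by (auto simp: Q_def n_def)
qed

text \<open>The cocycle records how conjugation by \<open>g\<close> moves the representatives of
  \<open>E / R\<close>. It is defined for every \<open>g\<close> in \<open>G\<close>, so the kernel
  of the product \<open>\<delta>\<close> complements \<open>R\<close> in all of \<open>G\<close>;
  this stands in for a complement of \<open>R\<close> in \<open>E\<close> followed by a Frattini
  argument. The absence of fixed points enters by killing the norm.\<close>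

lemma complement_of_fixed_point_free:
  assumes R: "R \<lhd> G" and E: "E \<lhd> G" and RE: "R \<subseteq> E"
    and comm: "\<And>x y. x \<in> R \<Longrightarrow> y \<in> R \<Longrightarrow> x \<otimes> y = y \<otimes> x"
    and fpf: "\<And>r. r \<in> R \<Longrightarrow> (\<And>e. e \<in> E \<Longrightarrow> conjugate e r = r) \<Longrightarrow> r = \<one>"
    and cop: "coprime (card R) (card E div card R)"
  obtains M where "subgroup M G" "R \<inter> M = {\<one>}" "R <#> M = carrier G"
proof -
  let ?R = "G\<lparr>carrier := R\<rparr>"
  interpret coset_section G R E
    by (intro coset_section.intro coset_section_axioms.intro R E RE finite_group_axioms)
  note Rs = normal_subgroup[OF R] and Es = normal_subgroup[OF E]
  define n where "n = card E div card R"
  have cm: "comm_group ?R"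
    using comm by (intro comm_subgroup[OF Rs]) auto
  interpret R: comm_group ?R by (rule cm)
  have conj_R: "conjugate r s = s" if "r \<in> R" "s \<in> R" for r s
    using comm[OF that] that R_carrier by (simp add: conjugate_fixed_iff)
  define act where "act g = induced (conjugate g)" for g
  define \<tau> where "\<tau> g c = conjugate g (t c) \<otimes> inv (t (act g c))" for g c
  define \<delta> where "\<delta> g = finprod ?R (\<tau> g) C" for g
  have \<tau>: "\<tau> g \<in> C \<rightarrow> R" if "g \<in> carrier G" for g
    using defect_in_R[OF coset_map_conjugate[OF that]] by (auto simp: \<tau>_def act_def)
  have \<delta>R: "\<delta> g \<in> R" if "g \<in> carrier G" for g
    using R.finprod_closed[of "\<tau> g" C] \<tau>[OF that] by (simp add: \<delta>_def)
  have \<delta>_mult: "\<delta> (g \<otimes> h) = conjugate g (\<delta> h) \<otimes> \<delta> g"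
    if g: "g \<in> carrier G" and h: "h \<in> carrier G" for g h
  proof -
    have "\<tau> (g \<otimes> h) c = conjugate g (\<tau> h c) \<otimes> \<tau> g (act h c)" if c: "c \<in> C" for c
    proof -
      have "act g (act h c) = act (g \<otimes> h) c"
        unfolding act_def using induced_comp[OF coset_map_conjugate[OF g] coset_map_conjugate[OF h] c] g h c
        by (simp add: induced_def conjugate_conjugate)
      moreover have "act h c \<in> C" "act (g \<otimes> h) c \<in> C"
        using induced_C[OF coset_map_conjugate] c g h by (auto simp: act_def)
      ultimately show ?thesis
        using g h c by (simp add: \<tau>_def conjugate_mult conjugate_conjugate conjugate_inv m_assoc)
    qed
    then show ?thesis
      unfolding \<delta>_def using bij_betw_conjugate[OF h] \<tau> g h
      by (intro cocycle_prod[OF R cm g, of _ _ _ "act h"]) (auto simp: act_def)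
  qed
  \<comment> \<open>As \<open>R\<close> is abelian, a factor depends only on the coset
    \<open>c\<close> and not on \<open>t c\<close>. Left multiplication by \<open>e\<close> in
    \<open>E\<close> permutes the cosets, so \<open>norm s\<close> is fixed by \<open>E\<close> and
    hence trivial.\<close>
  define norm where "norm s = finprod ?R (\<lambda>c. conjugate (t c) s) C" for s
  have norm1: "norm s = \<one>" if s: "s \<in> R" for s
  proof (rule fpf)
    have conjs: "(\<lambda>c. conjugate (t c) s) \<in> C \<rightarrow> R"
      using normal_conjugate[OF R _ s] by auto
    then show nR: "norm s \<in> R"
      using R.finprod_closed[of "\<lambda>c. conjugate (t c) s" C] by (simp add: norm_def)
    fix e assume e: "e \<in> E"
    have ec: "e \<in> carrier G" using e E_carrier by simp
    let ?\<sigma> = "induced (\<lambda>x. e \<otimes> x)"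
    have "conjugate e (conjugate (t c) s) = conjugate (t (?\<sigma> c)) s" if c: "c \<in> C" for c
    proof -
      have \<sigma>c: "?\<sigma> c \<in> C" using induced_C[OF coset_map_mult[OF e] c] .
      have d: "e \<otimes> t c \<otimes> inv (t (?\<sigma> c)) \<in> R"
        using defect_in_R[OF coset_map_mult[OF e] c] .
      have "conjugate e (conjugate (t c) s) =
          conjugate (e \<otimes> t c \<otimes> inv (t (?\<sigma> c))) (conjugate (t (?\<sigma> c)) s)"
        using ec c \<sigma>c s R_carrier by (simp add: conjugate_conjugate m_assoc)
      then show ?thesis
        using conj_R[OF d normal_conjugate[OF R _ s]] \<sigma>c by simp
    qed
    then have "finprod ?R (\<lambda>c. conjugate e (conjugate (t c) s)) C =
        finprod ?R (\<lambda>c. conjugate (t (?\<sigma> c)) s) C"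
      using normal_conjugate[OF R _ s] induced_C[OF coset_map_mult[OF e]]
      by (intro R.finprod_cong') auto
    also have "\<dots> = norm s"
      using R.finprod_reindex[of "\<lambda>c. conjugate (t c) s" ?\<sigma> C] bij_betw_mult[OF e] conjs
      by (simp add: bij_betw_def norm_def)
    finally show "conjugate e (norm s) = norm s"
      using conjugate_prod[OF R cm ec conjs] by (simp add: norm_def)
  qed
  \<comment> \<open>Conjugation by \<open>r\<close> fixes every coset of \<open>R\<close>, so each
    factor is the commutator of \<open>r\<close> with \<open>t c\<close>; the product is
    \<open>r [^] n\<close> times the norm of \<open>inv r\<close>.\<close>
  have \<delta>_R: "\<delta> r = r [^] n" if r: "r \<in> R" for r
  proof -
    have rc: "r \<in> carrier G" using r R_carrier by simp
    have "\<tau> r c = r \<otimes> conjugate (t c) (inv r)" if c: "c \<in> C" for c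
    proof -
      have eq: "conjugate r (t c) \<otimes> inv (t c) = r \<otimes> conjugate (t c) (inv r)"
        using rc c by (simp add: conjugate_def m_assoc)
      also have "\<dots> \<in> R"
        using r c normal_conjugate[OF R, of "t c" "inv r"] subgroup.m_closed[OF Rs] subgroup.m_inv_closed[OF Rs]
        by simp
      finally have "R #> conjugate r (t c) = R #> t c"
        using coset_eq[of "conjugate r (t c)" "t c"] t[OF c] normal_conjugate[OF E rc, of "t c"] by auto
      then have "act r c = c"
        using t[OF c] by (simp add: act_def induced_def)
      then show ?thesis using eq by (simp add: \<tau>_def)
    qed
    then have "\<delta> r = finprod ?R (\<lambda>c. r \<otimes>\<^bsub>?R\<^esub> conjugate (t c) (inv r)) C"
      unfolding \<delta>_def
      using r normal_conjugate[OF R] subgroup.m_inv_closed[OF Rs] subgroup.m_closed[OF Rs]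
      by (intro R.finprod_cong') auto
    also have "\<dots> = finprod ?R (\<lambda>_. r) C \<otimes>\<^bsub>?R\<^esub> norm (inv r)"
      unfolding norm_def
      using r normal_conjugate[OF R] subgroup.m_inv_closed[OF Rs]
      by (intro R.finprod_multf) auto
    also have "\<dots> = r [^] n"
      using R.finprod_const[of r C] r rc card_C nat_pow_consistent[of r n R, symmetric]
        norm1[OF subgroup.m_inv_closed[OF Rs r]] by (simp add: n_def)
    finally show ?thesis .
  qed
  have copn: "coprime n (card R)" using cop by (simp add: n_def coprime_commute)
  note ker = crossed_hom_kernel[OF Rs subgroup_self subgroup.subset[OF Rs] comm \<delta>R \<delta>_mult \<delta>_R copn]
  show thesis by (rule that[OF ker])
qed

end

section \<open>Eigenvectors of automorphisms whose order divides \<open>p - 1\<close>\<close>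

lemma ex_primroot_power_sum:
  fixes p :: nat
  assumes p: "prime p"
  obtains u :: nat where "coprime p u" "[u ^ (p - 1) = 1] (mod p)"
    "\<And>k. 0 < k \<Longrightarrow> k < p - 1 \<Longrightarrow> [(\<Sum>j<p - 1. u ^ (j * k)) = 0] (mod p)"
proof -
  obtain u where u: "residue_primroot p u"
    using prime_primitive_root_exists[OF prime_gt_1_nat[OF p] p] by blast
  have ord: "ord p u = p - 1" and cop: "coprime p u"
    using u p by (auto simp: residue_primroot_def totient_prime)
  have one: "[u ^ (p - 1) = 1] (mod p)"
    using ord ord_divides[of u "p - 1" p] by simp
  have "[(\<Sum>j<p - 1. u ^ (j * k)) = 0] (mod p)" if k: "0 < k" "k < p - 1" for k
  proof -
    have "\<not> [u ^ k = 1] (mod p)"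
      using ord k ord_divides[of u k p] by (auto dest: dvd_imp_le)
    then have nd: "\<not> int p dvd int u ^ k - 1"
      by (metis cong_iff_dvd_diff cong_int_iff of_nat_1 of_nat_power)
    have "[(u ^ (p - 1)) ^ k = 1 ^ k] (mod p)"
      by (rule cong_pow[OF one])
    then have "int p dvd (int u ^ (p - 1)) ^ k - 1"
      by (metis cong_iff_dvd_diff cong_int_iff of_nat_1 of_nat_power power_one)
    \<comment> \<open>The geometric sum times \<open>u ^ k - 1\<close> vanishes modulo
      \<open>p\<close>, while \<open>u ^ k - 1\<close> does not because \<open>u\<close> has order
      \<open>p - 1\<close>.\<close>
    moreover have "(int u ^ (p - 1)) ^ k - 1 = (int u ^ k - 1) * (\<Sum>j<p - 1. (int u ^ k) ^ j)"
      using power_diff_1_eq[of "int u ^ k" "p - 1"] by (simp add: power_mult[symmetric] mult.commute)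
    ultimately have "int p dvd (\<Sum>j<p - 1. (int u ^ k) ^ j)"
      using nd p prime_dvd_multD[of "int p"] by auto
    also have "(\<Sum>j<p - 1. (int u ^ k) ^ j) = int (\<Sum>j<p - 1. u ^ (j * k))"
      by (simp add: power_mult[symmetric] mult.commute)
    finally show ?thesis unfolding cong_0_iff int_dvd_int_iff .
  qed
  then show thesis by (rule that[OF cop one])
qed

text \<open>An automorphism \<open>\<gamma>\<close> with \<open>\<gamma>\<^sup>p\<^sup>-\<^sup>1 = 1\<close> of an elementary abelian \<open>p\<close>-group has an eigenvector:
  with a primitive root \<open>u\<close> the element \<open>w j = \<Prod>\<^sub>k \<gamma>\<^sup>k(r)\<^bsup>u\<^sup>j\<^sup>k\<^esup>\<close> satisfies \<open>\<gamma>(w j)\<^bsup>u\<^sup>j\<^esup> = w j\<close>, and the product of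
  all \<open>w j\<close> is \<open>r\<^sup>p\<^sup>-\<^sup>1 \<noteq> 1\<close>.\<close>

lemma (in comm_group) ex_eigenvector:
  fixes p :: nat
  assumes p: "prime p" and exponent: "\<And>x. x \<in> carrier G \<Longrightarrow> x [^] p = \<one>"
    and \<gamma>: "\<gamma> \<in> hom G G" and \<gamma>_order: "\<And>x. x \<in> carrier G \<Longrightarrow> (\<gamma> ^^ (p - 1)) x = x"
    and r: "r \<in> carrier G" "r \<noteq> \<one>"
  obtains v and b :: nat where "v \<in> carrier G" "v \<noteq> \<one>" "\<gamma> v = v [^] b"
proof -
  obtain u :: nat where cop: "coprime p u" and u1: "[u ^ (p - 1) = 1] (mod p)"
    and usum: "\<And>k. 0 < k \<Longrightarrow> k < p - 1 \<Longrightarrow> [(\<Sum>j<p - 1. u ^ (j * k)) = 0] (mod p)"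
    using ex_primroot_power_sum[OF p] by metis
  define q where "q = p - 1"
  \<comment> \<open>Since \<open>q\<close> is positive, the range \<open>{..<q}\<close> equals
    \<open>{..n}\<close>, where a first or a last factor can be split off.\<close>
  obtain n where n: "q = Suc n"
    using prime_gt_1_nat[OF p] by (cases q) (auto simp: q_def)
  define F where "F j k = (\<gamma> ^^ k) r [^] (u ^ (j * k))" for j k
  define w where "w j = finprod G (F j) {..<q}" for j
  have gc: "(\<gamma> ^^ k) r \<in> carrier G" for k
    using r hom_in_carrier[OF \<gamma>] by (induction k) auto
  have Fc: "F j k \<in> carrier G" for j k
    using gc by (simp add: F_def)
  have wc: "w j \<in> carrier G" for j
    unfolding w_def using Fc by (intro finprod_closed) auto
  have \<gamma>h: "group_hom G G \<gamma>"
    using \<gamma> by (simp add: group_hom_def group_hom_axioms_def is_group)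
  have \<gamma>1: "\<gamma> \<one> = \<one>" using group_hom.hom_one[OF \<gamma>h] .
  have \<gamma>pow: "\<gamma> (x [^] (m::nat)) = \<gamma> x [^] m" if "x \<in> carrier G" for x m
    using group_hom.hom_nat_pow[OF \<gamma>h that] .
  have shift: "\<gamma> (w j) [^] (u ^ j) = w j" for j
  proof -
    have "\<gamma> (w j) = finprod G (\<lambda>k. \<gamma> (F j k)) {..<q}"
      unfolding w_def using Fc by (intro finprod_hom[OF _ _ \<gamma> \<gamma>1]) (auto simp: comm_monoid_axioms)
    then have "\<gamma> (w j) [^] (u ^ j) = finprod G (\<lambda>k. \<gamma> (F j k) [^] (u ^ j)) {..<q}"
      using finprod_pow[of "\<lambda>k. \<gamma> (F j k)" "{..<q}"] hom_in_carrier[OF \<gamma> Fc] by simp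
    also have "\<dots> = finprod G (\<lambda>k. F j (Suc k)) {..<q}"
    proof (intro finprod_cong' refl)
      show "\<gamma> (F j k) [^] (u ^ j) = F j (Suc k)" for k
        using gc[of k] hom_in_carrier[OF \<gamma> gc[of k]]
        by (simp add: F_def \<gamma>pow nat_pow_pow power_add[symmetric] add.commute)
    qed (use Fc in auto)
    finally have 1: "\<gamma> (w j) [^] (u ^ j) = finprod G (\<lambda>k. F j (Suc k)) {..n}"
      using n by (simp add: lessThan_Suc_atMost)
    have "[u ^ (j * q) = 1] (mod p)"
    proof -
      have "[(u ^ q) ^ j = 1 ^ j] (mod p)"
        using u1 by (intro cong_pow) (simp add: q_def)
      then show ?thesis by (simp add: power_mult[symmetric] mult.commute)
    qed
    \<comment> \<open>\<open>\<gamma>\<close> iterated \<open>q\<close> times fixes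
      \<open>r\<close>, and \<open>u ^ (j * q)\<close> is 1 modulo \<open>p\<close>. Shifting
      \<open>k\<close> by one therefore only permutes the factors of \<open>w j\<close>
      cyclically.\<close>
    then have "F j q = F j 0"
      using \<gamma>_order[OF r(1)] pow_cong[OF r(1) exponent[OF r(1)]] r(1)
      by (simp add: F_def q_def)
    then have "finprod G (\<lambda>k. F j (Suc k)) {..n} \<otimes> F j 0 = F j 0 \<otimes> w j"
      using finprod_Suc2[of "F j" n] finprod_Suc[of "F j" n] Fc n
      by (simp add: w_def lessThan_Suc_atMost)
    then have "finprod G (\<lambda>k. F j (Suc k)) {..n} = w j"
      using Fc wc m_comm by (metis (no_types, lifting) Fc Pi_I finprod_closed right_cancel)
    then show ?thesis using 1 by simp
  qed
  have "finprod G w {..<q} = finprod G (\<lambda>j. finprod G (F j) {..<q}) {..<q}"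
    by (simp add: w_def[abs_def])
  also have "\<dots> = finprod G (\<lambda>k. finprod G (\<lambda>j. F j k) {..<q}) {..<q}"
    using Fc by (intro finprod_swap) auto
  \<comment> \<open>For fixed \<open>k\<close> the exponents add up to the power sum of
    \<open>u\<close>, which is 0 modulo \<open>p\<close> unless \<open>k = 0\<close>, where it is
    \<open>q\<close>.\<close>
  also have "\<dots> = finprod G (\<lambda>k. if 0 = k then r [^] q else \<one>) {..<q}"
  proof (intro finprod_cong' refl)
    fix k assume "k \<in> {..<q}"
    have "finprod G (\<lambda>j. F j k) {..<q} = (\<gamma> ^^ k) r [^] (\<Sum>j<q. u ^ (j * k))"
      unfolding F_def using gc by (intro finprod_pow_sum) auto
    also have "\<dots> = (if 0 = k then r [^] q else \<one>)"
    proof (cases "k = 0")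
      case False
      then have "[(\<Sum>j<q. u ^ (j * k)) = 0] (mod p)"
        using usum[of k] \<open>k \<in> {..<q}\<close> by (simp add: q_def)
      then show ?thesis
        using False pow_cong[OF gc exponent[OF gc]] by (metis nat_pow_0)
    qed simp
    finally show "finprod G (\<lambda>j. F j k) {..<q} = (if 0 = k then r [^] q else \<one>)" .
  qed (use r in auto)
  also have "\<dots> = r [^] q"
    using finprod_singleton[of 0 "{..<q}" "\<lambda>_. r [^] q"] n r by auto
  finally have prod: "finprod G w {..<q} = r [^] q" .
  have "r [^] q \<noteq> \<one>"
  proof
    assume "r [^] q = \<one>"
    then have "r [^] Suc q = r" using r by simp
    moreover have "Suc q = p" using prime_gt_1_nat[OF p] by (simp add: q_def)
    ultimately show False using exponent[OF r(1)] r by simp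
  qed
  then obtain j where j: "w j \<noteq> \<one>"
    using prod finprod_one_eqI[of "{..<q}" w] by auto
  \<comment> \<open>Inverting \<open>u ^ j\<close> modulo \<open>p\<close> solves the relation
    \<open>shift\<close> for \<open>\<gamma> (w j)\<close>; the inverse \<open>m\<close> is the
    eigenvalue.\<close>
  have "coprime (u ^ j) p" using cop by (simp add: coprime_commute)
  then obtain m where m: "[u ^ j * m = Suc 0] (mod p)"
    using cong_solve_coprime_nat by blast
  have \<gamma>w: "\<gamma> (w j) \<in> carrier G" using hom_in_carrier[OF \<gamma> wc] .
  have "\<gamma> (w j) = \<gamma> (w j) [^] (u ^ j * m)"
    using pow_cong[OF \<gamma>w exponent[OF \<gamma>w] m] \<gamma>w by simp
  also have "\<dots> = w j [^] m"
    using shift \<gamma>w by (simp add: nat_pow_pow[symmetric])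
  finally show thesis using that[OF wc j] by simp
qed

context finite_group
begin

text \<open>The average over \<open>P\<close>-cosets of the conjugates of a projection \<open>P \<rightarrow> R\<close> along \<open>M\<close> is a
  \<open>G\<close>-equivariant homomorphism \<open>Y \<rightarrow> R\<close>; on \<open>R\<close> it is the power map with exponent \<open>|G : P|\<close>.\<close>

lemma normal_complement_by_averaging:
  assumes p: "prime p" and P: "p_sylow p P G" and R: "R \<lhd> G" "card R = p"
    and central: "\<And>g r. g \<in> P \<Longrightarrow> r \<in> R \<Longrightarrow> conjugate g r = r"
    and M: "maximal_subgroup M (G\<lparr>carrier := P\<rparr>)" "\<not> R \<subseteq> M"
    and Y: "Y \<lhd> G" "Y \<subseteq> P" "R \<subseteq> Y"
  obtains Y' where "Y' \<lhd> G" "Y' \<subseteq> Y" "R \<inter> Y' = {\<one>}" "R <#> Y' = Y"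
proof -
  let ?R = "G\<lparr>carrier := R\<rparr>"
  note Ps = p_sylowD(1)[OF P] and Rs = normal_subgroup[OF R(1)] and Ys = normal_subgroup[OF Y(1)]
  note Pc = subgroup.mem_carrier[OF Ps] and Rc = subgroup.mem_carrier[OF Rs]
    and Yc = subgroup.mem_carrier[OF Ys]
  have RP: "R \<subseteq> P" using Y by auto
  interpret P: finite_group "G\<lparr>carrier := P\<rparr>"
    by (rule subgroup_finite_group[OF Ps])
  obtain k where k: "card P = p ^ k" using p_sylowD(3)[OF P] by blast
  have MP: "M \<lhd> G\<lparr>carrier := P\<rparr>" "card M * p = card P"
    using P.p_group_maximal_subgroup[OF p _ M(1)] k by (auto simp: order_def)
  have Ms: "subgroup M G" and MsP: "M \<subseteq> P"
    using incl_subgroup[OF Ps] M(1) subgroup.subset[of M "G\<lparr>carrier := P\<rparr>"]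
    by (auto simp: maximal_subgroup_def)
  note Mc = subgroup.mem_carrier[OF Ms]
  have conjM: "conjugate g m \<in> M" if "g \<in> P" "m \<in> M" for g m
    using P.normal_conjugate[OF MP(1)] that Ps
    by (simp add: P.conjugate_def conjugate_def m_inv_consistent)
  have RM: "R \<inter> M = {\<one>}"
  proof -
    have I: "subgroup (R \<inter> M) G" using subgroup_Int Rs Ms by blast
    have "card (R \<inter> M) dvd p" using card_subgroup_dvd[OF I Rs] R(2) by auto
    then have "card (R \<inter> M) = 1 \<or> card (R \<inter> M) = p"
      using p by (auto simp: prime_nat_iff)
    moreover have "card (R \<inter> M) \<noteq> p"
    proof
      assume "card (R \<inter> M) = p"
      then have "R \<inter> M = R" using R(2) finite_subgroup[OF Rs] by (metis card_subset_eq inf_le1)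
      then show False using M(2) by auto
    qed
    ultimately show ?thesis
      using subgroup.one_closed[OF I] by (metis card_1_singletonE singletonD)
  qed
  have RMP: "R <#> M = P"
  proof -
    have "card (R <#> M) = card P"
      using card_set_mult[OF Rs Ms] RM R(2) MP(2) by (simp add: mult.commute)
    then show ?thesis
      using set_mult_least[OF Ps RP MsP] finite_subgroup[OF Ps] by (metis card_subset_eq)
  qed
  have comm: "x \<otimes> y = y \<otimes> x" if "x \<in> R" "y \<in> P" for x y
    using central[OF that(2,1)] conjugate_fixed_iff[of y x] that Rc Pc by simp
  have cm: "comm_group ?R"
    using comm RP by (intro comm_subgroup[OF Rs]) auto
  interpret R: comm_group ?R by (rule cm)
  \<comment> \<open>The projection of \<open>P = R M\<close> onto \<open>R\<close> along
    \<open>M\<close>. As \<open>R\<close> is central in \<open>P\<close> and \<open>M\<close> is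
    normalized by \<open>P\<close>, it is a homomorphism that is unchanged by conjugation with
    elements of \<open>P\<close>.\<close>
  define pr where "pr x = (THE r. r \<in> R \<and> inv r \<otimes> x \<in> M)" for x
  have pr_eq: "pr x = r" if "r \<in> R" "inv r \<otimes> x \<in> M" "x \<in> P" for x r
    unfolding pr_def
  proof (rule the_equality)
    fix s assume s: "s \<in> R \<and> inv s \<otimes> x \<in> M"
    have c: "r \<in> carrier G" "s \<in> carrier G" "x \<in> carrier G" using s that Rc Pc by auto
    have "inv r \<otimes> x \<otimes> inv (inv s \<otimes> x) \<in> M"
      using s that subgroup.m_closed[OF Ms] subgroup.m_inv_closed[OF Ms] by blast
    then have "inv r \<otimes> s \<in> M" using c by (simp add: inv_mult_group m_assoc)
    moreover have "inv r \<otimes> s \<in> R"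
      using s that subgroup.m_closed[OF Rs] subgroup.m_inv_closed[OF Rs] by blast
    ultimately have "inv r \<otimes> s = \<one>" using RM by blast
    then show "s = r" using c by (metis inv_equality inv_inv inv_closed)
  qed (use that in simp)
  have pr: "pr x \<in> R" "inv (pr x) \<otimes> x \<in> M" if x: "x \<in> P" for x
  proof -
    obtain r m where "r \<in> R" "m \<in> M" "x = r \<otimes> m"
      using x RMP mem_set_mult by blast
    then have "r \<in> R" "inv r \<otimes> x \<in> M" using Rc Mc by simp_all
    then show "pr x \<in> R" "inv (pr x) \<otimes> x \<in> M" using pr_eq x by auto
  qed
  have pr_mult: "pr (x \<otimes> y) = pr x \<otimes> pr y" if x: "x \<in> P" and y: "y \<in> P" for x y
  proof (rule pr_eq)
    have c: "pr x \<in> carrier G" "pr y \<in> carrier G" "x \<in> carrier G" "y \<in> carrier G"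
      using pr x y Rc Pc by auto
    have px: "inv (pr x) \<otimes> x \<in> P" using pr(2)[OF x] MsP by auto
    have ipy: "inv (pr y) \<in> R" using pr(1)[OF y] subgroup.m_inv_closed[OF Rs] by blast
    have "inv (pr x \<otimes> pr y) \<otimes> (x \<otimes> y) = inv (pr y) \<otimes> (inv (pr x) \<otimes> x) \<otimes> y"
      using c by (simp add: inv_mult_group m_assoc)
    also have "\<dots> = (inv (pr x) \<otimes> x) \<otimes> inv (pr y) \<otimes> y"
      using comm[OF ipy px] by simp
    also have "\<dots> = (inv (pr x) \<otimes> x) \<otimes> (inv (pr y) \<otimes> y)"
      using c by (simp add: m_assoc)
    finally show "inv (pr x \<otimes> pr y) \<otimes> (x \<otimes> y) \<in> M"
      using pr(2) x y subgroup.m_closed[OF Ms] by simp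
  qed (use pr x y subgroup.m_closed[OF Rs] subgroup.m_closed[OF Ps] in auto)
  have pr_R: "pr r = r" if r: "r \<in> R" for r
    using pr_eq[OF r, of r] r RP Rc subgroup.one_closed[OF Ms] by auto
  have pr_conj: "pr (conjugate g x) = pr x" if g: "g \<in> P" and x: "x \<in> P" for g x
  proof (rule pr_eq[OF pr(1)[OF x]])
    have c: "pr x \<in> carrier G" "x \<in> carrier G" "g \<in> carrier G" using pr x g Rc Pc by auto
    have ip: "inv (pr x) \<in> R" using pr(1)[OF x] subgroup.m_inv_closed[OF Rs] by blast
    have "conjugate g (inv (pr x) \<otimes> x) = inv (pr x) \<otimes> conjugate g x"
      using c conjugate_mult[of g "inv (pr x)" x] central[OF g ip] by simp
    then show "inv (pr x) \<otimes> conjugate g x \<in> M"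
      using conjM[OF g pr(2)[OF x]] by simp
    show "conjugate g x \<in> P" using conjugate_subgroup[OF Ps g x] .
  qed
  \<comment> \<open>The projection transported by \<open>x\<close>. By its invariance under
    \<open>P\<close> it depends only on the coset \<open>P x\<close>, so the product over the cosets
    does not depend on the representatives.\<close>
  define T where "T x w = conjugate (inv x) (pr (conjugate x w))" for x w
  have conjY: "conjugate x w \<in> Y" "conjugate x w \<in> P" if "x \<in> carrier G" "w \<in> Y" for x w
    using normal_conjugate[OF Y(1) that] Y(2) by auto
  have TR: "T x w \<in> R" if "x \<in> carrier G" "w \<in> Y" for x w
    unfolding T_def using that conjY pr normal_conjugate[OF R(1)] by simp
  have T_coset: "T (g \<otimes> x) w = T x w" if g: "g \<in> P" and x: "x \<in> carrier G" and w: "w \<in> Y" for g x w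
  proof -
    note xw = conjY(2)[OF x w]
    have gc: "g \<in> carrier G" using Pc g by simp
    have ig: "inv g \<in> P" using subgroup.m_inv_closed[OF Ps g] .
    have "pr (conjugate (g \<otimes> x) w) = pr (conjugate x w)"
      using pr_conj[OF g xw] gc x w Yc by (simp add: conjugate_conjugate)
    then have "T (g \<otimes> x) w = conjugate (inv x) (conjugate (inv g) (pr (conjugate x w)))"
      using gc x pr(1)[OF xw] Rc by (simp add: T_def inv_mult_group conjugate_conjugate)
    then show ?thesis
      using central[OF ig pr(1)[OF xw]] by (simp add: T_def)
  qed
  define C where "C = (\<lambda>x. P #> x) ` carrier G"
  define t where "t c = (SOME x. x \<in> carrier G \<and> c = P #> x)" for c
  have t: "t c \<in> carrier G" "P #> t c = c" if "c \<in> C" for c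
  proof -
    have "\<exists>x. x \<in> carrier G \<and> c = P #> x" using that by (auto simp: C_def)
    then have "t c \<in> carrier G \<and> c = P #> t c" unfolding t_def by (rule someI_ex)
    then show "t c \<in> carrier G" "P #> t c = c" by auto
  qed
  have T_eq: "T x w = T y w" if "P #> x = P #> y" "x \<in> carrier G" "y \<in> carrier G" "w \<in> Y" for x y w
  proof -
    have "x \<otimes> inv y \<in> P" using r_coset_eq_iff[OF Ps that(2,3)] that(1) by simp
    then have "T (x \<otimes> inv y \<otimes> y) w = T y w" using T_coset that by simp
    then show ?thesis using that by (simp add: m_assoc)
  qed
  define \<Lambda> where "\<Lambda> w = finprod ?R (\<lambda>c. T (t c) w) C" for w
  have Tf: "(\<lambda>c. T (t c) w) \<in> C \<rightarrow> R" if "w \<in> Y" for w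
    using TR t that by auto
  have \<Lambda>R: "\<Lambda> w \<in> R" if "w \<in> Y" for w
    using R.finprod_closed[of "\<lambda>c. T (t c) w" C] Tf[OF that] by (simp add: \<Lambda>_def)
  have \<Lambda>_mult: "\<Lambda> (v \<otimes> w) = \<Lambda> v \<otimes> \<Lambda> w" if v: "v \<in> Y" and w: "w \<in> Y" for v w
  proof -
    have "T x (v \<otimes> w) = T x v \<otimes> T x w" if x: "x \<in> carrier G" for x
      using x v w Yc conjY pr(1) Rc by (simp add: T_def conjugate_mult pr_mult)
    then have "\<Lambda> (v \<otimes> w) = finprod ?R
        (\<lambda>c. T (t c) v \<otimes>\<^bsub>?R\<^esub> T (t c) w) C"
      unfolding \<Lambda>_def using Tf[OF v] Tf[OF w] t(1) subgroup.m_closed[OF Rs]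
      by (intro R.finprod_cong') (auto simp: Pi_iff)
    also have "\<dots> = \<Lambda> v \<otimes> \<Lambda> w"
      using R.finprod_multf[of "\<lambda>c. T (t c) v" C "\<lambda>c. T (t c) w"] Tf[OF v] Tf[OF w]
      by (simp add: \<Lambda>_def)
    finally show ?thesis .
  qed
  have \<Lambda>_conj: "\<Lambda> (conjugate g w) = conjugate g (\<Lambda> w)" if g: "g \<in> carrier G" and w: "w \<in> Y" for g w
  proof -
    \<comment> \<open>Conjugating the argument by \<open>g\<close> turns the factor at
      \<open>c\<close> into the conjugate of the factor at \<open>\<sigma> g c\<close>, so
      equivariance is a reindexing by right translation.\<close>
    define \<sigma> where "\<sigma> h c = P #> (t c \<otimes> h)" for h c
    have \<sigma>_coset: "\<sigma> h (P #> x) = P #> (x \<otimes> h)" if "x \<in> carrier G" "h \<in> carrier G" for h x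
    proof -
      have "t (P #> x) \<otimes> inv x \<in> P"
        using t[of "P #> x"] that r_coset_eq_iff[OF Ps] by (auto simp: C_def)
      then have "(t (P #> x) \<otimes> h) \<otimes> inv (x \<otimes> h) \<in> P"
        using t(1)[of "P #> x"] that by (simp add: C_def inv_mult_group m_assoc)
      then show ?thesis
        using r_coset_eq_iff[OF Ps, of "t (P #> x) \<otimes> h" "x \<otimes> h"] t(1)[of "P #> x"] that
        by (simp add: C_def \<sigma>_def)
    qed
    have \<sigma>: "bij_betw (\<sigma> g) C C"
      using g by (intro bij_betw_byWitness[where f' = "\<sigma> (inv g)"])
        (auto simp: C_def \<sigma>_coset m_assoc)
    then have \<sigma>C: "\<sigma> g c \<in> C" if "c \<in> C" for c using that by (auto simp: bij_betw_def)
    have gw: "conjugate g w \<in> Y" using conjY(1)[OF g w] .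
    have "T (t c) (conjugate g w) = conjugate g (T (t (\<sigma> g c)) w)" if c: "c \<in> C" for c
    proof -
      note tc = t(1)[OF c]
      have "T (t (\<sigma> g c)) w = T (t c \<otimes> g) w"
        using T_eq[of "t (\<sigma> g c)" "t c \<otimes> g" w] t[OF \<sigma>C[OF c]] tc g w by (simp add: \<sigma>_def)
      moreover have "conjugate g (T (t c \<otimes> g) w) = T (t c) (conjugate g w)"
        using tc g w Yc conjY(2)[of "t c \<otimes> g" w] pr(1) Rc
        by (simp add: T_def inv_mult_group conjugate_conjugate m_assoc[symmetric])
      ultimately show ?thesis by simp
    qed
    then have "\<Lambda> (conjugate g w) = finprod ?R (\<lambda>c. conjugate g (T (t (\<sigma> g c)) w)) C"
      unfolding \<Lambda>_def using TR t(1) \<sigma>C w g normal_conjugate[OF R(1) g]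
      by (intro R.finprod_cong') auto
    also have "\<dots> = finprod ?R (\<lambda>c. conjugate g (T (t c) w)) C"
    proof -
      have "(\<lambda>c. conjugate g (T (t c) w)) \<in> C \<rightarrow> R"
        using Tf[OF w] normal_conjugate[OF R(1) g] by auto
      then show ?thesis
        using R.finprod_reindex[of "\<lambda>c. conjugate g (T (t c) w)" "\<sigma> g" C] \<sigma>
        by (simp add: bij_betw_def)
    qed
    also have "\<dots> = conjugate g (\<Lambda> w)"
      unfolding \<Lambda>_def using conjugate_prod[OF R(1) cm g Tf[OF w]] by simp
    finally show ?thesis .
  qed
  define n where "n = card C"
  have n: "n * card P = order G"
  proof -
    have "C = rcosets P" by (auto simp: C_def RCOSETS_def)
    then show ?thesis using lagrange[OF Ps] by (simp add: n_def)
  qed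
  have \<Lambda>_pow: "\<Lambda> r = r [^] n" if r: "r \<in> R" for r
  proof -
    have rY: "r \<in> Y" using r Y(3) by auto
    have "T x r = r" if x: "x \<in> carrier G" for x
      using x r Rc normal_conjugate[OF R(1) x r] by (simp add: T_def pr_R)
    then have "\<Lambda> r = finprod ?R (\<lambda>_. r) C"
      unfolding \<Lambda>_def using r t(1) by (intro R.finprod_cong') auto
    then show ?thesis
      using R.finprod_const[of r C] r nat_pow_consistent[of r n R, symmetric] by (simp add: n_def)
  qed
  have "n = order G div card P"
    using n card_subgroup_pos[OF Ps] by (metis div_mult_self_is_m)
  then have copn: "coprime n (card R)"
    using p_sylowD(2)[OF P] p R(2) by (metis coprime_commute prime_imp_coprime)
  define Y' where "Y' = {w \<in> Y. \<Lambda> w = \<one>}"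
  have commR: "x \<otimes> y = y \<otimes> x" if "x \<in> R" "y \<in> R" for x y
    using comm that RP by blast
  \<comment> \<open>\<open>Y\<close> lies in \<open>P\<close> and so centralizes \<open>R\<close>:
    the homomorphism is also a crossed one.\<close>
  have \<Lambda>_crossed: "\<Lambda> (v \<otimes> w) = conjugate v (\<Lambda> w) \<otimes> \<Lambda> v" if "v \<in> Y" "w \<in> Y" for v w
    using \<Lambda>_mult[OF that] central[OF _ \<Lambda>R[OF that(2)], of v] commR[OF \<Lambda>R \<Lambda>R] that Y(2) by auto
  note ker = crossed_hom_kernel[OF Rs Ys Y(3) commR \<Lambda>R \<Lambda>_crossed \<Lambda>_pow copn, folded Y'_def]
  have "conjugate g w \<in> Y'" if "g \<in> carrier G" "w \<in> Y'" for g w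
    using that \<Lambda>_conj conjY by (simp add: Y'_def)
  then have Y'n: "Y' \<lhd> G" using ker(1) by (simp add: normal_iff_conjugate)
  show thesis by (rule that[OF Y'n _ ker(2,3)]) (auto simp: Y'_def)
qed

end

subsection \<open>The case without Frattini part\<close>

definition (in group) centralizer :: "'a set \<Rightarrow> 'a set" where
  "centralizer X = {g \<in> carrier G. \<forall>x\<in>X. conjugate g x = x}"

lemma (in group) centralizer_normal:
  assumes X: "X \<lhd> G"
  shows "centralizer X \<lhd> G"
proof -
  note Xc = subgroup.mem_carrier[OF normal_subgroup[OF X]]
  have "subgroup (centralizer X) G"
  proof (rule subgroupI)
    show "centralizer X \<noteq> {}" using Xc by (auto simp: centralizer_def intro!: exI[of _ \<one>])
    fix a assume a: "a \<in> centralizer X"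
    then have "conjugate (inv a) x = x" if "x \<in> X" for x
      using that Xc conjugate_inverse(2)[of a x] by (simp add: centralizer_def)
    then show "inv a \<in> centralizer X"
      using a by (simp add: centralizer_def)
    fix b assume "b \<in> centralizer X"
    then show "a \<otimes> b \<in> centralizer X"
      using a Xc by (auto simp: centralizer_def conjugate_conjugate[symmetric])
  qed (auto simp: centralizer_def)
  moreover have "conjugate g x \<in> centralizer X" if g: "g \<in> carrier G" and x: "x \<in> centralizer X" for g x
  proof -
    have xc: "x \<in> carrier G" using x by (simp add: centralizer_def)
    have "conjugate (conjugate g x) w = w" if w: "w \<in> X" for w
    proof -
      have "conjugate (conjugate g x) w = conjugate g (conjugate x (conjugate (inv g) w))"
        using g xc w Xc by (simp add: conjugate_conjugate) (simp add: conjugate_def m_assoc)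
      also have "\<dots> = w"
        using x g w Xc normal_conjugate[OF X, of "inv g" w] by (simp add: centralizer_def)
      finally show ?thesis .
    qed
    then show ?thesis using g xc by (simp add: centralizer_def)
  qed
  ultimately show ?thesis by (simp add: normal_iff_conjugate)
qed

text \<open>Commuting is symmetric. In this form \<open>R \<inter> centralizer E\<close> is the set
  of points of \<open>R\<close> fixed by \<open>E\<close>.\<close>

lemma (in group) mem_centralizer_iff:
  "X \<subseteq> carrier G \<Longrightarrow> g \<in> centralizer X \<longleftrightarrow> g \<in> carrier G \<and> (\<forall>x\<in>X. conjugate x g = g)"
  unfolding centralizer_def using conjugate_fixed_iff by (auto simp: subset_iff)

context finite_group
begin

lemma powers_subgroup:
  assumes "x \<in> carrier G"
  shows "subgroup (range (\<lambda>k::nat. x [^] k)) G"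
proof (rule subgroupI)
  fix a assume "a \<in> range (\<lambda>k::nat. x [^] k)"
  then obtain k :: nat where k: "a = x [^] k" by blast
  have "order G > 0" using finite_carrier order_gt_0_iff_finite by simp
  then have "x [^] (k * (order G - 1)) \<otimes> x [^] k = x [^] (order G * k)"
    using assms by (simp add: nat_pow_mult diff_mult_distrib2 mult.commute)
  also have "\<dots> = \<one>"
    using assms pow_order_eq_1[OF assms] by (simp add: nat_pow_pow[symmetric])
  finally have "inv a = x [^] (k * (order G - 1))"
    using assms k inv_equality by simp
  then show "inv a \<in> range (\<lambda>k::nat. x [^] k)" by blast
  fix b assume "b \<in> range (\<lambda>k::nat. x [^] k)"
  then obtain l :: nat where "b = x [^] l" by blast
  then have "a \<otimes> b = x [^] (k + l)" using k assms by (simp add: nat_pow_mult)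
  then show "a \<otimes> b \<in> range (\<lambda>k::nat. x [^] k)" by blast
qed (use assms in auto)

lemma prime_order_subgroup_eq:
  assumes p: "prime p" and X: "subgroup X G" "card X = p"
    and S: "subgroup S G" "S \<subseteq> X" "s \<in> S" "s \<noteq> \<one>"
  shows "S = X"
proof -
  have "card S dvd p" using card_subgroup_dvd[OF S(1) X(1) S(2)] X(2) by simp
  moreover have "card S \<noteq> 1"
    using S subgroup.one_closed[OF S(1)] by (metis card_1_singletonE singletonD)
  ultimately have "card S = card X" using p X(2) by (auto simp: prime_nat_iff)
  then show ?thesis using S(2) finite_subgroup[OF X(1)] by (metis card_subset_eq)
qed

lemma prime_order_generator:
  assumes "prime p" "subgroup X G" "card X = p" "z \<in> X" "z \<noteq> \<one>"
  shows "range (\<lambda>k::nat. z [^] k) = X"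
proof (rule prime_order_subgroup_eq[OF assms(1-3) _ powers_subset[OF assms(2,4)] _ assms(5)])
  have z: "z \<in> carrier G" by (rule subgroup.mem_carrier[OF assms(2,4)])
  show "subgroup (range (\<lambda>k::nat. z [^] k)) G" by (rule powers_subgroup[OF z])
  show "z \<in> range (\<lambda>k::nat. z [^] k)" by (rule range_eqI[of _ _ 1]) (simp add: z)
qed

text \<open>The exponent is read off at a generator, and it is prime to \<open>p\<close> because
  conjugation is injective. Power maps commute, and by Fermat their iterates of order
  \<open>p - 1\<close> are trivial; the next two lemmas record this.\<close>

lemma conjugate_prime_order:
  assumes p: "prime p" and X: "X \<lhd> G" "card X = p" and g: "g \<in> carrier G"
  obtains a :: nat where "\<And>x. x \<in> X \<Longrightarrow> conjugate g x = x [^] a" "coprime a p"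
proof -
  note Xs = normal_subgroup[OF X(1)] and Xc = subgroup.mem_carrier[OF normal_subgroup[OF X(1)]]
  have "X \<noteq> {\<one>}" using X(2) p by auto
  then obtain z where z: "z \<in> X" "z \<noteq> \<one>" using subgroup.one_closed[OF Xs] by blast
  have gen: "range (\<lambda>k::nat. z [^] k) = X"
    by (rule prime_order_generator[OF p Xs X(2) z])
  have "conjugate g z \<in> X" using normal_conjugate[OF X(1) g z(1)] .
  then obtain a :: nat where a: "conjugate g z = z [^] a" using gen by auto
  have "conjugate g x = x [^] a" if x: "x \<in> X" for x
  proof -
    obtain k :: nat where "x = z [^] k" using x gen by auto
    then show ?thesis
      using g a Xc[OF z(1)] by (simp add: conjugate_pow nat_pow_pow mult.commute)
  qed
  moreover have "coprime a p"
  proof (rule ccontr)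
    assume "\<not> coprime a p"
    then have "p dvd a" using p prime_imp_coprime coprime_commute by blast
    then obtain c where "a = p * c" by (auto elim: dvdE)
    then have "conjugate g z = \<one>"
      using a pow_card_subgroup[OF Xs z(1)] X(2) Xc[OF z(1)] by (simp add: nat_pow_pow[symmetric])
    then have "conjugate g z = conjugate g \<one>" using g by simp
    then show False using z g Xc conjugate_eq_iff by blast
  qed
  ultimately show thesis by (rule that)
qed

lemma commutator_centralizes_prime_order:
  assumes p: "prime p" and X: "X \<lhd> G" "card X = p"
    and g: "g \<in> carrier G" and h: "h \<in> carrier G" and x: "x \<in> X"
  shows "conjugate (g \<otimes> h) x = conjugate (h \<otimes> g) x"
proof -
  have xc: "x \<in> carrier G" using x subgroup.mem_carrier normal_subgroup[OF X(1)] by metis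
  obtain a b :: nat where "\<And>x. x \<in> X \<Longrightarrow> conjugate g x = x [^] a" "\<And>x. x \<in> X \<Longrightarrow> conjugate h x = x [^] b"
    using conjugate_prime_order[OF p X g] conjugate_prime_order[OF p X h] by metis
  then show ?thesis
    using g h x xc by (simp add: conjugate_conjugate[symmetric] conjugate_pow nat_pow_pow mult.commute)
qed

lemma power_centralizes_prime_order:
  assumes p: "prime p" and X: "X \<lhd> G" "card X = p"
    and g: "g \<in> carrier G" and x: "x \<in> X"
  shows "conjugate (g [^] (p - 1)) x = x"
proof -
  note Xs = normal_subgroup[OF X(1)]
  have xc: "x \<in> carrier G" using x subgroup.mem_carrier[OF Xs] by blast
  obtain a :: nat where a: "\<And>x. x \<in> X \<Longrightarrow> conjugate g x = x [^] a" "coprime a p"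
    using conjugate_prime_order[OF p X g] by metis
  have "conjugate (g [^] k) x = x [^] (a ^ k)" for k :: nat
  proof (induction k)
    case (Suc k)
    have "conjugate (g [^] Suc k) x = conjugate (g [^] k) (conjugate g x)"
      using g xc by (simp add: conjugate_conjugate)
    also have "\<dots> = conjugate (g [^] k) x [^] a"
      using a(1)[OF x] g xc by (simp add: conjugate_pow)
    finally show ?case using Suc xc by (simp add: nat_pow_pow mult.commute)
  qed (use xc in simp)
  moreover have "\<not> p dvd a"
    using coprime_common_divisor[OF a(2), of p] p by auto
  then have "[a ^ (p - 1) = 1] (mod p)"
    by (rule fermat_theorem[OF p])
  ultimately show ?thesis
    using pow_cong[OF xc _, of p "a ^ (p - 1)" 1] pow_card_subgroup[OF Xs x] X(2) xc by simp
qed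

lemma chief_factor_trivial_eq:
  assumes "chief_factor G R {\<one>}" "F \<lhd> G" "F \<subseteq> R" "z \<in> F" "z \<noteq> \<one>"
  shows "F = R"
  using chief_factorD(4)[OF assms(1,2)] assms(3-5) subgroup.one_closed[OF normal_subgroup[OF assms(2)]]
  by blast

text \<open>\<open>O\<^sub>p(N)\<close> is central in \<open>P\<close> and contains its centralizer in \<open>N\<close>, hence it is a Sylow subgroup of \<open>N\<close>.\<close>

lemma supersoluble_below_if_minimal_normal_supplemented:
  assumes p: "prime p" and P: "p_sylow p P G" and N: "N \<lhd> G"
    and no_p': "\<And>E. E \<lhd> G \<Longrightarrow> E \<subseteq> N \<Longrightarrow> \<not> p dvd card E \<Longrightarrow> E = {\<one>}"
    and sol: "\<And>L K. chief_factor G L K \<Longrightarrow> L \<subseteq> N \<Longrightarrow>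
      (\<exists>n. card L div card K = p ^ n) \<or> \<not> p dvd card L div card K"
    and minimal: "\<And>R. chief_factor G R {\<one>} \<Longrightarrow> R \<subseteq> N \<Longrightarrow> p dvd card R \<Longrightarrow>
      card R = p \<and> (\<exists>M. maximal_subgroup M (G\<lparr>carrier := P\<rparr>) \<and> \<not> R \<subseteq> M)"
  shows "supersoluble_between G p {\<one>} N"
proof -
  note Ps = p_sylowD(1)[OF P] and Ns = normal_subgroup[OF N]
  obtain k where k: "card P = p ^ k" using p_sylowD(3)[OF P] by blast
  \<comment> \<open>Normal p-subgroups of \<open>G\<close> inside \<open>N\<close> are closed under
    products, so a maximal one contains all of them and is \<open>O\<^sub>p(N)\<close>.\<close>
  let ?Q = "\<lambda>W. W \<lhd> G \<and> W \<subseteq> N \<and> (\<exists>n. card W = p ^ n)"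
  have Q0: "?Q {\<one>}"
    using one_is_normal subgroup.one_closed[OF Ns] by (auto intro: exI[of _ 0])
  have Q_carrier: "X \<subseteq> carrier G" if "?Q X" for X
    using that subgroup.subset[OF Ns] by blast
  obtain W where W: "?Q W" "\<And>X. ?Q X \<Longrightarrow> W \<subseteq> X \<Longrightarrow> X = W"
    using ex_maximal_set[of ?Q, OF Q0 Q_carrier] by blast
  have Wn: "W \<lhd> G" and WN: "W \<subseteq> N" using W(1) by auto
  note Ws = normal_subgroup[OF Wn]
  obtain w where w: "card W = p ^ w" using W(1) by blast
  have Wmax: "L \<subseteq> W" if L: "L \<lhd> G" "L \<subseteq> N" "card L = p ^ n" for L n
  proof -
    note Ls = normal_subgroup[OF L(1)]
    have "card (L <#> W) * card (L \<inter> W) = p ^ (n + w)"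
      using card_set_mult[OF Ls Ws] L(3) w by (simp add: power_add)
    then have "\<exists>m. card (L <#> W) = p ^ m"
      using divides_primepow_nat[OF p] by (metis dvd_triv_left)
    then have "?Q (L <#> W)"
      using normal_set_mult[OF L(1) Wn] set_mult_least[OF Ns L(2) WN] by simp
    moreover have "W \<subseteq> L <#> W" using subset_set_mult_right[OF Ls subgroup.subset[OF Ws]] .
    ultimately have "L <#> W = W" by (rule W(2))
    then show ?thesis using subset_set_mult_left[OF subgroup.subset[OF Ls] Ws] by simp
  qed
  have WP: "W \<subseteq> P" by (rule p_sylow_contains[OF p P Wn w])
  define C where "C = N \<inter> centralizer W"
  have Cn: "C \<lhd> G" unfolding C_def using normal_Int[OF N centralizer_normal[OF Wn]] .
  \<comment> \<open>Otherwise take a chief factor \<open>L / (C \<inter> W)\<close> with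
    \<open>L \<subseteq> C\<close>. If it is a p-group, so is \<open>L\<close>, and
    \<open>L \<subseteq> W\<close>. If it is a p'-group, then \<open>C \<inter> W\<close> is central
    in \<open>L\<close>, and the normal complement is a p'-subgroup of \<open>N\<close>, hence
    trivial.\<close>
  have CW: "C \<subseteq> W"
  proof (rule ccontr)
    assume nle: "\<not> C \<subseteq> W"
    have Zn: "C \<inter> W \<lhd> G" using normal_Int[OF Cn Wn] .
    note Zs = normal_subgroup[OF Zn]
    obtain z where z: "card (C \<inter> W) = p ^ z"
      using card_subgroup_p_power[OF p Ws w Zs] by auto
    obtain L where L: "chief_factor G L (C \<inter> W)" "L \<subseteq> C"
      using ex_chief_factor_above[OF Zn Cn] nle by blast
    note LD = chief_factorD[OF L(1)]
    note Ls = normal_subgroup[OF LD(1)]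
    have LN: "L \<subseteq> N" using L(2) by (auto simp: C_def)
    have cL: "card L = (card L div card (C \<inter> W)) * card (C \<inter> W)"
      using card_index_mult[OF Zs Ls] LD(3) by auto
    show False
    proof (cases "\<exists>n. card L div card (C \<inter> W) = p ^ n")
      case True
      then obtain n where "card L = p ^ (n + z)" using cL z by (metis power_add)
      then have "L \<subseteq> W" using Wmax[OF LD(1) LN] by blast
      then show False using L(2) LD(3) by blast
    next
      case False
      then have nd: "\<not> p dvd card L div card (C \<inter> W)" using sol[OF L(1) LN] by blast
      have "x \<otimes> e = e \<otimes> x" if "x \<in> C \<inter> W" "e \<in> L" for x e
      proof -
        have "e \<in> centralizer W" "x \<in> W" using that L(2) by (auto simp: C_def)
        then have "conjugate e x = x" "e \<in> carrier G" by (auto simp: centralizer_def)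
        then show ?thesis
          using conjugate_fixed_iff[of e x] subgroup.mem_carrier[OF Ws \<open>x \<in> W\<close>] by simp
      qed
      moreover have "coprime (card (C \<inter> W)) (card L div card (C \<inter> W))"
        using nd z p prime_imp_coprime by auto
      ultimately obtain Q where Q: "Q \<lhd> G" "Q \<subseteq> L" "card Q = card L div card (C \<inter> W)"
        using central_complement[OF Zn LD(1)] LD(3) by (metis psubset_imp_subset)
      then have "Q = {\<one>}" using no_p' nd LN by auto
      then have "card L div card (C \<inter> W) = 1" using Q(3) by simp
      then have "card L = card (C \<inter> W)" using cL by (metis mult_1)
      then show False using psubset_card_mono[OF finite_subgroup[OF Ls] LD(3)] by simp
    qed
  qed
  \<comment> \<open>Induction on the order: a minimal normal subgroup \<open>R\<close> of order
    \<open>p\<close> splits off from \<open>Y\<close>, and the complement \<open>Y'\<close> is again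
    normal in \<open>G\<close> and below \<open>W\<close>. A p-group acts trivially on
    \<open>R\<close>, since it fixes a generator.\<close>
  have below_W: "(\<forall>g\<in>P. \<forall>y\<in>Y. conjugate g y = y) \<and> supersoluble_between G p {\<one>} Y"
    if "Y \<lhd> G" "Y \<subseteq> W" for Y
    using that
  proof (induction "card Y" arbitrary: Y rule: less_induct)
    case less
    note Y = less.prems
    note Ys = normal_subgroup[OF Y(1)]
    note Yc = subgroup.mem_carrier[OF Ys] and Pc = subgroup.mem_carrier[OF Ps]
    show ?case
    proof (cases "Y = {\<one>}")
      case True
      then show ?thesis using Pc by (simp add: supersoluble_between_refl)
    next
      case False
      then obtain R where R: "chief_factor G R {\<one>}" "R \<subseteq> Y"
        using ex_chief_factor_above[OF one_is_normal Y(1)] subgroup.one_closed[OF Ys] by blast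
      note RD = chief_factorD[OF R(1)]
      note Rs = normal_subgroup[OF RD(1)]
      obtain r where r: "card R = p ^ r"
        using card_subgroup_p_power[OF p Ws w Rs] R(2) Y(2) by auto
      have "card R \<noteq> 1"
      proof
        assume "card R = 1"
        then obtain x where "R = {x}" by (rule card_1_singletonE)
        then show False using RD(3) subgroup.one_closed[OF Rs] by auto
      qed
      then have "p dvd card R" using r by (cases r) auto
      then obtain M where cR: "card R = p" and M: "maximal_subgroup M (G\<lparr>carrier := P\<rparr>)" "\<not> R \<subseteq> M"
        using minimal[OF R(1)] R(2) Y(2) WN by blast
      have conjR: "\<And>g x. g \<in> P \<Longrightarrow> x \<in> R \<Longrightarrow> conjugate g x \<in> R"
        using normal_conjugate[OF RD(1)] Pc by blast
      have RP: "R \<subseteq> P" using R(2) Y(2) WP by auto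
      obtain z where z: "z \<in> R" "z \<noteq> \<one>" "\<And>g. g \<in> P \<Longrightarrow> conjugate g z = z"
        using p_subgroup_fixes_element[OF p Ps k Rs r _ conjR] RD(3) by blast
      have Rc: "\<And>x. x \<in> R \<Longrightarrow> x \<in> carrier G" using subgroup.mem_carrier[OF Rs] .
      have gen: "range (\<lambda>k::nat. z [^] k) = R"
        by (rule prime_order_generator[OF p Rs cR z(1,2)])
      have central: "conjugate g x = x" if g: "g \<in> P" and x: "x \<in> R" for g x
      proof -
        obtain k :: nat where "x = z [^] k" using gen x by auto
        then show ?thesis using z(3)[OF g] g Pc Rc[OF z(1)] by (simp add: conjugate_pow)
      qed
      have YP: "Y \<subseteq> P" using Y(2) WP by auto
      obtain Y' where Y': "Y' \<lhd> G" "Y' \<subseteq> Y" "R \<inter> Y' = {\<one>}" "R <#> Y' = Y"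
        by (rule normal_complement_by_averaging[OF p P RD(1) cR central M Y(1) YP R(2)])
      note Y's = normal_subgroup[OF Y'(1)]
      have cY: "card Y = p * card Y'" using card_set_mult[OF Rs Y's] Y' cR by simp
      then have "card Y' < card Y"
        using card_subgroup_pos[OF Y's] prime_gt_1_nat[OF p] by simp
      then have IH: "\<forall>g\<in>P. \<forall>y\<in>Y'. conjugate g y = y" "supersoluble_between G p {\<one>} Y'"
        using less.hyps[of Y'] Y' Y(2) by auto
      have "conjugate g y = y" if g: "g \<in> P" and y: "y \<in> Y" for g y
      proof -
        obtain a b where "a \<in> R" "b \<in> Y'" "y = a \<otimes> b" using y Y'(4) mem_set_mult by blast
        then show ?thesis
          using IH(1) central g Pc Rc subgroup.mem_carrier[OF Y's] by (simp add: conjugate_mult)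
      qed
      moreover have "card Y div card Y' = p" using cY card_subgroup_pos[OF Y's] by simp
      then have "supersoluble_between G p Y' Y"
        using supersoluble_between_prime_index[OF p Y'(1) Y(1)] by simp
      then have "supersoluble_between G p {\<one>} Y"
        using supersoluble_between_trans[OF one_is_normal Y'(1) Y(1) _ Y'(2) IH(2)]
          subgroup.one_closed[OF Y's] by simp
      ultimately show ?thesis by blast
    qed
  qed
  have "P \<inter> N \<subseteq> C"
    using below_W[OF Wn] subgroup.mem_carrier[OF Ps] by (auto simp: C_def centralizer_def)
  then have "P \<inter> N = W" using CW WP WN by blast
  then have "\<not> p dvd card N div card W" using p_sylow_index_normal[OF P N] by simp
  then have "supersoluble_between G p W N"
    by (rule supersoluble_between_p'[OF Wn N])
  then show ?thesis
    using supersoluble_between_trans[OF one_is_normal Wn N _ WN] below_W[OF Wn]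
      subgroup.one_closed[OF Ws] by simp
qed

end

subsection \<open>Saturation\<close>

context finite_group
begin

text \<open>The centralizer of the section \<open>X / Y\<close>, taken as a subgroup of
  \<open>G\<close> itself so that the centralizers of different sections can be intersected.\<close>

definition factor_centralizer :: "'a set \<Rightarrow> 'a set \<Rightarrow> 'a set" where
  "factor_centralizer X Y = {g \<in> carrier G. \<forall>x\<in>X. Y #> conjugate g x = Y #> x}"

lemma factor_centralizer_preimage:
  assumes X: "X \<lhd> G" and Y: "Y \<lhd> G"
  shows "factor_centralizer X Y = finite_epimorphism.preimage G ((#>) Y)
    (group.centralizer (G Mod Y) ((#>) Y ` X))"
proof -
  interpret q: finite_epimorphism G "G Mod Y" "(#>) Y"
    by (rule quotient_epimorphism(1)[OF Y])
  have "q.H.conjugate (Y #> g) (Y #> x) = Y #> conjugate g x" if "g \<in> carrier G" "x \<in> X" for g x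
    using q.hom_conjugate[OF that(1), of x] that subgroup.mem_carrier[OF normal_subgroup[OF X]] by simp
  then show ?thesis
    unfolding factor_centralizer_def q.preimage_def q.H.centralizer_def by auto
qed

lemma factor_centralizer_normal:
  assumes X: "X \<lhd> G" and Y: "Y \<lhd> G"
  shows "factor_centralizer X Y \<lhd> G"
proof -
  interpret q: finite_epimorphism G "G Mod Y" "(#>) Y"
    by (rule quotient_epimorphism(1)[OF Y])
  show ?thesis
    unfolding factor_centralizer_preimage[OF assms]
    by (intro q.preimage_normal q.H.centralizer_normal q.image_normal X)
qed

lemma prime_index_factor:
  assumes p: "prime p" and X: "X \<lhd> G" and Y: "Y \<lhd> G" "Y \<subseteq> X"
    and ix: "card X div card Y = p" and g: "g \<in> carrier G" and h: "h \<in> carrier G"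
  shows "g \<otimes> h \<otimes> inv (h \<otimes> g) \<in> factor_centralizer X Y" "g [^] (p - 1) \<in> factor_centralizer X Y"
proof -
  interpret q: finite_epimorphism G "G Mod Y" "(#>) Y"
    by (rule quotient_epimorphism(1)[OF Y(1)])
  note ker = quotient_epimorphism(2)[OF Y(1)]
  note Xs = normal_subgroup[OF X] and Ys = normal_subgroup[OF Y(1)]
  let ?X = "(#>) Y ` X"
  have Xn: "?X \<lhd> G Mod Y" by (rule q.image_normal[OF X])
  note Xc = subgroup.mem_carrier[OF q.H.normal_subgroup[OF Xn]]
  have cX: "card ?X = p"
    using q.card_image_Ker[OF Xs] ker Y(2) ix card_subgroup_pos[OF Ys] by simp
  have hc: "Y #> g \<in> carrier (G Mod Y)" "Y #> h \<in> carrier (G Mod Y)"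
    using g h q.hom_closed by auto
  let ?g = "Y #> g" and ?h = "Y #> h"
  have "q.H.conjugate (?g \<otimes>\<^bsub>G Mod Y\<^esub> ?h \<otimes>\<^bsub>G Mod Y\<^esub> inv\<^bsub>G Mod Y\<^esub> (?h \<otimes>\<^bsub>G Mod Y\<^esub> ?g)) x = x"
    if x: "x \<in> ?X" for x
  proof -
    let ?k = "inv\<^bsub>G Mod Y\<^esub> (?h \<otimes>\<^bsub>G Mod Y\<^esub> ?g)"
    have kc: "?k \<in> carrier (G Mod Y)" "?h \<otimes>\<^bsub>G Mod Y\<^esub> ?g \<in> carrier (G Mod Y)"
      using hc by (simp_all del: mult_FactGroup)
    have kx: "q.H.conjugate ?k x \<in> ?X"
      using q.H.normal_conjugate[OF Xn kc(1) x] .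
    have "q.H.conjugate (?g \<otimes>\<^bsub>G Mod Y\<^esub> ?h \<otimes>\<^bsub>G Mod Y\<^esub> ?k) x =
        q.H.conjugate (?g \<otimes>\<^bsub>G Mod Y\<^esub> ?h) (q.H.conjugate ?k x)"
      using hc kc Xc[OF x] by (simp add: q.H.conjugate_conjugate del: mult_FactGroup)
    also have "\<dots> = q.H.conjugate (?h \<otimes>\<^bsub>G Mod Y\<^esub> ?g) (q.H.conjugate ?k x)"
      by (rule q.cod.commutator_centralizes_prime_order[OF p Xn cX hc kx])
    also have "\<dots> = x"
      by (rule q.H.conjugate_inverse(1)[OF kc(2) Xc[OF x]])
    finally show ?thesis .
  qed
  then show "g \<otimes> h \<otimes> inv (h \<otimes> g) \<in> factor_centralizer X Y"
    unfolding factor_centralizer_preimage[OF X Y(1)] q.preimage_def q.H.centralizer_def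
    using g h hc by (simp del: mult_FactGroup)
  have "q.H.conjugate (?g [^]\<^bsub>G Mod Y\<^esub> (p - 1)) x = x" if "x \<in> ?X" for x
    by (rule q.cod.power_centralizes_prime_order[OF p Xn cX hc(1) that])
  then show "g [^] (p - 1) \<in> factor_centralizer X Y"
    unfolding factor_centralizer_preimage[OF X Y(1)] q.preimage_def q.H.centralizer_def
    using g hc q.hom_nat_pow[OF g, of "p - 1"] by simp
qed

text \<open>Interchanges two factors: \<open>E / K\<close> of order prime to \<open>p\<close> above
  \<open>K / K'\<close> of order \<open>p\<close> becomes \<open>E / E'\<close> of order
  \<open>p\<close> above \<open>E' / K'\<close> of order prime to \<open>p\<close>. It is
  \<open>central_complement\<close> applied in \<open>G / K'\<close>.\<close>

lemma relative_central_complement: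
  assumes p: "prime p" and K': "K' \<lhd> G" and K: "K \<lhd> G" "K' \<subseteq> K" and E: "E \<lhd> G" "K \<subseteq> E"
    and central: "E \<subseteq> factor_centralizer K K'" and ix: "card K div card K' = p"
    and nd: "\<not> p dvd card E div card K"
  obtains E' where "E' \<lhd> G" "K' \<subseteq> E'" "E' \<subseteq> E" "card E' div card K' = card E div card K"
proof -
  interpret q: finite_epimorphism G "G Mod K'" "(#>) K'"
    by (rule quotient_epimorphism(1)[OF K'])
  note ker = quotient_epimorphism(2)[OF K']
  note s = normal_subgroup[OF K'] normal_subgroup[OF K(1)] normal_subgroup[OF E(1)]
  have KE: "K' \<subseteq> E" using K(2) E(2) by auto
  let ?K = "(#>) K' ` K" and ?E = "(#>) K' ` E"
  have n: "?K \<lhd> G Mod K'" "?E \<lhd> G Mod K'"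
    using q.image_normal K(1) E(1) by auto
  have cK: "card ?K = p"
    using q.card_image_Ker[OF s(2)] ker K(2) ix card_subgroup_pos[OF s(1)] by simp
  have cE: "card ?E div card ?K = card E div card K"
    using q.card_image_Ker[OF s(2)] q.card_image_Ker[OF s(3)] ker K(2) KE card_subgroup_pos[OF s(1)]
    by simp
  have "z \<otimes>\<^bsub>G Mod K'\<^esub> e = e \<otimes>\<^bsub>G Mod K'\<^esub> z" if z: "z \<in> ?K" and e: "e \<in> ?E" for z e
  proof -
    have "e \<in> q.H.centralizer ?K"
      using e central unfolding factor_centralizer_preimage[OF K(1) K'] q.preimage_def by auto
    then have ec: "e \<in> carrier (G Mod K')" "q.H.conjugate e z = z"
      using z by (auto simp: q.H.centralizer_def)
    have "z \<in> carrier (G Mod K')"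
      using z subgroup.mem_carrier[OF q.H.normal_subgroup[OF n(1)]] by blast
    then show ?thesis using q.H.conjugate_fixed_iff[of e z] ec by (simp del: mult_FactGroup)
  qed
  moreover have "coprime (card ?K) (card ?E div card ?K)"
    using cK cE nd p prime_imp_coprime by auto
  ultimately obtain Q where Q: "Q \<lhd> G Mod K'" "Q \<subseteq> ?E" "card Q = card ?E div card ?K"
    using q.cod.central_complement[OF n] E(2) by (metis image_mono)
  note Qs = q.H.normal_subgroup[OF Q(1)]
  have "card (q.preimage Q) = (card E div card K) * card K'"
    using q.card_preimage[OF Qs] Q(3) cE ker by simp
  then have "card (q.preimage Q) div card K' = card E div card K"
    using card_subgroup_pos[OF s(1)] by simp
  moreover have "q.preimage Q \<subseteq> E"
    using Q(2) q.mem_image_iff[OF s(3)] ker KE unfolding q.preimage_def by blast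
  moreover have "K' \<subseteq> q.preimage Q" using q.Ker_subset_preimage[OF Qs] ker by simp
  ultimately show thesis using that q.preimage_normal[OF Q(1)] by blast
qed

lemma normal_Inter:
  assumes "\<And>H. H \<in> \<H> \<Longrightarrow> H \<lhd> G"
  shows "carrier G \<inter> \<Inter>\<H> \<lhd> G"
  unfolding normal_iff_conjugate
  using subgroup_carrier_Inter[of \<H>] assms normal_subgroup normal_conjugate by auto

text \<open>For \<open>R = 1\<close> and \<open>D = G\<close> this is \<open>p\<close>-nilpotency of a \<open>p\<close>-supersoluble group that centralizes its
  chief factors of order \<open>p\<close>.\<close>

lemma ex_relative_p_complement:
  assumes p: "prime p" and R: "R \<lhd> G" and D: "D \<lhd> G" "R \<subseteq> D"
    and ss: "supersoluble_between G p R (carrier G)"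
    and central: "\<And>X Y. chief_factor G X Y \<Longrightarrow> R \<subseteq> Y \<Longrightarrow> card X div card Y = p \<Longrightarrow> D \<subseteq> factor_centralizer X Y"
  obtains E m where "E \<lhd> G" "R \<subseteq> E" "E \<subseteq> D" "\<not> p dvd card E div card R" "card D div card E = p ^ m"
proof -
  \<comment> \<open>Says that \<open>D / K\<close> has a normal p-complement \<open>E / K\<close>.
    The property descends from \<open>K = D\<close> to \<open>K = R\<close> along chief factors: a
    p'-factor is absorbed into \<open>E\<close>, a factor of order \<open>p\<close> is moved above
    it.\<close>
  let ?good = "\<lambda>K. \<exists>E. E \<lhd> G \<and> K \<subseteq> E \<and> E \<subseteq> D \<and> \<not> p dvd card E div card K \<and> (\<exists>m. card D div card E = p ^ m)"
  let ?Q = "\<lambda>K. K \<lhd> G \<and> R \<subseteq> K \<and> K \<subseteq> D \<and> ?good K"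
  note Ds = normal_subgroup[OF D(1)]
  have Q0: "?Q D"
    using D card_subgroup_pos[OF Ds] p
    by (auto intro!: exI[of _ D] exI[of _ "0::nat"])
  have Q_carrier: "X \<subseteq> carrier G" if "?Q X" for X
    using that subgroup.subset[OF Ds] by blast
  obtain K where K: "?Q K" "\<And>X. ?Q X \<Longrightarrow> X \<subseteq> K \<Longrightarrow> X = K"
    using ex_minimal_set[of ?Q, OF Q0 Q_carrier] by blast
  have Kn: "K \<lhd> G" and RK: "R \<subseteq> K" and KD: "K \<subseteq> D" using K(1) by auto
  obtain E m where E: "E \<lhd> G" "K \<subseteq> E" "E \<subseteq> D" "\<not> p dvd card E div card K" "card D div card E = p ^ m"
    using K(1) by blast
  have "K = R"
  proof (rule ccontr)
    assume "K \<noteq> R"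
    then obtain K' where K': "chief_factor G K K'" "R \<subseteq> K'"
      using ex_chief_factor_below[OF R _ Kn] RK by blast
    note KD' = chief_factorD[OF K'(1)]
    have K'K: "K' \<subseteq> K" using KD'(3) by blast
    note s = normal_subgroup[OF KD'(2)] normal_subgroup[OF Kn] normal_subgroup[OF E(1)]
    have nS: "\<not> ?Q K'" using K(2)[of K'] KD'(3) by blast
    have "card K div card K' = p \<or> \<not> p dvd card K div card K'"
      using ss K' subgroup.subset[OF s(2)] unfolding supersoluble_between_def by blast
    then show False
    proof
      assume nd: "\<not> p dvd card K div card K'"
      have "card E div card K' = (card E div card K) * (card K div card K')"
        by (rule index_mult[OF s K'K E(2)])
      then have "\<not> p dvd card E div card K'"
        using nd E(4) p by (simp add: prime_dvd_mult_iff)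
      then have "?Q K'"
        using KD' K' K'K KD E by (intro conjI exI[of _ E]) auto
      then show False using nS by contradiction
    next
      assume ix: "card K div card K' = p"
      have "E \<subseteq> factor_centralizer K K'"
        using central[OF K'(1,2) ix] E(3) by blast
      then obtain E' where E': "E' \<lhd> G" "K' \<subseteq> E'" "E' \<subseteq> E" "card E' div card K' = card E div card K"
        using relative_central_complement[OF p KD'(2) Kn K'K E(1,2) _ ix E(4)] by blast
      note E's = normal_subgroup[OF E'(1)]
      have "card E = (card E div card K) * (p * card K')"
        using card_index_mult[OF s(2,3) E(2)] card_index_mult[OF s(1,2) K'K] ix by simp
      also have "\<dots> = p * card E'"
        using card_index_mult[OF s(1) E's E'(2)] E'(4) by (simp add: mult.left_commute)
      finally have "card D = (p ^ m * p) * card E'"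
        using card_index_mult[OF s(3) Ds E(3)] E(5) by (simp add: mult.assoc)
      then have "card D div card E' = p ^ Suc m"
        using card_subgroup_pos[OF E's] by (simp add: mult.commute)
      then have "\<exists>m. card D div card E' = p ^ m" by blast
      moreover have "E' \<subseteq> D" "K' \<subseteq> D" "\<not> p dvd card E' div card K'"
        using E'(3,4) E(3,4) K'K KD by auto
      ultimately have "?Q K'"
        using KD'(2) K'(2) E'(1,2) by blast
      then show False using nS by contradiction
    qed
  qed
  then show thesis using that E by blast
qed

text \<open>\<open>R\<close> acts on itself with a nontrivial fixed point, so its center is
  nontrivial, normal in \<open>G\<close>, and equal to \<open>R\<close>. The elements with trivial
  \<open>p\<close>-th power then form a normal subgroup, which is nontrivial and hence also
  \<open>R\<close>.\<close>

lemma minimal_normal_elementary_abelian: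
  assumes p: "prime p" and cf: "chief_factor G R {\<one>}" and n: "card R = p ^ n"
  shows "\<And>x y. x \<in> R \<Longrightarrow> y \<in> R \<Longrightarrow> x \<otimes> y = y \<otimes> x" "\<And>x. x \<in> R \<Longrightarrow> x [^] p = \<one>"
proof -
  note RD = chief_factorD[OF cf]
  note Rs = normal_subgroup[OF RD(1)]
  note Rc = subgroup.mem_carrier[OF Rs]
  obtain z where z: "z \<in> R" "z \<noteq> \<one>" "\<And>g. g \<in> R \<Longrightarrow> conjugate g z = z"
    using p_subgroup_fixes_element[OF p Rs n Rs n _ conjugate_subgroup[OF Rs]] RD(3) by blast
  have "R \<inter> centralizer R = R"
    using z Rc normal_Int[OF RD(1) centralizer_normal[OF RD(1)]]
    by (intro chief_factor_trivial_eq[OF cf, of _ z])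
       (auto simp: mem_centralizer_iff subgroup.subset[OF Rs])
  then have "x \<in> centralizer R" if "x \<in> R" for x using that by blast
  then show comm: "x \<otimes> y = y \<otimes> x" if "x \<in> R" "y \<in> R" for x y
    using that conjugate_fixed_iff[of x y] Rc by (simp add: centralizer_def)
  define F where "F = {x \<in> R. x [^] p = \<one>}"
  have cm: "comm_group (G\<lparr>carrier := R\<rparr>)"
    using comm by (rule comm_subgroup[OF Rs])
  have Fs: "subgroup F G"
  proof (rule subgroupI)
    show "F \<subseteq> carrier G" using Rc by (auto simp: F_def)
    show "F \<noteq> {}" using subgroup.one_closed[OF Rs] by (auto simp: F_def)
    fix a assume a: "a \<in> F"
    then show "inv a \<in> F"
      using subgroup.m_inv_closed[OF Rs] Rc by (simp add: F_def nat_pow_inv)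
    fix b assume "b \<in> F"
    then show "a \<otimes> b \<in> F"
      using a comm[of a b] Rc subgroup.m_closed[OF Rs] by (simp add: F_def pow_mult_distrib)
  qed
  then have Fn: "F \<lhd> G"
    using normal_conjugate[OF RD(1)] Rc
    by (auto simp: normal_iff_conjugate F_def conjugate_pow[symmetric])
  have "\<exists>x\<in>F. x \<noteq> \<one>"
  proof (rule ccontr)
    assume "\<not> (\<exists>x\<in>F. x \<noteq> \<one>)"
    then have triv: "\<And>x. x \<in> R \<Longrightarrow> x [^] p = \<one> \<Longrightarrow> x = \<one>" by (auto simp: F_def)
    \<comment> \<open>If only the identity had trivial \<open>p\<close>-th power, the same would
      hold for iterated powers, contradicting that \<open>card R\<close> annihilates
      \<open>R\<close>.\<close>
    have "x \<in> R \<Longrightarrow> x [^] (p ^ k) = \<one> \<Longrightarrow> x = \<one>" for x k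
    proof (induction k)
      case (Suc k)
      then have "(x [^] (p ^ k)) [^] p = \<one>"
        using Rc by (simp add: nat_pow_pow mult.commute)
      moreover have "x [^] (p ^ k) \<in> R" using powers_subset[OF Rs Suc.prems(1)] by blast
      ultimately show ?case using triv Suc by blast
    qed (use Rc in simp)
    then show False using pow_card_subgroup[OF Rs z(1)] n z by auto
  qed
  then have "F = R"
    using chief_factor_trivial_eq[OF cf Fn] by (auto simp: F_def)
  then show "x [^] p = \<one>" if "x \<in> R" for x using that by (auto simp: F_def)
qed

text \<open>Each \<open>g\<close> has an eigenvector in \<open>R\<close>. As the actions commute,
  the eigenvectors for its eigenvalue form a normal subgroup, which by minimality is
  \<open>R\<close>: every \<open>g\<close> acts as a scalar. Then the powers of any \<open>z\<close>
  form a normal subgroup, so \<open>R\<close> is cyclic of exponent \<open>p\<close>.\<close>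

lemma minimal_normal_prime_order_if_abelian_action:
  assumes p: "prime p" and cf: "chief_factor G R {\<one>}" and n: "card R = p ^ n"
    and commute: "\<And>g h x. g \<in> carrier G \<Longrightarrow> h \<in> carrier G \<Longrightarrow> x \<in> R \<Longrightarrow>
      conjugate (g \<otimes> h) x = conjugate (h \<otimes> g) x"
    and power: "\<And>g x. g \<in> carrier G \<Longrightarrow> x \<in> R \<Longrightarrow> conjugate (g [^] (p - 1)) x = x"
  shows "card R = p"
proof -
  note RD = chief_factorD[OF cf]
  note Rs = normal_subgroup[OF RD(1)]
  note Rc = subgroup.mem_carrier[OF Rs]
  note el = minimal_normal_elementary_abelian[OF p cf n]
  interpret R: comm_group "G\<lparr>carrier := R\<rparr>"
    using el(1) by (rule comm_subgroup[OF Rs])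
  have pow_R: "x [^]\<^bsub>G\<lparr>carrier := R\<rparr>\<^esub> (k::nat) = x [^] k" for x k
    by (rule nat_pow_consistent[symmetric])
  obtain z where z: "z \<in> R" "z \<noteq> \<one>"
    using RD(3) subgroup.one_closed[OF Rs] by blast
  have scalar: "\<exists>b::nat. \<forall>x\<in>R. conjugate g x = x [^] b" if g: "g \<in> carrier G" for g
  proof -
    have hom: "conjugate g \<in> hom (G\<lparr>carrier := R\<rparr>) (G\<lparr>carrier := R\<rparr>)"
      using normal_conjugate[OF RD(1) g] g Rc by (auto simp: hom_def conjugate_mult)
    have iter: "(conjugate g ^^ k) x = conjugate (g [^] k) x" if "x \<in> R" for x and k :: nat
    proof (induction k)
      case (Suc k)
      then show ?case
        using g that Rc nat_pow_Suc2[OF g, of k] by (simp add: conjugate_conjugate)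
    qed (use that Rc in simp)
    obtain v and b :: nat where v: "v \<in> R" "v \<noteq> \<one>" "conjugate g v = v [^] b"
      using R.ex_eigenvector[OF p _ hom _, of z] el(2) iter power[OF g] z pow_R by auto
    define F where "F = {x \<in> R. conjugate g x = x [^] b}"
    have "subgroup F G"
    proof (rule subgroupI)
      show "F \<subseteq> carrier G" using Rc by (auto simp: F_def)
      show "F \<noteq> {}" using v by (auto simp: F_def)
      fix a assume a: "a \<in> F"
      then show "inv a \<in> F"
        using subgroup.m_inv_closed[OF Rs] Rc g by (simp add: F_def nat_pow_inv conjugate_inv)
      fix c assume "c \<in> F"
      then show "a \<otimes> c \<in> F"
        using a el(1)[of a c] Rc subgroup.m_closed[OF Rs] g
        by (simp add: F_def pow_mult_distrib conjugate_mult)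
    qed
    moreover have "conjugate h x \<in> F" if h: "h \<in> carrier G" and x: "x \<in> F" for h x
    proof -
      have xR: "x \<in> R" "conjugate g x = x [^] b" using x by (auto simp: F_def)
      have "conjugate g (conjugate h x) = conjugate h (conjugate g x)"
        using commute[OF g h xR(1)] g h Rc[OF xR(1)] by (simp add: conjugate_conjugate)
      then show ?thesis
        using xR normal_conjugate[OF RD(1) h xR(1)] h Rc by (simp add: F_def conjugate_pow)
    qed
    ultimately have "F \<lhd> G" by (simp add: normal_iff_conjugate)
    then have "F = R"
      using chief_factor_trivial_eq[OF cf, of F v] v by (auto simp: F_def)
    then show ?thesis by (auto simp: F_def)
  qed
  let ?S = "range (\<lambda>k::nat. z [^] k)"
  have "conjugate g x \<in> ?S" if g: "g \<in> carrier G" and x: "x \<in> ?S" for g x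
  proof -
    obtain k :: nat where k: "x = z [^] k" using x by blast
    obtain b :: nat where "conjugate g z = z [^] b" using scalar[OF g] z by blast
    then have "conjugate g x = z [^] (b * k)"
      using k g Rc[OF z(1)] by (simp add: conjugate_pow nat_pow_pow)
    then show ?thesis by blast
  qed
  then have "?S \<lhd> G" using powers_subgroup[OF Rc[OF z(1)]] by (simp add: normal_iff_conjugate)
  moreover have "z \<in> ?S" using nat_pow_eone[OF Rc[OF z(1)]] by (metis rangeI)
  ultimately have S: "?S = R"
    using chief_factor_trivial_eq[OF cf _ powers_subset[OF Rs z(1)] _ z(2)] by blast
  have "?S \<subseteq> (\<lambda>k::nat. z [^] k) ` {..<p}"
  proof
    fix x assume "x \<in> ?S"
    then obtain k :: nat where "x = z [^] k" by blast
    then have "x = z [^] (k mod p)"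
      using pow_cong[OF Rc[OF z(1)] el(2)[OF z(1)], of k "k mod p"] by simp
    moreover have "k mod p < p" using prime_gt_0_nat[OF p] by simp
    ultimately show "x \<in> (\<lambda>k::nat. z [^] k) ` {..<p}" by blast
  qed
  then have "card R \<le> card ((\<lambda>k::nat. z [^] k) ` {..<p})"
    using S by (metis card_mono finite_imageI finite_lessThan)
  also have "\<dots> \<le> p" using card_image_le[of "{..<p}" "\<lambda>k::nat. z [^] k"] by simp
  finally have le: "p ^ n \<le> p" using n by simp
  have "n \<noteq> 0"
  proof
    assume "n = 0"
    then have "card R = 1" using n by simp
    then obtain x where "R = {x}" by (rule card_1_singletonE)
    then show False using z subgroup.one_closed[OF Rs] by auto
  qed
  moreover have "n \<le> 1"
    using power_le_imp_le_exp[of p n 1] prime_gt_1_nat[OF p] le by simp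
  ultimately have "n = 1" by simp
  then show ?thesis using n by simp
qed

text \<open>If the \<open>p'\<close>-part \<open>E / R\<close> of the kernel \<open>D\<close> acted nontrivially on \<open>R\<close>, then \<open>R\<close> would have a
  complement, against the hypothesis that \<open>R\<close> consists of nongenerators of \<open>P\<close>.\<close>

lemma minimal_normal_prime_order:
  assumes p: "prime p" and P: "p_sylow p P G" and cf: "chief_factor G R {\<one>}"
    and n: "card R = p ^ n"
    and nongen: "\<And>B. subgroup B G \<Longrightarrow> B \<subseteq> P \<Longrightarrow> P \<subseteq> R <#> B \<Longrightarrow> B = P"
    and ss: "supersoluble_between G p R (carrier G)"
  shows "card R = p"
proof -
  note RD = chief_factorD[OF cf]
  note Rn = RD(1) and Rs = normal_subgroup[OF RD(1)]
  note Rc = subgroup.mem_carrier[OF Rs]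
  note Ps = p_sylowD(1)[OF P]
  note Pc = subgroup.mem_carrier[OF Ps]
  obtain k where k: "card P = p ^ k" using p_sylowD(3)[OF P] by blast
  note el = minimal_normal_elementary_abelian[OF p cf n]
  have RP: "R \<subseteq> P" by (rule p_sylow_contains[OF p P Rn n])
  let ?H = "{factor_centralizer X Y | X Y. chief_factor G X Y \<and> R \<subseteq> Y \<and> card X div card Y = p}"
  \<comment> \<open>With \<open>carrier G\<close> included, \<open>D\<close> is \<open>G\<close>
    when no chief factor of order \<open>p\<close> lies above \<open>R\<close>.\<close>
  define D where "D = carrier G \<inter> \<Inter>?H"
  have Dn: "D \<lhd> G"
    unfolding D_def using factor_centralizer_normal chief_factorD(1,2) by (intro normal_Inter) blast
  note Ds = normal_subgroup[OF Dn]
  have mem_D: "g \<in> D" if "g \<in> carrier G"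
    "\<And>X Y. chief_factor G X Y \<Longrightarrow> R \<subseteq> Y \<Longrightarrow> card X div card Y = p \<Longrightarrow> g \<in> factor_centralizer X Y" for g
    using that unfolding D_def by blast
  \<comment> \<open>The commutator of \<open>r\<close> in \<open>R\<close> with any \<open>x\<close>
    lies in \<open>R\<close>, hence in \<open>Y\<close>.\<close>
  have RD': "R \<subseteq> D"
  proof
    fix r assume r: "r \<in> R"
    show "r \<in> D"
    proof (rule mem_D)
      fix X Y assume XY: "chief_factor G X Y" "R \<subseteq> Y"
      note XYD = chief_factorD[OF XY(1)]
      have "Y #> conjugate r x = Y #> x" if x: "x \<in> X" for x
      proof -
        have xc: "x \<in> carrier G" using x subgroup.mem_carrier[OF normal_subgroup[OF XYD(1)]] by blast
        have "conjugate r x \<otimes> inv x = r \<otimes> conjugate x (inv r)"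
          using xc Rc[OF r] by (simp add: conjugate_def m_assoc)
        also have "\<dots> \<in> R"
          using r normal_conjugate[OF Rn xc] subgroup.m_closed[OF Rs] subgroup.m_inv_closed[OF Rs] by simp
        finally show ?thesis
          using r_coset_eq_iff[OF normal_subgroup[OF XYD(2)], of "conjugate r x" x] xc Rc[OF r] XY(2) by auto
      qed
      then show "r \<in> factor_centralizer X Y" using Rc[OF r] by (simp add: factor_centralizer_def)
    qed (rule Rc[OF r])
  qed
  obtain E m where E: "E \<lhd> G" "R \<subseteq> E" "E \<subseteq> D" "\<not> p dvd card E div card R" "card D div card E = p ^ m"
  proof (rule ex_relative_p_complement[OF p Rn Dn RD' ss])
    show "D \<subseteq> factor_centralizer X Y"
      if "chief_factor G X Y" "R \<subseteq> Y" "card X div card Y = p" for X Y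
      using that unfolding D_def by blast
  qed
  have cE: "R \<inter> centralizer E \<lhd> G"
    using normal_Int[OF Rn centralizer_normal[OF E(1)]] .
  note Es = normal_subgroup[OF E(1)]
  have E_central: "conjugate e r = r" if e: "e \<in> E" and r: "r \<in> R" for e r
  proof -
    have "R \<inter> centralizer E \<noteq> {\<one>}"
    proof
      assume triv: "R \<inter> centralizer E = {\<one>}"
      have "coprime (card R) (card E div card R)"
        using E(4) n p prime_imp_coprime by auto
      then obtain M where M: "subgroup M G" "R \<inter> M = {\<one>}" "R <#> M = carrier G"
        using complement_of_fixed_point_free[OF Rn E(1,2) el(1)] triv
          mem_centralizer_iff[OF subgroup.subset[OF Es]] Rc by blast
      \<comment> \<open>Dedekind's law turns the complement in \<open>G\<close> into a supplement of
        \<open>R\<close> in \<open>P\<close>; nongeneration then gives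
        \<open>P \<subseteq> M\<close>, so \<open>R \<subseteq> M\<close>.\<close>
      have "R <#> (M \<inter> P) = P"
        using dedekind_left[OF Ps RP subgroup.subset[OF M(1)]] M(3) subgroup.subset[OF Ps] by auto
      then have "M \<inter> P = P"
        using nongen[OF subgroup_Int[OF M(1) Ps]] by auto
      then have "R \<inter> M = R" using RP by auto
      then show False using M(2) RD(3) by auto
    qed
    then have "\<exists>z\<in>R \<inter> centralizer E. z \<noteq> \<one>"
      using subgroup.one_closed[OF normal_subgroup[OF cE]] by blast
    then have "R \<inter> centralizer E = R"
      using chief_factor_trivial_eq[OF cf cE] by blast
    then show ?thesis
      using e r mem_centralizer_iff[OF subgroup.subset[OF Es], of r] by blast
  qed
  \<comment> \<open>\<open>D\<close> is \<open>(P \<inter> D) E\<close>, where \<open>E\<close>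
    centralizes \<open>R\<close> and \<open>P\<close> fixes some nontrivial \<open>z\<close> in
    \<open>R\<close>. So \<open>D\<close> has a nontrivial fixed point in \<open>R\<close>, and
    minimality of \<open>R\<close> does the rest.\<close>
  have D_central: "conjugate d r = r" if d: "d \<in> D" and r: "r \<in> R" for d r
  proof -
    have conjR: "\<And>g x. g \<in> P \<Longrightarrow> x \<in> R \<Longrightarrow> conjugate g x \<in> R"
      using normal_conjugate[OF Rn] Pc by blast
    obtain z where z: "z \<in> R" "z \<noteq> \<one>" "\<And>g. g \<in> P \<Longrightarrow> conjugate g z = z"
      using p_subgroup_fixes_element[OF p Ps k Rs n _ conjR] RD(3) by blast
    have "conjugate x z = z" if x: "x \<in> D" for x
    proof -
      have "(P \<inter> D) <#> E = D"
        by (rule p_sylow_covers[OF p P E(1) Dn E(3,5)])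
      then obtain a e where ae: "a \<in> P" "e \<in> E" "x = a \<otimes> e"
        using x mem_set_mult[of x "P \<inter> D" E] by blast
      then have "conjugate x z = conjugate a (conjugate e z)"
        using Pc Rc[OF z(1)] subgroup.mem_carrier[OF Es] by (simp add: conjugate_conjugate)
      then show ?thesis using E_central[OF ae(2) z(1)] z(3)[OF ae(1)] by simp
    qed
    then have "z \<in> R \<inter> centralizer D"
      using z(1) Rc mem_centralizer_iff[OF subgroup.subset[OF Ds]] by blast
    then have "R \<inter> centralizer D = R"
      using chief_factor_trivial_eq[OF cf normal_Int[OF Rn centralizer_normal[OF Dn]]] z(2) by blast
    then show ?thesis
      using d r mem_centralizer_iff[OF subgroup.subset[OF Ds], of r] by blast
  qed
  show ?thesis
  proof (rule minimal_normal_prime_order_if_abelian_action[OF p cf n])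
    fix g x assume g: "g \<in> carrier G" and x: "x \<in> R"
    show "conjugate (g [^] (p - 1)) x = x"
    proof (rule D_central[OF mem_D x])
      fix X Y assume "chief_factor G X Y" "card X div card Y = p"
      then show "g [^] (p - 1) \<in> factor_centralizer X Y"
        using prime_index_factor(2)[OF p _ _ _ _ g g] chief_factorD(1-3) by blast
    qed (use g in simp)
    fix h assume h: "h \<in> carrier G"
    let ?d = "g \<otimes> h \<otimes> inv (h \<otimes> g)"
    have hx: "conjugate (h \<otimes> g) x \<in> R" using normal_conjugate[OF Rn _ x] g h by simp
    have "g \<otimes> h = ?d \<otimes> (h \<otimes> g)"
      using g h by (simp add: m_assoc inv_mult_group)
    then have "conjugate (g \<otimes> h) x = conjugate ?d (conjugate (h \<otimes> g) x)"
      using g h Rc[OF x] by (metis conjugate_conjugate inv_closed m_closed)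
    also have "\<dots> = conjugate (h \<otimes> g) x"
    proof (rule D_central[OF mem_D hx])
      fix X Y assume "chief_factor G X Y" "card X div card Y = p"
      then show "?d \<in> factor_centralizer X Y"
        using prime_index_factor(1)[OF p _ _ _ _ g h] chief_factorD(1-3) by blast
    qed (use g h in simp)
    finally show "conjugate (g \<otimes> h) x = conjugate (h \<otimes> g) x" .
  qed
qed

end

subsection \<open>The \<open>\<Pi>\<close>-property\<close>

context finite_group
begin

lemma index_normalizer_eq_1_iff:
  assumes A: "subgroup A G"
  shows "card (rcosets (normalizer G A)) = 1 \<longleftrightarrow> A \<lhd> G"
proof -
  note sub = normalizer_imp_subgroup[OF subgroup.subset[OF A]]
  have "card (rcosets (normalizer G A)) = 1 \<longleftrightarrow> card (normalizer G A) = card (carrier G)"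
    using lagrange[OF sub] card_subgroup_pos[OF sub] by (auto simp: order_def)
  also have "\<dots> \<longleftrightarrow> normalizer G A = carrier G"
    using subgroup.subset[OF sub] finite_carrier by (metis card_subset_eq)
  also have "\<dots> \<longleftrightarrow> A \<lhd> G"
  proof
    assume "normalizer G A = carrier G"
    then have "conjugate g x \<in> A" if "g \<in> carrier G" "x \<in> A" for g x
      using that mem_normalizer[OF subgroup.subset[OF A], of g] by blast
    then show "A \<lhd> G" using A by (simp add: normal_iff_conjugate)
  next
    assume "A \<lhd> G"
    then have "carrier G \<subseteq> normalizer G A"
      using mem_normalizer_subgroup[OF A] normal_conjugate by blast
    then show "normalizer G A = carrier G" using subgroup.subset[OF sub] by blast
  qed
  finally show ?thesis .
qed

lemma quotient_image_set_mult:
  assumes H: "subgroup H G" and K: "K \<lhd> G"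
  shows "(#>) K ` (H <#> K) = (#>) K ` H"
proof
  note Ks = normal_subgroup[OF K]
  show "(#>) K ` H \<subseteq> (#>) K ` (H <#> K)"
    using subset_set_mult_left[OF subgroup.subset[OF H] Ks] by (rule image_mono)
  have "K #> (h \<otimes> k) = K #> h" if "h \<in> H" "k \<in> K" for h k
    using that subgroup.mem_carrier[OF H] subgroup.mem_carrier[OF Ks] normal_conjugate[OF K, of h k]
      r_coset_eq_iff[OF Ks, of "h \<otimes> k" h] by (simp add: conjugate_def)
  then show "(#>) K ` (H <#> K) \<subseteq> (#>) K ` H"
    by (auto simp: mem_set_mult)
qed

text \<open>An element of \<open>H\<close> that is congruent modulo \<open>K\<close> to one of
  \<open>L\<close> lies in \<open>L\<close>, because \<open>K \<subseteq> L\<close>. The set in the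
  \<Pi>-property is thus the image of the subgroup \<open>H \<inter> L\<close>.\<close>

lemma quotient_Int_eq_image:
  assumes H: "subgroup H G" and K: "K \<lhd> G" and L: "L \<lhd> G" "K \<subseteq> L"
  shows "carrier (G\<lparr>carrier := H <#> K\<rparr> Mod K) \<inter> carrier (G\<lparr>carrier := L\<rparr> Mod K) = (#>) K ` (H \<inter> L)"
proof -
  note Ks = normal_subgroup[OF K] and Ls = normal_subgroup[OF L(1)]
  note c = subgroup.mem_carrier[OF H] subgroup.mem_carrier[OF Ks] subgroup.mem_carrier[OF Ls]
  have "h \<in> L" if h: "h \<in> H" "x \<in> L" "K #> h = K #> x" for h x
  proof -
    have "h \<otimes> inv x \<in> L" using h c r_coset_eq_iff[OF Ks, of h x] L(2) by auto
    then have "h \<otimes> inv x \<otimes> x \<in> L" using h subgroup.m_closed[OF Ls] by blast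
    then show ?thesis using h c by (simp add: m_assoc)
  qed
  then have "(#>) K ` H \<inter> (#>) K ` L = (#>) K ` (H \<inter> L)" by blast
  then show ?thesis
    using quotient_image_set_mult[OF H K] by (simp add: carrier_FactGroup)
qed

lemma Pi_property_iff:
  assumes H: "subgroup H G"
  shows "Pi_property H G \<longleftrightarrow> (\<forall>L K. chief_factor G L K \<longrightarrow>
    pi_number {q. prime q \<and> q dvd card ((#>) K ` (H \<inter> L))}
      (card (rcosets\<^bsub>G Mod K\<^esub> (normalizer (G Mod K) ((#>) K ` (H \<inter> L))))))"
proof -
  have "carrier (G\<lparr>carrier := H <#> K\<rparr> Mod K) \<inter> carrier (G\<lparr>carrier := L\<rparr> Mod K) = (#>) K ` (H \<inter> L)"
    if "chief_factor G L K" for L K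
    using quotient_Int_eq_image[OF H] chief_factorD[OF that] by blast
  then show ?thesis
    unfolding Pi_property_def Let_def by (auto simp del: set_mult_consistent)
qed

text \<open>The image of \<open>H \<inter> L\<close> is a p-group inside a group of order
  \<open>p\<close> or prime to \<open>p\<close>, so it is trivial or everything. Either way it is
  normal, and the index 1 of its normalizer satisfies every divisibility condition.\<close>

lemma p_subgroup_Pi_property:
  assumes p: "prime p" and ss: "supersoluble_between G p {\<one>} (carrier G)"
    and H: "subgroup H G" "card H = p ^ k"
  shows "Pi_property H G"
  unfolding Pi_property_iff[OF H(1)]
proof (intro allI impI)
  fix L K assume cf: "chief_factor G L K"
  note LK = chief_factorD[OF cf]
  note Ls = normal_subgroup[OF LK(1)] and Ks = normal_subgroup[OF LK(2)]
  interpret q: finite_epimorphism G "G Mod K" "(#>) K"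
    by (rule quotient_epimorphism(1)[OF LK(2)])
  note ker = quotient_epimorphism(2)[OF LK(2)]
  let ?A = "(#>) K ` (H \<inter> L)" and ?L = "(#>) K ` L"
  have HL: "subgroup (H \<inter> L) G" by (rule subgroup_Int[OF H(1) Ls])
  note As = q.image_subgroup[OF HL]
  have AL: "?A \<subseteq> ?L" by blast
  have Ln: "?L \<lhd> G Mod K" by (rule q.image_normal[OF LK(1)])
  note Ls' = q.H.normal_subgroup[OF Ln]
  have cL: "card ?L = card L div card K"
    using q.card_image_Ker[OF Ls] ker LK(3) card_subgroup_pos[OF Ks] by auto
  have dvd: "card ?A dvd card ?L"
    by (rule q.H.card_subgroup_dvd[OF As Ls' AL])
  obtain j where "card (H \<inter> L) = p ^ j"
    using card_subgroup_p_power[OF p H HL] by auto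
  then have pow: "card ?A dvd p ^ j"
    using q.card_image[OF HL] by (metis dvd_triv_left)
  have "{\<one>} \<subseteq> K" "L \<subseteq> carrier G"
    using subgroup.one_closed[OF Ks] subgroup.subset[OF Ls] by auto
  then have "card L div card K = p \<or> \<not> p dvd card L div card K"
    using ss cf unfolding supersoluble_between_def by blast
  then have "card ?A = 1 \<or> card ?A = card ?L"
  proof
    assume "card L div card K = p"
    then show ?thesis using dvd cL p by (auto simp: prime_nat_iff)
  next
    assume "\<not> p dvd card L div card K"
    then have "\<not> p dvd card ?A" using dvd cL dvd_trans by metis
    then show ?thesis using prime_dvd_primepow_nat[OF p pow] by blast
  qed
  then have "?A \<lhd> G Mod K"
  proof
    assume "card ?A = 1"
    then obtain x where x: "?A = {x}" by (rule card_1_singletonE)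
    then have "x = \<one>\<^bsub>G Mod K\<^esub>" using subgroup.one_closed[OF As] by auto
    then show ?thesis using x q.H.one_is_normal by metis
  next
    assume "card ?A = card ?L"
    then have "?A = ?L" using q.cod.finite_subgroup[OF Ls'] AL by (metis card_subset_eq)
    then show ?thesis using Ln by simp
  qed
  then have "card (rcosets\<^bsub>G Mod K\<^esub> (normalizer (G Mod K) ?A)) = 1"
    using q.cod.index_normalizer_eq_1_iff[OF As] by blast
  then show "pi_number {q. prime q \<and> q dvd card ?A}
      (card (rcosets\<^bsub>G Mod K\<^esub> (normalizer (G Mod K) ?A)))"
    by (auto simp: pi_number_def)
qed

text \<open>The index of the normalizer is a \<open>p\<close>-number by the \<open>\<Pi>\<close>-property, and prime to \<open>p\<close> because \<open>P\<close>
  normalizes \<open>M\<close>.\<close>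

lemma Pi_property_normal:
  assumes p: "prime p" and P: "p_sylow p P G" and M: "subgroup M G" "M \<subseteq> P"
    and norm: "\<And>g x. g \<in> P \<Longrightarrow> x \<in> M \<Longrightarrow> conjugate g x \<in> M"
    and N: "N \<lhd> G" and Pi: "Pi_property (M \<inter> N) G" and cf: "chief_factor G L K" and LN: "L \<subseteq> N"
  shows "(M \<inter> L) <#> K \<lhd> G"
proof -
  note LK = chief_factorD[OF cf]
  note Ls = normal_subgroup[OF LK(1)] and Ks = normal_subgroup[OF LK(2)]
  note Ps = p_sylowD(1)[OF P]
  obtain k where k: "card P = p ^ k" using p_sylowD(3)[OF P] by blast
  interpret q: finite_epimorphism G "G Mod K" "(#>) K"
    by (rule quotient_epimorphism(1)[OF LK(2)])
  note ker = quotient_epimorphism(2)[OF LK(2)]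
  let ?A = "(#>) K ` (M \<inter> L)"
  have MiL: "subgroup (M \<inter> L) G" by (rule subgroup_Int[OF M(1) Ls])
  note As = q.image_subgroup[OF MiL]
  let ?n = "card (rcosets\<^bsub>G Mod K\<^esub> (normalizer (G Mod K) ?A))"
  have "M \<inter> N \<inter> L = M \<inter> L" using LN by auto
  then have pi: "pi_number {q. prime q \<and> q dvd card ?A} ?n"
    using Pi[unfolded Pi_property_iff[OF subgroup_Int[OF M(1) normal_subgroup[OF N]]], rule_format, OF cf]
    by simp
  obtain j where "card (M \<inter> L) = p ^ j"
    using card_subgroup_p_power[OF p Ps k MiL] M(2) by auto
  then have "card ?A dvd p ^ j"
    using q.card_image[OF MiL] by (metis dvd_triv_left)
  then have p_only: "r = p" if "prime r" "r dvd card ?A" for r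
    using that p by (metis dvd_trans prime_dvd_power primes_dvd_imp_eq)
  note Nor = q.H.normalizer_imp_subgroup[OF subgroup.subset[OF As]]
  have "(#>) K ` P \<subseteq> normalizer (G Mod K) ?A"
  proof
    fix g assume "g \<in> (#>) K ` P"
    then obtain a where a: "a \<in> P" "g = K #> a" by blast
    have ac: "a \<in> carrier G" using a(1) subgroup.mem_carrier[OF Ps] by blast
    show "g \<in> normalizer (G Mod K) ?A"
    proof (rule q.cod.mem_normalizer_subgroup[OF As])
      show "g \<in> carrier (G Mod K)" using q.hom_closed[OF ac] a(2) by simp
      fix x assume "x \<in> ?A"
      then obtain b where b: "b \<in> M \<inter> L" "x = K #> b" by blast
      have "conjugate a b \<in> M \<inter> L" using norm[OF a(1)] normal_conjugate[OF LK(1) ac] b(1) by blast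
      moreover have "q.H.conjugate g x = K #> conjugate a b"
        using q.hom_conjugate[OF ac, of b] a b subgroup.mem_carrier[OF MiL] by simp
      ultimately show "q.H.conjugate g x \<in> ?A" by blast
    qed
  qed
  moreover have sP: "subgroup ((#>) K ` P) (G Mod K)" by (rule q.image_subgroup[OF Ps])
  ultimately have "card (normalizer (G Mod K) ?A) = (card (normalizer (G Mod K) ?A) div card ((#>) K ` P)) * card ((#>) K ` P)"
    using q.cod.card_index_mult[OF _ Nor] by simp
  then have "order (G Mod K) = ?n * (card (normalizer (G Mod K) ?A) div card ((#>) K ` P)) * card ((#>) K ` P)"
    using q.H.lagrange[OF Nor] by (metis mult.assoc)
  then have "order (G Mod K) div card ((#>) K ` P) =
      ?n * (card (normalizer (G Mod K) ?A) div card ((#>) K ` P))"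
    using q.cod.card_subgroup_pos[OF sP] by (metis div_mult_self_is_m)
  then have "\<not> p dvd ?n"
    using q.cod.p_sylowD(2)[OF q.p_sylow_image[OF p P]] by auto
  \<comment> \<open>By the \<Pi>-property a prime divisor of the index divides the order of the
    p-group \<open>?A\<close>, so it is \<open>p\<close>, which was just excluded.\<close>
  then have "\<not> prime r \<or> \<not> r dvd ?n" for r
    using pi p_only unfolding pi_number_def by blast
  then have "?n = 1" using prime_factor_nat by blast
  then have An: "?A \<lhd> G Mod K" using q.cod.index_normalizer_eq_1_iff[OF As] by blast
  have "q.preimage ?A = (M \<inter> L) <#> K"
  proof -
    have B: "subgroup ((M \<inter> L) <#> K) G" by (rule subgroup_set_mult[OF MiL LK(2)])
    show ?thesis
      using q.preimage_image[OF B] quotient_image_set_mult[OF MiL LK(2)]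
        subset_set_mult_right[OF MiL subgroup.subset[OF Ks]] ker by simp
  qed
  then show ?thesis using q.preimage_normal[OF An] by simp
qed

end

section \<open>Sufficiency of the \<Pi>-property for a family of maximal subgroups\<close>

locale Pi_family = finite_group G for G (structure) +
  fixes p :: nat and P N :: "'a set" and \<M>
  assumes p: "prime p" and soluble: "p_soluble p G" and P: "p_sylow p P G" and N: "N \<lhd> G"
    and quotient: "p_supersoluble p (G Mod N)"
    and max: "\<And>M. M \<in> \<M> \<Longrightarrow> maximal_subgroup M (G\<lparr>carrier := P\<rparr>)"
    and Inter: "P \<inter> \<Inter>\<M> = frattini (G\<lparr>carrier := P\<rparr>)"
    and Pi: "\<And>M. M \<in> \<M> \<Longrightarrow> Pi_property (M \<inter> N) G"
begin

abbreviation \<Phi> where "\<Phi> \<equiv> frattini (G\<lparr>carrier := P\<rparr>)"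

lemmas Ps = p_sylowD(1)[OF P]

interpretation P: finite_group "G\<lparr>carrier := P\<rparr>"
  by (rule subgroup_finite_group[OF Ps])

lemma frattini_subset: "M \<in> \<M> \<Longrightarrow> \<Phi> \<subseteq> M" "\<Phi> \<subseteq> P"
  using Inter by auto

lemma family_member:
  assumes M: "M \<in> \<M>"
  shows "subgroup M G" "M \<subseteq> P" "card P = p * card M" "M \<noteq> P"
    "\<And>g x. g \<in> P \<Longrightarrow> x \<in> M \<Longrightarrow> conjugate g x \<in> M"
    "\<And>B. subgroup B G \<Longrightarrow> M \<subseteq> B \<Longrightarrow> B \<subseteq> P \<Longrightarrow> B = M \<or> B = P"
proof -
  obtain k where "card P = p ^ k" using p_sylowD(3)[OF P] by blast
  then have MP: "M \<lhd> G\<lparr>carrier := P\<rparr>" "card M * p = card P"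
    using P.p_group_maximal_subgroup[OF p _ max[OF M]] by (auto simp: order_def)
  show "subgroup M G" "M \<subseteq> P"
    using incl_subgroup[OF Ps] max[OF M] subgroup.subset[of M "G\<lparr>carrier := P\<rparr>"]
    by (auto simp: maximal_subgroup_def)
  show "card P = p * card M" using MP(2) by (simp add: mult.commute)
  show "M \<noteq> P" using max[OF M] by (simp add: maximal_subgroup_def)
  show "conjugate g x \<in> M" if "g \<in> P" "x \<in> M" for g x
    using P.normal_conjugate[OF MP(1)] that Ps
    by (simp add: P.conjugate_def conjugate_def m_inv_consistent)
  show "B = M \<or> B = P" if "subgroup B G" "M \<subseteq> B" "B \<subseteq> P" for B
    using max[OF M] subgroup_incl[OF that(1) Ps that(3)] that(2) by (simp add: maximal_subgroup_def)
qed

lemma frattini_nongenerator: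
  assumes "subgroup B G" "B \<subseteq> P" "P \<subseteq> \<Phi> <#> B"
  shows "B = P"
  using P.frattini_set_mult[of B] subgroup_incl[OF assms(1) Ps assms(2)] assms(3) by simp

text \<open>Some \<open>M\<close> in the family omits part of \<open>P \<inter> L\<close>. If
  \<open>M \<inter> L\<close> covered \<open>L / K\<close>, Dedekind's law would give
  \<open>P \<inter> L = (M \<inter> L) (K \<inter> P) \<subseteq> M\<close>; so
  \<open>M \<inter> L \<subseteq> K\<close>. Then \<open>P \<inter> L\<close> meets \<open>M\<close>
  in \<open>P \<inter> K\<close>, and \<open>|P : M| = p\<close> forces
  \<open>|P \<inter> L : P \<inter> K| = p\<close>, which is the order of
  \<open>L / K\<close>.\<close>

lemma chief_factor_outside_frattini:
  assumes cf: "chief_factor G L K" and LN: "L \<subseteq> N" and K: "P \<inter> K \<subseteq> \<Phi>" and L: "\<not> P \<inter> L \<subseteq> \<Phi>"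
    and ix: "card L div card K = p ^ n"
  shows "card L div card K = p \<and> (\<exists>M\<in>\<M>. \<not> P \<inter> L \<subseteq> M)"
proof -
  note LK = chief_factorD[OF cf]
  note Ls = normal_subgroup[OF LK(1)] and Ks = normal_subgroup[OF LK(2)]
  have KL: "K \<subseteq> L" using LK(3) by blast
  have PL: "subgroup (P \<inter> L) G" "subgroup (P \<inter> K) G"
    using subgroup_Int[OF Ps] Ls Ks by auto
  obtain M where M: "M \<in> \<M>" "\<not> P \<inter> L \<subseteq> M"
    using L Inter by blast
  note Mf = family_member[OF M(1)]
  have MiL: "subgroup (M \<inter> L) G" by (rule subgroup_Int[OF Mf(1) Ls])
  have KM: "P \<inter> K \<subseteq> M" using K frattini_subset(1)[OF M(1)] by auto
  let ?X = "(M \<inter> L) <#> K"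
  have "?X \<lhd> G"
    by (rule Pi_property_normal[OF p P Mf(1,2) Mf(5) N Pi[OF M(1)] cf LN])
  moreover have "K \<subseteq> ?X" "?X \<subseteq> L"
    using subset_set_mult_right[OF MiL subgroup.subset[OF Ks]] set_mult_least[OF Ls _ KL] by auto
  ultimately consider "?X = K" | "?X = L" using LK(4) by blast
  then have X: "?X = K"
  proof cases
    case 2
    have "P \<inter> L = (M \<inter> L) <#> (K \<inter> P)"
      using dedekind_left[OF Ps _ subgroup.subset[OF Ks], of "M \<inter> L"] Mf(2) 2 by blast
    also have "\<dots> \<subseteq> M"
      using KM by (intro set_mult_least[OF Mf(1)]) auto
    finally show ?thesis using M(2) by blast
  qed
  then have "M \<inter> L \<subseteq> K"
    using subset_set_mult_left[OF subgroup.subset[OF MiL] Ks] by simp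
  then have int: "(P \<inter> L) \<inter> M = P \<inter> K" using Mf(2) KM KL by blast
  have sP: "P \<inter> L \<subseteq> P" "P \<inter> L \<subseteq> carrier G" using subgroup.subset[OF Ps] by auto
  have "(P \<inter> L) <#> M = P"
  proof -
    \<comment> \<open>Neither \<open>P \<inter> L\<close> nor \<open>M\<close> need be normal in
      \<open>G\<close>; their product is recognized as a subgroup by cutting \<open>L M\<close> down
      to \<open>P\<close>.\<close>
    have "second_isomorphism_grp L G M"
      using LK(1) Mf(1) by (simp add: second_isomorphism_grp_def second_isomorphism_grp_axioms_def)
    then have "subgroup (L <#> M) G" by (rule second_isomorphism_grp.normal_set_mult_subgroup)
    moreover have "(P \<inter> L) <#> M = (L <#> M) \<inter> P"
      using dedekind_right[OF Ps Mf(2) subgroup.subset[OF Ls]] by (simp add: Int_commute)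
    ultimately have "subgroup ((P \<inter> L) <#> M) G" using subgroup_Int Ps by simp
    moreover have "M \<subseteq> (P \<inter> L) <#> M" "P \<inter> L \<subseteq> (P \<inter> L) <#> M"
      using subset_set_mult_right[OF PL(1) subgroup.subset[OF Mf(1)]]
        subset_set_mult_left[OF sP(2) Mf(1)] by auto
    moreover have "(P \<inter> L) <#> M \<subseteq> P" by (rule set_mult_least[OF Ps sP(1) Mf(2)])
    ultimately show ?thesis using Mf(6) M(2) by blast
  qed
  then have "p * card M * card (P \<inter> K) = card (P \<inter> L) * card M"
    using card_set_mult[OF PL(1) Mf(1)] int Mf(3) by simp
  then have cPL: "card (P \<inter> L) = p * card (P \<inter> K)"
    using card_subgroup_pos[OF Mf(1)] by simp
  have "(P \<inter> L) \<inter> K = P \<inter> K" using KL by auto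
  then have "card L * card (P \<inter> K) = p * card (P \<inter> K) * card K"
    using card_set_mult[OF PL(1) Ks] p_sylow_covers[OF p P LK(2,1) KL ix] cPL by simp
  then have "card L = p * card K"
    using card_subgroup_pos[OF PL(2)] by simp
  then show ?thesis using M card_subgroup_pos[OF Ks] by auto
qed

lemma supersoluble_above_frattini_part:
  assumes K: "K \<lhd> G" "K \<subseteq> N" "P \<inter> K \<subseteq> \<Phi>"
    and Kmax: "\<And>X. X \<lhd> G \<Longrightarrow> X \<subseteq> N \<Longrightarrow> P \<inter> X \<subseteq> \<Phi> \<Longrightarrow> K \<subseteq> X \<Longrightarrow> X = K"
  shows "supersoluble_between G p K N"
proof -
  interpret q: finite_epimorphism G "G Mod K" "(#>) K"
    by (rule quotient_epimorphism(1)[OF K(1)])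
  note ker = quotient_epimorphism(2)[OF K(1)]
  note Ks = normal_subgroup[OF K(1)] and Ns = normal_subgroup[OF N]
  note Pc = subgroup.mem_carrier[OF Ps]
  let ?P = "(#>) K ` P" and ?N = "(#>) K ` N"
  have KerN: "q.Ker \<subseteq> N" using ker K(2) by simp
  have pre_N: "q.preimage X \<subseteq> N" if "X \<subseteq> ?N" for X
    using that q.mem_image_iff[OF Ns KerN] unfolding q.preimage_def by blast
  have one: "q.preimage {\<one>\<^bsub>G Mod K\<^esub>} = K"
  proof -
    have "q.preimage {\<one>\<^bsub>G Mod K\<^esub>} = q.Ker" unfolding q.preimage_def kernel_def by simp
    then show ?thesis using ker by simp
  qed
  have "supersoluble_between (G Mod K) p {\<one>\<^bsub>G Mod K\<^esub>} ?N"
  proof (rule q.cod.supersoluble_below_if_minimal_normal_supplemented[OF p q.p_sylow_image[OF p P] q.image_normal[OF N]])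
    fix E assume E: "E \<lhd> G Mod K" "E \<subseteq> ?N" "\<not> p dvd card E"
    note Es = q.H.normal_subgroup[OF E(1)]
    have En: "q.preimage E \<lhd> G" by (rule q.preimage_normal[OF E(1)])
    have KE: "K \<subseteq> q.preimage E" using q.Ker_subset_preimage[OF Es] ker by simp
    have cE: "card (q.preimage E) = card E * card K"
      using q.card_preimage[OF Es] ker by simp
    then have "\<not> p dvd card (q.preimage E) div card K"
      using E(3) card_subgroup_pos[OF Ks] by simp
    then have "P \<inter> q.preimage E = P \<inter> K"
      by (rule p_sylow_Int_eq[OF p P K(1) En KE])
    then have "q.preimage E = K"
      using Kmax[OF En pre_N[OF E(2)] _ KE] K(3) by simp
    then have "card E = 1" using cE card_subgroup_pos[OF Ks] by simp
    then obtain x where "E = {x}" by (rule card_1_singletonE)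
    then show "E = {\<one>\<^bsub>G Mod K\<^esub>}" using subgroup.one_closed[OF Es] by auto
  next
    fix X Y assume XY: "chief_factor (G Mod K) X Y" "X \<subseteq> ?N"
    note XYD = chief_factorD[OF XY(1)]
    have "card (q.preimage X) div card (q.preimage Y) = card X div card Y"
      using q.card_preimage[OF q.H.normal_subgroup[OF XYD(1)]]
        q.card_preimage[OF q.H.normal_subgroup[OF XYD(2)]] q.card_Ker_pos by simp
    then show "(\<exists>n. card X div card Y = p ^ n) \<or> \<not> p dvd card X div card Y"
      using p_soluble_iff[OF soluble q.chief_factor_preimage[OF XY(1)]] by simp
  next
    fix R assume R: "chief_factor (G Mod K) R {\<one>\<^bsub>G Mod K\<^esub>}" "R \<subseteq> ?N" "p dvd card R"
    note RD = chief_factorD[OF R(1)]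
    note Rs = q.H.normal_subgroup[OF RD(1)]
    define L where "L = q.preimage R"
    have cf: "chief_factor G L K"
      using q.chief_factor_preimage[OF R(1)] one by (simp add: L_def)
    note LD = chief_factorD[OF cf]
    have LN: "L \<subseteq> N" unfolding L_def by (rule pre_N[OF R(2)])
    have ix: "card L div card K = card R"
      using q.card_preimage[OF Rs] ker card_subgroup_pos[OF Ks] by (simp add: L_def)
    obtain n where n: "card L div card K = p ^ n"
      using p_soluble_iff[OF soluble cf] ix R(3) by auto
    have "\<not> P \<inter> L \<subseteq> \<Phi>"
      using Kmax[OF LD(1) LN] LD(3) by blast
    then obtain M where cR: "card R = p" and M: "M \<in> \<M>" "\<not> P \<inter> L \<subseteq> M"
      using chief_factor_outside_frattini[OF cf LN K(3) _ n] ix by auto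
    note Mf = family_member[OF M(1)]
    note Mc = subgroup.mem_carrier[OF Mf(1)]
    have KM: "P \<inter> K \<subseteq> M" using K(3) frattini_subset(1)[OF M(1)] by auto
    \<comment> \<open>Since \<open>P \<inter> K \<subseteq> M\<close>, the subgroup \<open>M\<close>
      can be recovered inside \<open>P\<close> from its image in \<open>G / K\<close>; its
      maximality therefore passes to the image.\<close>
    have mem_M: "x \<in> M" if x: "x \<in> P" "K #> x \<in> (#>) K ` M" for x
    proof -
      obtain m where m: "m \<in> M" "K #> x = K #> m" using x(2) by blast
      have "x \<otimes> inv m \<in> K" using r_coset_eq_iff[OF Ks, of x m] m x(1) Pc Mc by simp
      moreover have "x \<otimes> inv m \<in> P"
        using x(1) m(1) Mf(2) subgroup.m_closed[OF Ps] subgroup.m_inv_closed[OF Ps] by blast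
      ultimately have "x \<otimes> inv m \<in> M" using KM by blast
      then have "x \<otimes> inv m \<otimes> m \<in> M" using m(1) subgroup.m_closed[OF Mf(1)] by blast
      then show ?thesis using x(1) m(1) Pc Mc by (simp add: m_assoc)
    qed
    let ?M = "(#>) K ` M"
    have nR: "\<not> R \<subseteq> ?M"
    proof
      assume "R \<subseteq> ?M"
      then have "P \<inter> L \<subseteq> M" using mem_M unfolding L_def q.preimage_def by blast
      then show False using M(2) by contradiction
    qed
    have sP: "subgroup ?P (G Mod K)" and sM: "subgroup ?M (G Mod K)"
      using q.image_subgroup Ps Mf(1) by auto
    have "maximal_subgroup ?M ((G Mod K)\<lparr>carrier := ?P\<rparr>)"
      unfolding maximal_subgroup_def
    proof (intro conjI allI impI)
      show "subgroup ?M ((G Mod K)\<lparr>carrier := ?P\<rparr>)"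
        using Mf(2) by (intro q.H.subgroup_incl[OF sM sP]) blast
      have "P \<subseteq> M" if eq: "?M = ?P"
      proof
        fix x assume x: "x \<in> P"
        then have "K #> x \<in> ?M" unfolding eq by (rule imageI)
        then show "x \<in> M" by (rule mem_M[OF x])
      qed
      then show "?M \<noteq> carrier ((G Mod K)\<lparr>carrier := ?P\<rparr>)" using Mf(2,4) by auto
      fix B assume B: "subgroup B ((G Mod K)\<lparr>carrier := ?P\<rparr>)" "?M \<subseteq> B"
      have BP: "B \<subseteq> ?P" using subgroup.subset[OF B(1)] by simp
      have Bs: "subgroup B (G Mod K)" by (rule q.H.incl_subgroup[OF sP B(1)])
      let ?B = "P \<inter> q.preimage B"
      have "subgroup ?B G" by (rule subgroup_Int[OF Ps q.preimage_subgroup[OF Bs]])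
      moreover have "M \<subseteq> ?B" using B(2) Mf(2) Mc unfolding q.preimage_def by blast
      ultimately have "?B = M \<or> ?B = P" using Mf(6) by blast
      moreover have "(#>) K ` ?B = B" using BP Pc unfolding q.preimage_def by blast
      ultimately show "B = ?M \<or> B = carrier ((G Mod K)\<lparr>carrier := ?P\<rparr>)" by auto
    qed
    then show "card R = p \<and> (\<exists>M. maximal_subgroup M ((G Mod K)\<lparr>carrier := ?P\<rparr>) \<and> \<not> R \<subseteq> M)"
      using cR nR by blast
  qed
  then show ?thesis
    using q.supersoluble_between_image[OF Ks _ Ns KerN] q.image_Ker ker by simp
qed

text \<open>Each p-chief factor \<open>X / Y\<close> below \<open>K\<close> is a minimal normal
  subgroup of \<open>G / Y\<close>, so \<open>minimal_normal_prime_order\<close> has to be applied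
  in a varying quotient. Nongeneration descends to such quotients directly, without identifying the
  Frattini subgroup of the image of \<open>P\<close>.\<close>

lemma supersoluble_below_frattini_part:
  assumes K: "K \<lhd> G" "P \<inter> K \<subseteq> \<Phi>" and ss: "supersoluble_between G p K (carrier G)"
  shows "supersoluble_between G p {\<one>} (carrier G)"
proof -
  let ?Q = "\<lambda>X. X \<lhd> G \<and> X \<subseteq> K \<and> supersoluble_between G p X (carrier G)"
  have Q0: "?Q K" using K ss by simp
  have Q_carrier: "X \<subseteq> carrier G" if "?Q X" for X
    using that subgroup.subset[OF normal_subgroup[OF K(1)]] by blast
  obtain X where X: "?Q X" "\<And>Z. ?Q Z \<Longrightarrow> Z \<subseteq> X \<Longrightarrow> Z = X"
    using ex_minimal_set[of ?Q, OF Q0 Q_carrier] by blast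
  have Xn: "X \<lhd> G" and XK: "X \<subseteq> K" and Xss: "supersoluble_between G p X (carrier G)"
    using X(1) by auto
  note Xs = normal_subgroup[OF Xn]
  have "X = {\<one>}"
  proof (rule ccontr)
    assume "X \<noteq> {\<one>}"
    then obtain Y where Y: "chief_factor G X Y"
      using ex_chief_factor_below[OF one_is_normal _ Xn] subgroup.one_closed[OF Xs] by blast
    note YD = chief_factorD[OF Y]
    note Ys = normal_subgroup[OF YD(2)]
    have YX: "Y \<subseteq> X" using YD(3) by blast
    interpret q: finite_epimorphism G "G Mod Y" "(#>) Y"
      by (rule quotient_epimorphism(1)[OF YD(2)])
    note ker = quotient_epimorphism(2)[OF YD(2)]
    let ?R = "(#>) Y ` X" and ?P = "(#>) Y ` P"
    have "supersoluble_between G p Y X"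
    proof (cases "\<exists>n. card X div card Y = p ^ n")
      case False
      then have "\<not> p dvd card X div card Y" using p_soluble_iff[OF soluble Y] by blast
      then show ?thesis by (rule supersoluble_between_p'[OF YD(2,1)])
    next
      case True
      then obtain n where n: "card X div card Y = p ^ n" by blast
      have cf: "chief_factor (G Mod Y) ?R {\<one>\<^bsub>G Mod Y\<^esub>}"
        using q.chief_factor_image[OF Y] q.image_Ker ker by simp
      have cR: "card ?R = card X div card Y"
        using q.card_image_Ker[OF Xs] ker YX card_subgroup_pos[OF Ys] by simp
      have "card ?R = p"
      proof (rule q.cod.minimal_normal_prime_order[OF p q.p_sylow_image[OF p P] cf])
        show "card ?R = p ^ n" using cR n by simp
        show "supersoluble_between (G Mod Y) p ?R (carrier (G Mod Y))"
          using q.supersoluble_between_image[OF Xs _ subgroup_self] Xss ker YX subgroup.subset[OF Ys] q.surj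
          by simp
        fix B assume B: "subgroup B (G Mod Y)" "B \<subseteq> ?P" "?P \<subseteq> ?R <#>\<^bsub>G Mod Y\<^esub> B"
        let ?B = "P \<inter> q.preimage B"
        have Bs: "subgroup ?B G" by (rule subgroup_Int[OF Ps q.preimage_subgroup[OF B(1)]])
        note Pc = subgroup.mem_carrier[OF Ps]
        \<comment> \<open>\<open>X = (P \<inter> X) Y\<close> and
          \<open>P \<inter> X \<subseteq> \<Phi>\<close>, so the factor from \<open>?R\<close> is
          represented by an element \<open>a\<close> of \<open>\<Phi>\<close>, and the other factor
          by \<open>inv a \<otimes> x\<close> in \<open>P\<close>.\<close>
        have "P \<subseteq> \<Phi> <#> ?B"
        proof
          fix x assume x: "x \<in> P"
          then have "Y #> x \<in> ?R <#>\<^bsub>G Mod Y\<^esub> B" using B(3) by blast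
          then obtain r b where rb: "r \<in> ?R" "b \<in> B" "Y #> x = r \<otimes>\<^bsub>G Mod Y\<^esub> b"
            unfolding q.H.mem_set_mult by blast
          obtain y where y: "y \<in> X" "r = Y #> y" using rb(1) by blast
          then obtain a c where ac: "a \<in> P \<inter> X" "c \<in> Y" "y = a \<otimes> c"
            using p_sylow_covers[OF p P YD(2,1) YX n] mem_set_mult[of y "P \<inter> X" Y] by blast
          have carr: "a \<in> carrier G" "c \<in> carrier G" "x \<in> carrier G"
            using ac x Pc subgroup.mem_carrier[OF Ys] by auto
          have ra: "r = Y #> a"
            using y(2) ac carr normal_conjugate[OF YD(2), of a c] r_coset_eq_iff[OF Ys, of "a \<otimes> c" a]
            by (simp add: conjugate_def)
          have bc: "b \<in> carrier (G Mod Y)" using subgroup.mem_carrier[OF B(1) rb(2)] .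
          have "Y #> (inv a \<otimes> x) = inv\<^bsub>G Mod Y\<^esub> (Y #> a) \<otimes>\<^bsub>G Mod Y\<^esub> (Y #> x)"
            using q.hom_mult[of "inv a" x] q.hom_inv[of a] carr by (simp del: mult_FactGroup)
          also have "\<dots> = b"
            using rb(3) ra bc q.hom_closed[OF carr(1)] by (simp del: mult_FactGroup)
          finally have "inv a \<otimes> x \<in> q.preimage B"
            using rb(2) carr by (simp add: q.preimage_def)
          moreover have "inv a \<otimes> x \<in> P"
            using ac(1) x subgroup.m_closed[OF Ps] subgroup.m_inv_closed[OF Ps] by blast
          moreover have "a \<in> \<Phi>" using ac(1) XK K(2) by blast
          moreover have "x = a \<otimes> (inv a \<otimes> x)" using carr by simp
          ultimately show "x \<in> \<Phi> <#> ?B" unfolding mem_set_mult by blast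
        qed
        then have "?B = P" using frattini_nongenerator[OF Bs] by blast
        then have "?P \<subseteq> B" unfolding q.preimage_def by blast
        then show "B = ?P" using B(2) by blast
      qed
      then show ?thesis
        using supersoluble_between_prime_index[OF p YD(2,1)] cR by simp
    qed
    then have "supersoluble_between G p Y (carrier G)"
      using supersoluble_between_trans[OF YD(2) Xn normal_carrier YX subgroup.subset[OF Xs] _ Xss] by simp
    then have "Y = X" using X(2)[of Y] YD(2) YX XK by simp
    then show False using YD(3) by blast
  qed
  then show ?thesis using Xss by simp
qed

lemma p_supersoluble_group: "p_supersoluble p G"
proof -
  interpret q: finite_epimorphism G "G Mod N" "(#>) N"
    by (rule quotient_epimorphism(1)[OF N])
  note Ns = normal_subgroup[OF N]
  have "supersoluble_between (G Mod N) p {\<one>\<^bsub>G Mod N\<^esub>} ((#>) N ` carrier G)"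
    using quotient q.cod.p_supersoluble_iff q.surj by simp
  then have top: "supersoluble_between G p N (carrier G)"
    using q.supersoluble_between_image[OF Ns _ subgroup_self] subgroup.subset[OF Ns]
      q.image_Ker quotient_epimorphism(2)[OF N] by simp
  let ?Q = "\<lambda>K. K \<lhd> G \<and> K \<subseteq> N \<and> P \<inter> K \<subseteq> \<Phi>"
  have Q0: "?Q {\<one>}"
    using one_is_normal subgroup.one_closed[OF Ns] subgroup.one_closed[OF P.frattini_subgroup] by auto
  have Q_carrier: "X \<subseteq> carrier G" if "?Q X" for X
    using that subgroup.subset[OF Ns] by blast
  obtain K where K: "?Q K" "\<And>X. ?Q X \<Longrightarrow> K \<subseteq> X \<Longrightarrow> X = K"
    using ex_maximal_set[of ?Q, OF Q0 Q_carrier] by blast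
  have Kn: "K \<lhd> G" and KN: "K \<subseteq> N" and KP: "P \<inter> K \<subseteq> \<Phi>" using K(1) by auto
  have "supersoluble_between G p K N"
    using K(2) by (intro supersoluble_above_frattini_part[OF Kn KN KP]) blast
  then have "supersoluble_between G p K (carrier G)"
    using supersoluble_between_trans[OF Kn N normal_carrier KN subgroup.subset[OF Ns] _ top] by simp
  then show ?thesis
    using supersoluble_below_frattini_part[OF Kn KP] p_supersoluble_iff by simp
qed

end

theorem theorem1:
  fixes G :: "('a, 'b) monoid_scheme" and p d :: nat and P N :: "'a set"
  assumes "group G" and "finite (carrier G)"
    and "Factorial_Ring.prime p" and "p dvd Coset.order G"
    and "p_soluble p G"
    and "sylow_subgroup p P G"
    and "N \<lhd> G" and "p_supersoluble p (G Mod N)"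
    and "p ^ d = Coset.order (G\<lparr>carrier := P\<rparr> Mod frattini (G\<lparr>carrier := P\<rparr>))"
  shows "p_supersoluble p G \<longleftrightarrow>
    (\<exists>\<M>. maximal_family (G\<lparr>carrier := P\<rparr>) d \<M> \<and> (\<forall>M\<in>\<M>. Pi_property (M \<inter> N) G))"
proof -
  interpret finite_group G
    using assms(1,2) by (simp add: finite_group_def finite_group_axioms_def)
  have P: "p_sylow p P G" by (rule sylow_subgroup_p_sylow[OF assms(3,6)])
  note Ps = p_sylowD(1)[OF P]
  obtain k where k: "card P = p ^ k" using p_sylowD(3)[OF P] by blast
  interpret P: finite_group "G\<lparr>carrier := P\<rparr>"
    by (rule subgroup_finite_group[OF Ps])
  show ?thesis
  proof
    assume "p_supersoluble p G"
    then have ss: "supersoluble_between G p {\<one>\<^bsub>G\<^esub>} (carrier G)"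
      using p_supersoluble_iff by simp
    obtain \<M> where M: "maximal_family (G\<lparr>carrier := P\<rparr>) d \<M>"
      using P.ex_maximal_family[OF assms(3) _ assms(9)] k by (auto simp: order_def)
    have "Pi_property (M \<inter> N) G" if "M \<in> \<M>" for M
    proof -
      have "subgroup M (G\<lparr>carrier := P\<rparr>)"
        using M that by (simp add: maximal_family_def maximal_subgroup_def)
      then have Ms: "subgroup M G" "M \<subseteq> P"
        using incl_subgroup[OF Ps] subgroup.subset by fastforce+
      have MN: "subgroup (M \<inter> N) G" by (rule subgroup_Int[OF Ms(1) normal_subgroup[OF assms(7)]])
      then obtain j where "card (M \<inter> N) = p ^ j"
        using card_subgroup_p_power[OF assms(3) Ps k MN] Ms(2) by auto
      then show ?thesis by (rule p_subgroup_Pi_property[OF assms(3) ss MN])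
    qed
    then show "\<exists>\<M>. maximal_family (G\<lparr>carrier := P\<rparr>) d \<M> \<and> (\<forall>M\<in>\<M>. Pi_property (M \<inter> N) G)"
      using M by blast
  next
    assume "\<exists>\<M>. maximal_family (G\<lparr>carrier := P\<rparr>) d \<M> \<and> (\<forall>M\<in>\<M>. Pi_property (M \<inter> N) G)"
    then obtain \<M> where M: "maximal_family (G\<lparr>carrier := P\<rparr>) d \<M>" "\<And>M. M \<in> \<M> \<Longrightarrow> Pi_property (M \<inter> N) G"
      by blast
    interpret Pi_family G p P N \<M>
      using M by (intro Pi_family.intro Pi_family_axioms.intro finite_group_axioms assms(3,5,7,8) P)
        (simp_all add: maximal_family_def)
    show "p_supersoluble p G" by (rule p_supersoluble_group)
  qed
qed

end
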